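(* Let $k\geq 3$ be odd, $\ell\geq 2$, and $t=\lfloor \frac{k-1}{2}\rfloor+\lfloor \frac{\ell-1}{2}\rfloor$. Then for all sufficiently large $n$: if $\ell$ is odd, $H(n,3,t+1)$ is the unique extremal graph for $C_{k,\ell}^{4}$ (i.e. the unique $n$-vertex $C_{k,\ell}^4$-free graph with the maximum number of edges); if $\ell$ is even, $H(n,3,t+2)$ is the unique extremal graph for $C_{k,\ell}^{4}$.
   Context: All graphs are finite, simple and undirected. For a graph $H$ and integer $p\geq 2$, the edge blow-up $H^{p+1}$ is the graph obtained from $H$ by replacing each edge by a clique of order $p+1$, where the new vertices of the different cliques are all distinct. The lollipop $C_{k,\ell}$ is the graph obtained from a cycle $C_k$ by appending a path $P_{\ell+1}$ (on $\ell+1$ vertices) to one of its vertices, i.e. identifying one endpoint of the path with a vertex of the cycle. $T_p(n)$ is the $p$-partite Turán graph (complete $p$-partite graph on $n$ vertices with part sizes as equal as possible). $H(n,p,q)=K_{q-1}\vee T_p(n-q+1)$, where $\vee$ denotes the join (disjoint union plus all edges between the two graphs). A graph is $F$-free if it has no subgraph isomorphic to $F$. *)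

theory Defs
  imports Main
begin

record 'a graph =
  verts :: "'a set"
  edges :: "'a set set"

definition simple_graph :: "'a graph \<Rightarrow> bool" where
  "simple_graph G \<longleftrightarrow> finite (verts G) \<and> (\<forall>e\<in>edges G. e \<subseteq> verts G \<and> card e = 2)"

definition graph_iso :: "'a graph \<Rightarrow> 'b graph \<Rightarrow> bool"  (infix "\<simeq>" 50) where
  "G \<simeq> H \<longleftrightarrow> (\<exists>f. bij_betw f (verts G) (verts H) \<and> edges H = (\<lambda>e. f ` e) ` edges G)"

definition subgraph :: "'a graph \<Rightarrow> 'a graph \<Rightarrow> bool" where
  "subgraph S G \<longleftrightarrow> simple_graph S \<and> verts S \<subseteq> verts G \<and> edges S \<subseteq> edges G"

definition graph_free :: "'f graph \<Rightarrow> 'a graph \<Rightarrow> bool" where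
  "graph_free F G \<longleftrightarrow> \<not> (\<exists>S. subgraph S G \<and> S \<simeq> F)"

definition graph_union :: "'a graph \<Rightarrow> 'a graph \<Rightarrow> 'a graph" where
  "graph_union G H = \<lparr>verts = verts G \<union> verts H, edges = edges G \<union> edges H\<rparr>"

definition graph_map :: "('a \<Rightarrow> 'b) \<Rightarrow> 'a graph \<Rightarrow> 'b graph" where
  "graph_map f G = \<lparr>verts = f ` verts G, edges = (\<lambda>e. f ` e) ` edges G\<rparr>"

definition graph_join :: "'a graph \<Rightarrow> 'b graph \<Rightarrow> ('a + 'b) graph"  (infixr "\<nabla>" 65) where
  "G \<nabla> H =
     \<lparr>verts = Inl ` verts G \<union> Inr ` verts H,
      edges = (\<lambda>e. Inl ` e) ` edges G \<union> (\<lambda>e. Inr ` e) ` edges H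
              \<union> {{Inl u, Inr v} | u v. u \<in> verts G \<and> v \<in> verts H}\<rparr>"

definition complete_graph :: "nat \<Rightarrow> nat graph" where
  "complete_graph n = \<lparr>verts = {..<n}, edges = {e. e \<subseteq> {..<n} \<and> card e = 2}\<rparr>"

text \<open>The argument is the number of vertices, as in the notation \<open>P\<^sub>m\<close>.\<close>
definition path_graph :: "nat \<Rightarrow> nat graph" where
  "path_graph m = \<lparr>verts = {..<m}, edges = {{i, i + 1} | i. i + 1 < m}\<rparr>"

definition cycle_graph :: "nat \<Rightarrow> nat graph" where
  "cycle_graph k = \<lparr>verts = {..<k}, edges = {{i, (i + 1) mod k} | i. i < k}\<rparr>"

text \<open>
  The path \<open>P\<^bsub>l+1\<^esub>\<close> is shifted to \<open>k - 1, k, \<dots>, k + l - 1\<close>, so that its first vertex,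
  and no other one, is a vertex of the cycle on \<open>0, \<dots>, k - 1\<close>.
\<close>
definition lollipop :: "nat \<Rightarrow> nat \<Rightarrow> nat graph" where
  "lollipop k l = graph_union (cycle_graph k) (graph_map (\<lambda>i. i + (k - 1)) (path_graph (l + 1)))"

text \<open>
  The edge blow-up \<open>H\<^bsup>p+1\<^esup>\<close> for \<open>p \<ge> 2\<close>: every edge \<open>e\<close> of \<open>H\<close> receives the \<open>p - 1\<close> new vertices
  \<open>(e, 0), \<dots>, (e, p - 2)\<close>, which form a clique of order \<open>p + 1\<close> together with the ends of \<open>e\<close>.
\<close>
definition blow_up_clique :: "nat \<Rightarrow> 'a set \<Rightarrow> ('a + 'a set \<times> nat) set" where
  "blow_up_clique p e = Inl ` e \<union> Inr ` ({e} \<times> {..<p - 1})"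

definition edge_blow_up :: "nat \<Rightarrow> 'a graph \<Rightarrow> ('a + 'a set \<times> nat) graph" where
  "edge_blow_up p H =
     \<lparr>verts = Inl ` verts H \<union> (\<Union>e\<in>edges H. blow_up_clique p e),
      edges = (\<Union>e\<in>edges H. {d. d \<subseteq> blow_up_clique p e \<and> card d = 2})\<rparr>"

text \<open>
  For \<open>p \<ge> 1\<close> the parts are the residue classes modulo \<open>p\<close> in \<open>0, \<dots>, n - 1\<close>, whose sizes
  differ by at most one.
\<close>
definition turan_graph :: "nat \<Rightarrow> nat \<Rightarrow> nat graph" where
  "turan_graph p n =
     \<lparr>verts = {..<n}, edges = {{i, j} | i j. i < n \<and> j < n \<and> i mod p \<noteq> j mod p}\<rparr>"

text \<open>The graph \<open>H(n, p, q)\<close>, for \<open>q \<ge> 1\<close> and \<open>n \<ge> q - 1\<close>.\<close>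
definition H_graph :: "nat \<Rightarrow> nat \<Rightarrow> nat \<Rightarrow> (nat + nat) graph" where
  "H_graph n p q = complete_graph (q - 1) \<nabla> turan_graph p (n + 1 - q)"

text \<open>
  Below, the graphs with which a given graph is compared have natural numbers as vertices;
  every finite graph is isomorphic to one of these.
\<close>
definition extremal_graph :: "'f graph \<Rightarrow> nat \<Rightarrow> 'a graph \<Rightarrow> bool" where
  "extremal_graph F n G \<longleftrightarrow>
     simple_graph G \<and> card (verts G) = n \<and> graph_free F G \<and>
     (\<forall>G' :: nat graph. simple_graph G' \<and> card (verts G') = n \<and> graph_free F G'
        \<longrightarrow> card (edges G') \<le> card (edges G))"

definition unique_extremal_graph :: "'f graph \<Rightarrow> nat \<Rightarrow> 'a graph \<Rightarrow> bool" where
  "unique_extremal_graph F n G \<longleftrightarrow>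
     extremal_graph F n G \<and> (\<forall>G' :: nat graph. extremal_graph F n G' \<longrightarrow> G' \<simeq> G)"

end

theory Submission
  imports Defs Complex_Main
begin

text \<open>
  The lollipop is a path on \<open>0, \<dots>, k + l - 1\<close> with the chord \<open>{0, k - 1}\<close>. Its positive even
  vertices, of which there are \<open>s = (k + l - 1) div 2\<close>, cover all edges except \<open>{0, 1}\<close>, while the
  cliques of the blow-up cannot be met by \<open>s\<close> vertices. Hence \<open>K\<^sub>s \<or> T\<^sub>3(n - s)\<close> is free of the
  blow-up, but an additional edge in a part, or one more vertex with many neighbours in every
  part, creates a copy.

  Conversely, deleting vertices of small degree reduces the extremal problem to graphs of minimum
  degree at least \<open>2 n / 3\<close>. Such a graph contains a large complete tripartite graph, and sorting
  the vertices by their adjacency to it gives three nearly independent parts of size about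
  \<open>n / 3\<close> and a few exceptional vertices. Vertices with linearly many neighbours in all three
  parts are the apex vertices: there are at most \<open>s\<close> of them, because any two of them have many
  common neighbours in some part and some two even in two parts. A vertex with two neighbours in
  a part excludes large matchings inside that part, so few edges lie inside parts. Counting edges
  then forces exactly \<open>s\<close> apex vertices, all of nearly full degree, no edge inside a part, and
  finally the structure of \<open>K\<^sub>s \<or> T\<^sub>3(n - s)\<close>.
\<close>

section \<open>Neighbourhoods, edge counts and greedy embeddings\<close>

text \<open>The number \<open>s\<close> is t for odd l and t + 1 for even l, so both cases are one
  statement. Oddness of k enters twice: k - 1 is even, so the even vertices also meet the chord, and
  meeting all edges of an odd cycle takes one vertex more than half its length rounded down, which
  makes \<open>s\<close> vertices too few for the cliques. The main obstacle is the border between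
  apex vertices and vertices of a part. A vertex with moderately many neighbours in every part is
  too sparse for an apex, given the error terms, and too dense for a part. No threshold fixed in
  advance excludes such vertices; a suitable one is found by pigeonhole among boundedly many. A copy
  through \<open>s\<close> + 1 apices needs a pair of them with many common neighbours in two parts,
  because the adjacent vertices 0 and 1 both see the additional apex. Three apices contain such a
  pair, and \<open>s\<close> \<ge> 2 provides three. The same bound makes the deletion of a vertex
  of degree below 2 n / 3 profitable, and it shows that edges inside the parts cannot make up for
  the absence of all apices.\<close>

definition nbrs :: "'a graph \<Rightarrow> 'a \<Rightarrow> 'a set" where
  "nbrs G x = {y. {x, y} \<in> edges G}"

lemma nbrs_sym: "y \<in> nbrs G x \<longleftrightarrow> x \<in> nbrs G y"
  by (simp add: nbrs_def insert_commute)

lemma nbrs_irrefl: "simple_graph G \<Longrightarrow> x \<notin> nbrs G x"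
  by (auto simp: nbrs_def simple_graph_def dest!: bspec)

lemma nbrs_in_verts: "simple_graph G \<Longrightarrow> y \<in> nbrs G x \<Longrightarrow> x \<in> verts G \<and> y \<in> verts G"
  by (auto simp: nbrs_def simple_graph_def)

lemma nbrs_subset: "simple_graph G \<Longrightarrow> nbrs G x \<subseteq> verts G"
  using nbrs_in_verts by fast

lemma finite_nbrs: "simple_graph G \<Longrightarrow> finite (nbrs G x)"
  using nbrs_subset[of G x] by (auto simp: simple_graph_def intro: finite_subset)

lemma simple_edgeE:
  assumes "simple_graph G" "e \<in> edges G"
  obtains x y where "e = {x, y}" "x \<noteq> y" "x \<in> verts G" "y \<in> verts G"
  using assms by (fastforce simp: simple_graph_def card_2_iff)

lemma finite_edges: "simple_graph G \<Longrightarrow> finite (edges G)"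
  by (rule finite_subset[of _ "Pow (verts G)"]) (auto simp: simple_graph_def)

text \<open>For \<open>X = Y\<close> every edge inside \<open>X\<close> is counted from both of its
  ends; for disjoint sets this is the number of edges between them.\<close>

definition pairs :: "'a graph \<Rightarrow> 'a set \<Rightarrow> 'a set \<Rightarrow> nat" where
  "pairs G X Y = (\<Sum>x\<in>X. card (nbrs G x \<inter> Y))"

lemma pairs_card:
  assumes "finite X" "finite Y"
  shows "pairs G X Y = card {(x, y). x \<in> X \<and> y \<in> Y \<and> y \<in> nbrs G x}"
proof -
  have "{(x, y). x \<in> X \<and> y \<in> Y \<and> y \<in> nbrs G x} = Sigma X (\<lambda>x. nbrs G x \<inter> Y)" by auto
  with assms show ?thesis by (simp add: pairs_def)
qed

lemma pairs_sym:
  assumes "finite X" "finite Y"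
  shows "pairs G X Y = pairs G Y X"
  unfolding pairs_card[OF assms] pairs_card[OF assms(2,1)]
  by (rule bij_betw_same_card[of prod.swap], rule bij_betw_byWitness[where f' = prod.swap])
    (auto simp: nbrs_sym)

lemma pairs_Un_left:
  assumes "finite X" "finite X'" "X \<inter> X' = {}"
  shows "pairs G (X \<union> X') Y = pairs G X Y + pairs G X' Y"
  using assms by (simp add: pairs_def sum.union_disjoint)

lemma pairs_Un_right:
  assumes "finite Y" "finite Y'" "Y \<inter> Y' = {}"
  shows "pairs G X (Y \<union> Y') = pairs G X Y + pairs G X Y'"
  using assms unfolding pairs_def
  by (subst sum.distrib[symmetric], intro sum.cong refl)
    (subst card_Un_disjoint[symmetric], auto simp: Int_Un_distrib)

lemma pairs_mono: "finite X' \<Longrightarrow> finite Y' \<Longrightarrow> X \<subseteq> X' \<Longrightarrow> Y \<subseteq> Y' \<Longrightarrow> pairs G X Y \<le> pairs G X' Y'"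
  unfolding pairs_def
  by (rule order_trans[OF sum_mono sum_mono2]) (auto intro!: card_mono)

lemma pairs_le: "finite Y \<Longrightarrow> pairs G X Y \<le> card X * card Y"
  unfolding pairs_def
  using sum_bounded_above[of X "\<lambda>x. card (nbrs G x \<inter> Y)" "card Y"]
  by (simp add: card_mono)

lemma handshake:
  assumes "simple_graph G"
  shows "pairs G (verts G) (verts G) = 2 * card (edges G)"
proof -
  have fin: "finite (verts G)" and fe: "finite (edges G)"
    using assms finite_edges by (auto simp: simple_graph_def)
  let ?S = "{(x, y). x \<in> verts G \<and> y \<in> verts G \<and> y \<in> nbrs G x}"
  have eq: "?S = (\<Union>e\<in>edges G. {(x, y). {x, y} = e})"
    using nbrs_in_verts[OF assms] by (auto simp: nbrs_def)
  have c2: "card {(x, y). {x, y} = e} = 2" "finite {(x, y). {x, y} = e}" if "e \<in> edges G" for e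
  proof -
    obtain a b where ab: "e = {a, b}" "a \<noteq> b" using simple_edgeE[OF assms \<open>e \<in> edges G\<close>] by metis
    then have "{(x, y). {x, y} = e} = {(a, b), (b, a)}" by (auto simp: doubleton_eq_iff)
    with ab show "card {(x, y). {x, y} = e} = 2" "finite {(x, y). {x, y} = e}" by auto
  qed
  have "card ?S = (\<Sum>e\<in>edges G. card {(x, y). {x, y} = e})"
    unfolding eq by (rule card_UN_disjoint) (use fe c2 in auto)
  also have "\<dots> = 2 * card (edges G)" using c2 by simp
  finally show ?thesis by (simp add: pairs_card fin)
qed

section \<open>Copies as injective edge-preserving maps\<close>

definition embeds :: "'f graph \<Rightarrow> 'a graph \<Rightarrow> ('f \<Rightarrow> 'a) \<Rightarrow> bool" where
  "embeds F G \<phi> \<longleftrightarrow> inj_on \<phi> (verts F) \<and> \<phi> ` verts F \<subseteq> verts G \<and> (\<forall>e\<in>edges F. \<phi> ` e \<in> edges G)"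

text \<open>The image of \<open>F\<close> under an embedding is the required subgraph; conversely,
  the inverse of an isomorphism onto \<open>F\<close> is an embedding. Embeddings can be built
  vertex by vertex, and refuted by following single cliques.\<close>

lemma graph_free_iff:
  assumes "simple_graph F"
  shows "graph_free F G \<longleftrightarrow> \<not> (\<exists>\<phi>. embeds F G \<phi>)"
proof
  assume "graph_free F G"
  show "\<nexists>\<phi>. embeds F G \<phi>"
  proof (rule notI, elim exE)
  fix \<phi> note free = \<open>graph_free F G\<close>
  assume e: "embeds F G \<phi>"
  define S where "S = graph_map \<phi> F"
  have "simple_graph S"
    unfolding simple_graph_def
  proof (intro conjI ballI)
    show "finite (verts S)" using assms by (simp add: S_def graph_map_def simple_graph_def)
    fix d assume "d \<in> edges S"
    then obtain e' where e': "e' \<in> edges F" "d = \<phi> ` e'" by (auto simp: S_def graph_map_def)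
    with assms have sub: "e' \<subseteq> verts F" "card e' = 2" by (auto simp: simple_graph_def)
    then show "d \<subseteq> verts S" by (auto simp: S_def graph_map_def e')
    show "card d = 2" using e sub by (auto simp: e' embeds_def card_image inj_on_subset)
  qed
  moreover have "S \<simeq> F"
    unfolding graph_iso_def
  proof (intro exI conjI)
    let ?g = "inv_into (verts F) \<phi>"
    show "bij_betw ?g (verts S) (verts F)"
      using e by (auto simp: S_def graph_map_def embeds_def bij_betw_inv_into inj_on_imp_bij_betw)
    have "?g ` \<phi> ` e' = e'" if "e' \<in> edges F" for e'
      using e assms that by (auto simp: embeds_def simple_graph_def intro!: inv_into_image_cancel)
    then show "edges F = (`) ?g ` edges S"
      by (force simp: S_def graph_map_def image_image)
  qed
  moreover have "verts S \<subseteq> verts G" "edges S \<subseteq> edges G"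
    using e by (auto simp: embeds_def S_def graph_map_def)
  ultimately show False using free unfolding graph_free_def subgraph_def by blast
  qed
next
  assume ne: "\<nexists>\<phi>. embeds F G \<phi>"
  show "graph_free F G"
    unfolding graph_free_def
  proof (rule notI, elim exE conjE)
    fix S :: "'b graph" assume S: "subgraph S G" "S \<simeq> F"
    then obtain f where f: "bij_betw f (verts S) (verts F)" "edges F = (`) f ` edges S"
      by (auto simp: graph_iso_def)
    let ?g = "inv_into (verts S) f"
    have im: "?g ` verts F = verts S" using f(1) by (metis bij_betw_def bij_betw_inv_into)
    have "?g ` f ` e = e" if "e \<in> edges S" for e
      using S that f(1) by (auto simp: subgraph_def simple_graph_def bij_betw_def intro!: inv_into_image_cancel)
    then have "embeds F G ?g"
      using S f im bij_betw_inv_into[OF f(1)] unfolding embeds_def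
      by (auto simp: subgraph_def bij_betw_def)
    with ne show False by blast
  qed
qed

text \<open>Every vertex \<open>v\<close> outside the prescribed set \<open>P\<close> has a list
  \<open>C v\<close> of candidates that already respects its neighbours in \<open>P\<close>. The
  vertices are placed one after another: fewer than \<open>card I\<close> candidates are occupied,
  and each placed neighbour rules out at most \<open>d\<close> more, so a list longer than
  \<open>card I * (d + 1)\<close> never runs out.\<close>

lemma greedy_embedding:
  fixes C :: "'v \<Rightarrow> 'a set"
  assumes "finite I" "P \<subseteq> I"
    and inj0: "inj_on \<phi> P"
    and hom0: "\<And>u v. u \<in> P \<Longrightarrow> v \<in> P \<Longrightarrow> R u v \<Longrightarrow> \<phi> v \<in> nbrs G (\<phi> u)"
    and symR: "\<And>u v. R u v \<Longrightarrow> R v u" and irrR: "\<And>u. \<not> R u u"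
    and finC: "\<And>v. v \<in> I - P \<Longrightarrow> finite (C v)"
    and CP: "\<And>u v. u \<in> P \<Longrightarrow> v \<in> I - P \<Longrightarrow> R u v \<Longrightarrow> C v \<subseteq> nbrs G (\<phi> u)"
    and CC: "\<And>u v x. u \<in> I - P \<Longrightarrow> v \<in> I - P \<Longrightarrow> R u v \<Longrightarrow> x \<in> C u \<Longrightarrow>
               real (card (C v - nbrs G x)) \<le> d"
    and big: "\<And>v. v \<in> I - P \<Longrightarrow> real (card (C v)) > real (card I) * (d + 1)" and "d \<ge> 0"
  shows "\<exists>\<psi>. inj_on \<psi> I \<and> (\<forall>u\<in>I. \<forall>v\<in>I. R u v \<longrightarrow> \<psi> v \<in> nbrs G (\<psi> u))"
proof -
  \<comment> \<open>The invariant keeps each new image inside its candidate list, since only for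
    such images is the number of excluded candidates bounded.\<close>
  have "\<exists>\<psi>. inj_on \<psi> (P \<union> J) \<and> (\<forall>u\<in>P. \<psi> u = \<phi> u) \<and> (\<forall>v\<in>J. \<psi> v \<in> C v) \<and>
      (\<forall>u\<in>P \<union> J. \<forall>v\<in>P \<union> J. R u v \<longrightarrow> \<psi> v \<in> nbrs G (\<psi> u))"
    if "finite J" "J \<subseteq> I - P" for J
    using that
  proof (induction J rule: finite_induct)
    case empty
    then show ?case using inj0 hom0 by (intro exI[of _ \<phi>]) auto
  next
    case (insert v J)
    then obtain \<psi> where \<psi>: "inj_on \<psi> (P \<union> J)" "\<And>u. u \<in> P \<Longrightarrow> \<psi> u = \<phi> u" "\<And>v. v \<in> J \<Longrightarrow> \<psi> v \<in> C v"
      "\<And>u v. u \<in> P \<union> J \<Longrightarrow> v \<in> P \<union> J \<Longrightarrow> R u v \<Longrightarrow> \<psi> v \<in> nbrs G (\<psi> u)" by auto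
    have vI: "v \<in> I - P" using insert by auto
    define J' where "J' = {u \<in> J. R u v}"
    define Bad where "Bad = \<psi> ` (P \<union> J) \<union> (\<Union>u\<in>J'. C v - nbrs G (\<psi> u))"
    have fin: "finite J" "finite J'" "finite P"
      using insert.hyps assms(1,2) finite_subset by (auto simp: J'_def)
    have "card (P \<union> J) < card I"
      using insert vI assms(1,2) by (intro psubset_card_mono) auto
    then have c1: "real (card (\<psi> ` (P \<union> J))) + 1 \<le> card I"
      using card_image_le[of "P \<union> J" \<psi>] fin by fastforce
    have cJ: "card J' \<le> card I"
      using insert assms(1) by (intro card_mono) (auto simp: J'_def)
    have "card (\<Union>u\<in>J'. C v - nbrs G (\<psi> u)) \<le> (\<Sum>u\<in>J'. card (C v - nbrs G (\<psi> u)))"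
      using fin card_UN_le by blast
    then have "real (card (\<Union>u\<in>J'. C v - nbrs G (\<psi> u))) \<le> (\<Sum>u\<in>J'. real (card (C v - nbrs G (\<psi> u))))"
      by (metis of_nat_le_iff of_nat_sum)
    also have "\<dots> \<le> (\<Sum>u\<in>J'. d)"
    proof (rule sum_mono)
      fix u assume "u \<in> J'"
      then have "u \<in> I - P" "R u v" "\<psi> u \<in> C u" using insert.prems \<psi>(3) by (auto simp: J'_def)
      then show "real (card (C v - nbrs G (\<psi> u))) \<le> d" using CC vI by blast
    qed
    also have "\<dots> \<le> card I * d" using cJ \<open>d \<ge> 0\<close> by (simp add: mult_right_mono)
    finally have c2: "real (card (\<Union>u\<in>J'. C v - nbrs G (\<psi> u))) \<le> card I * d" .
    have "real (card Bad) \<le> card (\<psi> ` (P \<union> J)) + card (\<Union>u\<in>J'. C v - nbrs G (\<psi> u))"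
      unfolding Bad_def of_nat_add[symmetric] of_nat_le_iff by (rule card_Un_le)
    also have "\<dots> < card I * (d + 1)" using c1 c2 by (simp add: algebra_simps)
    also have "\<dots> < card (C v)" using big[OF vI] .
    finally have "card Bad < card (C v)" by simp
    moreover have "finite Bad" using fin finC[OF vI] by (auto simp: Bad_def)
    ultimately have "\<not> C v \<subseteq> Bad" by (meson card_mono leD)
    then obtain y where y: "y \<in> C v" "y \<notin> \<psi> ` (P \<union> J)" "\<And>u. u \<in> J' \<Longrightarrow> y \<in> nbrs G (\<psi> u)"
      by (auto simp: Bad_def)
    let ?\<psi> = "\<psi>(v := y)"
    have v: "v \<notin> P \<union> J" using insert by auto
    have adj: "y \<in> nbrs G (\<psi> u)" if "u \<in> P \<union> J" "R u v" for u
    proof (cases "u \<in> P")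
      case True
      then show ?thesis using CP[OF True vI that(2)] y(1) \<psi>(2) by auto
    next
      case False
      then show ?thesis using that y(3) by (auto simp: J'_def)
    qed
    have "inj_on ?\<psi> (P \<union> insert v J)"
      using \<psi>(1) y(2) v by (auto simp: inj_on_def)
    moreover have "\<forall>u\<in>P. ?\<psi> u = \<phi> u" using \<psi>(2) vI by auto
    moreover have "\<forall>w\<in>insert v J. ?\<psi> w \<in> C w" using \<psi>(3) y(1) by auto
    moreover have "?\<psi> b \<in> nbrs G (?\<psi> a)"
      if ab: "a \<in> P \<union> insert v J" "b \<in> P \<union> insert v J" "R a b" for a b
    proof -
      consider "a = v" "b \<noteq> v" | "b = v" "a \<noteq> v" | "a \<noteq> v" "b \<noteq> v"
        using ab(3) irrR by blast
      then show ?thesis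
      proof cases
        case 1
        then have "y \<in> nbrs G (\<psi> b)" using adj ab symR by blast
        with 1 show ?thesis using nbrs_sym by fastforce
      next
        case 2
        then show ?thesis using adj ab by auto
      next
        case 3
        then show ?thesis using \<psi>(4) ab by auto
      qed
    qed
    ultimately show ?case by blast
  qed
  from this[of "I - P"] assms(1,2) show ?thesis
    by (metis Diff_partition finite_Diff order_refl)
qed

section \<open>The blow-up of a lollipop\<close>

text \<open>The lollipop has as many edges as vertices, so the indices below \<open>k + l\<close>
  number both; the index left over by the path edges goes to the chord that closes the
  cycle.\<close>

definition ends :: "nat \<Rightarrow> nat \<Rightarrow> nat \<Rightarrow> nat set" where
  "ends k l j = (if Suc j < k + l then {j, Suc j} else {k - 1, 0})"

text \<open>The code \<open>(i, 0)\<close> stands for the vertex \<open>i\<close> of the lollipop, \<open>(j, 1)\<close> and \<open>(j, 2)\<close> for the new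
  vertices of the \<open>j\<close>-th clique. That clique belongs to the edge \<open>{j, j + 1}\<close> or, for the last
  \<open>j\<close>, to the chord \<open>{0, k - 1}\<close>.\<close>
definition codes :: "nat \<Rightarrow> nat \<Rightarrow> (nat \<times> nat) set" where
  "codes k l = {..<k + l} \<times> {..<3}"

definition clq :: "nat \<Rightarrow> nat \<Rightarrow> nat \<Rightarrow> (nat \<times> nat) set" where
  "clq k l j = (if Suc j < k + l then {(j, 0), (Suc j, 0)} else {(k - 1, 0), (0, 0)}) \<union> {(j, 1), (j, 2)}"

definition code_adj :: "nat \<Rightarrow> nat \<Rightarrow> nat \<times> nat \<Rightarrow> nat \<times> nat \<Rightarrow> bool" where
  "code_adj k l u v \<longleftrightarrow> u \<noteq> v \<and> (\<exists>j<k + l. u \<in> clq k l j \<and> v \<in> clq k l j)"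

locale odd_lollipop =
  fixes k l :: nat
  assumes k3: "k \<ge> 3" and odd_k: "odd k" and l2: "l \<ge> 2"
begin

abbreviation "F \<equiv> edge_blow_up 3 (lollipop k l)"

lemma verts_lollipop: "verts (lollipop k l) = {..<k + l}"
proof -
  have "i \<in> (\<lambda>i. i + (k - 1)) ` {..<l + 1}" if "i < k + l" "\<not> i < k" for i
    using that k3 by (intro image_eqI[of _ _ "i - (k - 1)"]) auto
  then show ?thesis using k3
    by (auto simp: lollipop_def graph_union_def cycle_graph_def graph_map_def path_graph_def)
qed

lemma edges_lollipop: "edges (lollipop k l) = ends k l ` {..<k + l}"
proof -
  have e: "edges (lollipop k l) = {{i, (i + 1) mod k} | i. i < k} \<union>
      (\<lambda>e. (\<lambda>i. i + (k - 1)) ` e) ` {{i, i + 1} | i. i + 1 < l + 1}"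
    by (simp add: lollipop_def graph_union_def cycle_graph_def graph_map_def path_graph_def)
  have path: "(\<lambda>e. (\<lambda>i. i + (k - 1)) ` e) ` {{i, i + 1} | i. i + 1 < l + 1} =
      {{j, Suc j} | j. k - 1 \<le> j \<and> Suc j < k + l}"
  proof (intro equalityI subsetI)
    fix d assume "d \<in> (\<lambda>e. (\<lambda>i. i + (k - 1)) ` e) ` {{i, i + 1} | i. i + 1 < l + 1}"
    then obtain i where "i < l" "d = {i + (k - 1), Suc (i + (k - 1))}" by auto
    then show "d \<in> {{j, Suc j} | j. k - 1 \<le> j \<and> Suc j < k + l}"
      using k3 by (intro CollectI exI[of _ "i + (k - 1)"]) auto
  next
    fix d assume "d \<in> {{j, Suc j} | j. k - 1 \<le> j \<and> Suc j < k + l}"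
    then obtain j where "k - 1 \<le> j" "Suc j < k + l" "d = {j, Suc j}" by auto
    then show "d \<in> (\<lambda>e. (\<lambda>i. i + (k - 1)) ` e) ` {{i, i + 1} | i. i + 1 < l + 1}"
      using k3 by (intro image_eqI[of _ _ "{j - (k - 1), j - (k - 1) + 1}"])
        (auto intro!: exI[of _ "j - (k - 1)"])
  qed
  have cyc: "{{i, (i + 1) mod k} | i. i < k} = {{j, Suc j} | j. Suc j < k} \<union> {{k - 1, 0}}"
  proof (intro equalityI subsetI)
    fix d assume "d \<in> {{i, (i + 1) mod k} | i. i < k}"
    then obtain i where i: "i < k" "d = {i, (i + 1) mod k}" by auto
    show "d \<in> {{j, Suc j} | j. Suc j < k} \<union> {{k - 1, 0}}"
    proof (cases "Suc i < k")
      case True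
      then show ?thesis using i by auto
    next
      case False
      then have "i = k - 1" "Suc i = k" using i by auto
      then show ?thesis using i by auto
    qed
  next
    fix d assume "d \<in> {{j, Suc j} | j. Suc j < k} \<union> {{k - 1, 0}}"
    then consider j where "Suc j < k" "d = {j, Suc j}" | "d = {k - 1, 0}" by auto
    then show "d \<in> {{i, (i + 1) mod k} | i. i < k}"
    proof cases
      case 1
      then show ?thesis by (intro CollectI exI[of _ j]) auto
    next
      case 2
      then show ?thesis using k3 by (intro CollectI exI[of _ "k - 1"]) auto
    qed
  qed
  show ?thesis unfolding e path cyc
  proof (intro equalityI subsetI)
    fix d assume "d \<in> {{j, Suc j} | j. Suc j < k} \<union> {{k - 1, 0}} \<union> {{j, Suc j} | j. k - 1 \<le> j \<and> Suc j < k + l}"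
    then consider j where "Suc j < k + l" "d = {j, Suc j}" | "d = {k - 1, 0}"
      using trans_less_add1 by blast
    then show "d \<in> ends k l ` {..<k + l}"
    proof cases
      case 1
      then show ?thesis by (intro image_eqI[of _ _ j]) (auto simp: ends_def)
    next
      case 2
      then show ?thesis using k3 by (intro image_eqI[of _ _ "k + l - 1"]) (auto simp: ends_def)
    qed
  next
    fix d assume "d \<in> ends k l ` {..<k + l}"
    then obtain j where "j < k + l" "d = ends k l j" by auto
    then show "d \<in> {{j, Suc j} | j. Suc j < k} \<union> {{k - 1, 0}} \<union> {{j, Suc j} | j. k - 1 \<le> j \<and> Suc j < k + l}"
      by (cases "Suc j < k") (auto simp: ends_def)
  qed
qed

lemma ends_inj: "inj_on (ends k l) {..<k + l}"
proof (rule inj_onI)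
  fix i j assume "i \<in> {..<k + l}" "j \<in> {..<k + l}" "ends k l i = ends k l j"
  then show "i = j" using k3 l2
    by (auto simp: ends_def doubleton_eq_iff split: if_splits)
qed

lemma ends_subset: "j < k + l \<Longrightarrow> ends k l j \<subseteq> {..<k + l}"
  using k3 by (auto simp: ends_def)

lemma simple_blow_up: "simple_graph F"
proof -
  have "finite (edges (lollipop k l))" by (simp add: edges_lollipop)
  moreover have "finite (blow_up_clique 3 e)" if "e \<in> edges (lollipop k l)" for e
    using that ends_subset finite_subset unfolding edges_lollipop blow_up_clique_def by fastforce
  ultimately show ?thesis
    by (auto simp: simple_graph_def edge_blow_up_def verts_lollipop)
qed

text \<open>In a new vertex \<open>(e, b)\<close> the edge \<open>e\<close> is replaced by its
  number, and \<open>b\<close> is shifted because second component 0 is reserved for the vertices of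
  the lollipop.\<close>

definition code :: "nat + nat set \<times> nat \<Rightarrow> nat \<times> nat" where
  "code x = (case x of Inl i \<Rightarrow> (i, 0) | Inr (e, b) \<Rightarrow> (inv_into {..<k + l} (ends k l) e, Suc b))"

lemma code_clique:
  assumes "j < k + l" shows "code ` blow_up_clique 3 (ends k l j) = clq k l j"
proof -
  have "inv_into {..<k + l} (ends k l) (ends k l j) = j"
    using assms ends_inj by (simp add: inv_into_f_f)
  then have "code ` blow_up_clique 3 (ends k l j) = (\<lambda>i. (i, 0)) ` ends k l j \<union> {(j, 1), (j, 2)}"
    by (auto simp: code_def blow_up_clique_def image_Un image_image lessThan_Suc numeral_2_eq_2)
  then show ?thesis by (simp add: clq_def ends_def)
qed

lemma verts_F: "verts F = Inl ` {..<k + l} \<union> Inr ` (ends k l ` {..<k + l} \<times> {..<2})"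
  using ends_subset
  by (fastforce simp: edge_blow_up_def verts_lollipop edges_lollipop blow_up_clique_def)

lemma code_inj: "inj_on code (verts F)"
  using ends_inj by (auto simp: inj_on_def verts_F code_def inv_into_f_f)

lemma code_verts: "code ` verts F \<subseteq> codes k l"
  using ends_inj by (auto simp: verts_F code_def codes_def)

text \<open>No code is isolated. A map that preserves adjacency therefore sends every code into
  \<open>verts G\<close>, where all neighbours lie; this is how \<open>not_free_codes\<close>
  obtains that property.\<close>

lemma codes_adj_ex: 
  assumes "u \<in> codes k l" shows "\<exists>v\<in>codes k l. code_adj k l u v"
proof -
  obtain j b where u: "u = (j, b)" "j < k + l" "b < 3" using assms by (auto simp: codes_def)
  show ?thesis
  proof (cases "b = 0 \<and> Suc j = k + l")
    \<comment> \<open>The end of the tail is the only code outside the clique of its own index, as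
      the last index belongs to the chord; the preceding clique contains it.\<close>
    case True
    define i where "i = j - 1"
    have "Suc i < k + l" "j = Suc i" using True k3 u by (auto simp: i_def)
    then have "code_adj k l u (i, 1)" using True u unfolding code_adj_def
      by (intro conjI exI[of _ i]) (auto simp: clq_def)
    with \<open>Suc i < k + l\<close> show ?thesis by (intro bexI[of _ "(i,1)"]) (auto simp: codes_def)
  next
    case False
    then have "u \<in> clq k l j" using u by (auto simp: clq_def)
    then have "code_adj k l u (if b = 1 then (j, 2) else (j, 1))" using u
      unfolding code_adj_def by (intro conjI exI[of _ j]) (auto simp: clq_def)
    then show ?thesis using u by (intro bexI[of _ "if b = 1 then (j, 2) else (j, 1)"]) (auto simp: codes_def)
  qed
qed

lemma not_free_codes:
  assumes sg: "simple_graph G" and inj: "inj_on \<phi> (codes k l)"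
    and hom: "\<And>u v. u \<in> codes k l \<Longrightarrow> v \<in> codes k l \<Longrightarrow> code_adj k l u v \<Longrightarrow> \<phi> v \<in> nbrs G (\<phi> u)"
  shows "\<not> graph_free F G"
proof -
  have "embeds F G (\<phi> \<circ> code)"
    unfolding embeds_def
  proof (intro conjI ballI)
    show "inj_on (\<phi> \<circ> code) (verts F)"
      using code_inj inj code_verts by (meson comp_inj_on inj_on_subset)
    show "(\<phi> \<circ> code) ` verts F \<subseteq> verts G"
    proof (clarsimp)
      fix x assume "x \<in> verts F"
      then have "code x \<in> codes k l" using code_verts by auto
      then show "\<phi> (code x) \<in> verts G" using codes_adj_ex hom nbrs_in_verts[OF sg] by blast
    qed
    fix d assume "d \<in> edges F"
    then obtain j where j: "j < k + l" "d \<subseteq> blow_up_clique 3 (ends k l j)" "card d = 2"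
      by (auto simp: edge_blow_up_def edges_lollipop)
    then obtain x y where d: "d = {x, y}" "x \<noteq> y" by (meson card_2_iff)
    have "blow_up_clique 3 (ends k l j) \<subseteq> verts F" using j by (auto simp: edge_blow_up_def edges_lollipop)
    then have xy: "x \<in> verts F" "y \<in> verts F" using j d by auto
    have "code x \<noteq> code y" using code_inj xy d by (auto simp: inj_on_def)
    moreover have "code x \<in> clq k l j" "code y \<in> clq k l j"
      using j d code_clique[OF j(1)] by blast+
    ultimately have "code_adj k l (code x) (code y)" using j(1) by (auto simp: code_adj_def)
    then show "(\<phi> \<circ> code) ` d \<in> edges G"
      using hom[of "code x" "code y"] xy code_verts d by (auto simp: nbrs_def)
  qed
  then show ?thesis using graph_free_iff[OF simple_blow_up] by blast
qed

lemma code_adj_sym: "code_adj k l u v \<Longrightarrow> code_adj k l v u"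
  by (auto simp: code_adj_def)

lemma finite_codes: "finite (codes k l)" by (simp add: codes_def)

lemma card_codes: "card (codes k l) = 3 * (k + l)" by (simp add: codes_def)

text \<open>The map \<open>c\<close> gives each code that is not prescribed the part from which its
  image is drawn. Prescribed vertices come in two kinds: those in \<open>Pg\<close> miss at most
  \<open>d\<close> vertices of the parts of their neighbours, while of the apices in
  \<open>Pa\<close> only the size of common neighbourhoods is known. Of the room
  \<open>3 * (k + l) * (2 * d + 1)\<close>, a share of \<open>d\<close> per code pays for the misses
  of \<open>Pg\<close> and \<open>d + 1\<close> per code for the greedy choice.\<close>

lemma coloured_embedding:
  fixes B :: "nat \<Rightarrow> 'a set" and d :: real
  assumes sg: "simple_graph G" and P: "Pg \<union> Pa \<subseteq> codes k l"
    and inj0: "inj_on \<phi> (Pg \<union> Pa)"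
    and hom0: "\<And>u v. u \<in> Pg \<union> Pa \<Longrightarrow> v \<in> Pg \<union> Pa \<Longrightarrow> code_adj k l u v \<Longrightarrow> \<phi> v \<in> nbrs G (\<phi> u)"
    and fin: "\<And>v. v \<in> codes k l - (Pg \<union> Pa) \<Longrightarrow> finite (B (c v))" and "d \<ge> 0"
    and miss: "\<And>u v x. u \<in> codes k l - (Pg \<union> Pa) \<Longrightarrow> v \<in> codes k l - (Pg \<union> Pa) \<Longrightarrow>
        code_adj k l u v \<Longrightarrow> x \<in> B (c u) \<Longrightarrow> real (card (B (c v) - nbrs G x)) \<le> d"
    and good: "\<And>u v. u \<in> Pg \<Longrightarrow> v \<in> codes k l - (Pg \<union> Pa) \<Longrightarrow>
        code_adj k l u v \<Longrightarrow> real (card (B (c v) - nbrs G (\<phi> u))) \<le> d"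
    and apex: "\<And>v. v \<in> codes k l - (Pg \<union> Pa) \<Longrightarrow>
        real (card {y \<in> B (c v). \<forall>u\<in>Pa. code_adj k l u v \<longrightarrow> y \<in> nbrs G (\<phi> u)}) > 3 * (k + l) * (2 * d + 1)"
  shows "\<not> graph_free F G"
proof -
  define P where "P = Pg \<union> Pa"
  define C where "C v = {y \<in> B (c v). \<forall>u\<in>P. code_adj k l u v \<longrightarrow> y \<in> nbrs G (\<phi> u)}" for v
  have finP: "finite Pg" "finite Pa" using P finite_codes finite_subset by auto
  have "\<exists>\<psi>. inj_on \<psi> (codes k l) \<and>
    (\<forall>u\<in>codes k l. \<forall>v\<in>codes k l. code_adj k l u v \<longrightarrow> \<psi> v \<in> nbrs G (\<psi> u))"
  proof (rule greedy_embedding[of "codes k l" P \<phi> "code_adj k l" G C d])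
    show "P \<subseteq> codes k l" using P by (simp add: P_def)
    show "\<phi> v \<in> nbrs G (\<phi> u)" if "u \<in> P" "v \<in> P" "code_adj k l u v" for u v
      using hom0 that by (simp add: P_def)
    show "finite (C v)" if "v \<in> codes k l - P" for v
      using fin that by (auto simp: P_def C_def)
    show "real (card (C v - nbrs G x)) \<le> d"
      if "u \<in> codes k l - P" "v \<in> codes k l - P" "code_adj k l u v" "x \<in> C u" for u v x
    proof -
      have "card (C v - nbrs G x) \<le> card (B (c v) - nbrs G x)"
        using fin that by (intro card_mono) (auto simp: P_def C_def)
      then show ?thesis using miss[of u v x] that by (auto simp: P_def C_def)
    qed
    show "real (card (codes k l)) * (d + 1) < real (card (C v))" if v: "v \<in> codes k l - P" for v
    proof -
      let ?A = "{y \<in> B (c v). \<forall>u\<in>Pa. code_adj k l u v \<longrightarrow> y \<in> nbrs G (\<phi> u)}"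
      let ?U = "{u \<in> Pg. code_adj k l u v}"
      have "?A \<subseteq> C v \<union> (\<Union>u\<in>?U. B (c v) - nbrs G (\<phi> u))" by (auto simp: C_def P_def)
      moreover have "finite (C v)" "finite (\<Union>u\<in>?U. B (c v) - nbrs G (\<phi> u))"
        using fin v finP by (auto simp: P_def C_def)
      ultimately have "card ?A \<le> card (C v) + card (\<Union>u\<in>?U. B (c v) - nbrs G (\<phi> u))"
        using card_mono[OF finite_UnI] card_Un_le order_trans by (metis (no_types, lifting))
      also have "card (\<Union>u\<in>?U. B (c v) - nbrs G (\<phi> u)) \<le> (\<Sum>u\<in>?U. card (B (c v) - nbrs G (\<phi> u)))"
        using finP by (intro card_UN_le) auto
      finally have "real (card ?A) \<le> real (card (C v)) + (\<Sum>u\<in>?U. real (card (B (c v) - nbrs G (\<phi> u))))"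
        unfolding of_nat_sum[symmetric] of_nat_add[symmetric] of_nat_le_iff by simp
      also have "(\<Sum>u\<in>?U. real (card (B (c v) - nbrs G (\<phi> u)))) \<le> (\<Sum>u\<in>?U. d)"
        using good v by (intro sum_mono) (auto simp: P_def)
      also have "\<dots> \<le> (3 * (k + l)) * d"
      proof -
        have "card ?U \<le> card (codes k l)" using P finite_codes by (intro card_mono) auto
        then have "real (card ?U) \<le> 3 * (k + l)" unfolding card_codes by linarith
        then have "real (card ?U) * d \<le> (3 * (k + l)) * d" using \<open>d \<ge> 0\<close> by (rule mult_right_mono)
        then show ?thesis by simp
      qed
      finally have "real (card ?A) \<le> real (card (C v)) + (3 * (k + l)) * d" by simp
      moreover have "real (card ?A) > 3 * (k + l) * (2 * d + 1)" using apex v by (simp add: P_def)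
      ultimately show ?thesis unfolding card_codes by (simp add: algebra_simps)
    qed
    show "code_adj k l v u" if "code_adj k l u v" for u v using that by (rule code_adj_sym)
    show "C v \<subseteq> nbrs G (\<phi> u)" if "u \<in> P" "code_adj k l u v" for u v using that by (auto simp: C_def)
  qed (use inj0 finite_codes \<open>d \<ge> 0\<close> in \<open>auto simp: P_def code_adj_def\<close>)
  then show ?thesis using not_free_codes[OF sg] by blast
qed

end

section \<open>Host configurations that contain the blow-up\<close>

context odd_lollipop
begin

lemma code_adj_cases:
  assumes "code_adj k l u v"
  obtains (inner) j where "Suc j < k + l" "u \<noteq> v" "u \<in> {(j, 0), (Suc j, 0), (j, 1), (j, 2)}"
      "v \<in> {(j, 0), (Suc j, 0), (j, 1), (j, 2)}"
    | (chord) j where "Suc j = k + l" "u \<noteq> v" "u \<in> {(k - 1, 0), (0, 0), (j, 1), (j, 2)}"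
      "v \<in> {(k - 1, 0), (0, 0), (j, 1), (j, 2)}"
proof -
  from assms obtain j where j: "j < k + l" "u \<in> clq k l j" "v \<in> clq k l j" "u \<noteq> v"
    by (auto simp: code_adj_def)
  show ?thesis
  proof (cases "Suc j < k + l")
    case True
    with j inner[of j] show ?thesis by (simp add: clq_def insert_commute)
  next
    case False
    with j chord[of j] show ?thesis by (simp add: clq_def insert_commute)
  qed
qed

lemma even_k1: "even (k - 1)" "k - 1 \<ge> 2"
  using odd_k k3 by auto

text \<open>The blow-up is 4-colourable. As the lollipop contains an odd cycle, its vertex 0 gets a
  colour of its own, 2, while its other vertices alternate between 1 and 0; in each clique one new
  vertex gets 3 and the other the colour still missing.\<close>

lemma complete_4_partite_not_free:
  fixes A :: "nat \<Rightarrow> 'a set"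
  assumes sg: "simple_graph G" and fin: "\<And>i. i < 4 \<Longrightarrow> finite (A i)"
    and adj: "\<And>i j x y. i < 4 \<Longrightarrow> j < 4 \<Longrightarrow> i \<noteq> j \<Longrightarrow> x \<in> A i \<Longrightarrow> y \<in> A j \<Longrightarrow> y \<in> nbrs G x"
    and big: "\<And>i. i < 4 \<Longrightarrow> card (A i) > 3 * (k + l)"
  shows "\<not> graph_free F G"
proof -
  define c :: "nat \<times> nat \<Rightarrow> nat" where "c = (\<lambda>(i, b). if b = 0 then if i = 0 then 2 else if odd i then 1 else 0
    else if b = 1 then 3 else if i = 0 then 0 else if Suc i = k + l then 1 else 2)"
  have c4: "c v < 4" for v by (auto simp: c_def split: prod.split)
  have proper: "c u \<noteq> c v" if "code_adj k l u v" for u v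
    using that
  proof (cases rule: code_adj_cases)
    case (inner j)
    then show ?thesis by (cases "j = 0"; cases "even j") (auto simp: c_def)
  next
    case (chord j)
    have "even (k - 1)" "k - 1 \<noteq> 0" using even_k1 by auto
    with chord show ?thesis using k3 by (auto simp: c_def)
  qed
  show ?thesis
  proof (rule coloured_embedding[of G "{}" "{}" undefined A c 0])
    show "real (card (A (c v) - nbrs G x)) \<le> 0" if "code_adj k l u v" "x \<in> A (c u)" for u v x
    proof -
      have "A (c v) - nbrs G x = {}" using adj[OF c4 c4 proper[OF that(1)]] that(2) by blast
      then show ?thesis by (simp only: card.empty)
    qed
    show "3 * (k + l) * (2 * (0::real) + 1) < real (card {y \<in> A (c v). \<forall>u\<in>{}. code_adj k l u v \<longrightarrow> y \<in> nbrs G (undefined u)})" for v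
      using big[OF c4[of v]] by simp
  qed (use sg fin c4 in auto)
qed

text \<open>The vertex \<open>z\<close> plays the vertex \<open>1\<close> of the lollipop, the edges \<open>z y1\<close> and \<open>z y2\<close> lie in the two
  cliques at it, and the other cliques take their new vertices from the matching. Without the
  vertex \<open>1\<close> the lollipop is bipartite, so its vertices fit into \<open>B1\<close> and \<open>B2\<close>.\<close>
lemma matching_not_free:
  fixes B1 B2 :: "'a set" and d :: real and e :: "nat \<times> nat \<Rightarrow> 'a"
  assumes sg: "simple_graph G" and fin: "finite B1" "finite B2" and "d \<ge> 0"
    and z: "y1 \<in> nbrs G z" "y2 \<in> nbrs G z" "y1 \<noteq> y2"
    and inj: "inj_on e ({..<k + l} \<times> {1, 2})"
    and avoid: "e ` ({..<k + l} \<times> {1, 2}) \<inter> {z, y1, y2} = {}"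
    and matching: "\<And>j. j < k + l \<Longrightarrow> e (j, 2) \<in> nbrs G (e (j, 1))"
    and good: "\<And>x. x \<in> {y1, y2} \<union> e ` ({..<k + l} \<times> {1, 2}) \<Longrightarrow>
      real (card (B1 - nbrs G x)) \<le> d \<and> real (card (B2 - nbrs G x)) \<le> d"
    and B12: "\<And>x. x \<in> B1 \<Longrightarrow> real (card (B2 - nbrs G x)) \<le> d"
    and B21: "\<And>x. x \<in> B2 \<Longrightarrow> real (card (B1 - nbrs G x)) \<le> d"
    and big: "real (card (B1 \<inter> nbrs G z)) > 3 * (k + l) * (2 * d + 1)"
      "real (card (B2 \<inter> nbrs G z)) > 3 * (k + l) * (2 * d + 1)"
  shows "\<not> graph_free F G"
proof -
  \<comment> \<open>Colour 1 stands for \<open>B1\<close> and 2 for \<open>B2\<close>. Vertex 0 may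
    join the odd ones: once vertex 1 is removed, its only neighbour in the lollipop is k - 1, which
    is even. The codes \<open>(0, 2)\<close> and \<open>(1, 2)\<close>, the remaining new vertices
    in the cliques at vertex 1, get the colour opposite to that of 0 and of 2.\<close>
  define c :: "nat \<times> nat \<Rightarrow> nat" where "c = (\<lambda>(i, b). if b = 0 then if i = 0 \<or> odd i then 1 else 2
    else if i = 0 then 2 else 1)"
  define B where "B i = (if i = 1 then B1 else B2)" for i :: nat
  define \<phi> where "\<phi> u = (if u = (1, 0) then z else if u = (0, 1) then y1 else if u = (1, 1) then y2 else e u)" for u
  define Pg where "Pg = {(0, 1), (1, 1)} \<union> {2..<k + l} \<times> {1, 2::nat}"
  \<comment> \<open>The vertex \<open>z\<close> may miss many vertices of \<open>B1\<close> and
    \<open>B2\<close>, so it is treated like an apex.\<close>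
  define Pa where "Pa = {(1::nat, 0::nat)}"
  have zy: "z \<noteq> y1" "z \<noteq> y2" using z nbrs_irrefl[OF sg] by auto
  let ?P = "Pg \<union> Pa"
  have inner0: "w \<in> ?P \<Longrightarrow> w \<in> {(1, 0), (0, 1)}" "w \<notin> ?P \<Longrightarrow> w \<in> {(0, 0), (0, 2)}"
    if "w \<in> {(0, 0), (Suc 0, 0), (0, 1), (0, 2)}" for w
    using that by (auto simp: Pg_def Pa_def)
  have inner1: "w \<in> ?P \<Longrightarrow> w \<in> {(1, 0), (1, 1)}" "w \<notin> ?P \<Longrightarrow> w \<in> {(2, 0), (1, 2)}"
    if "w \<in> {(1, 0), (Suc 1, 0), (1, 1), (1, 2)}" for w
    using that by (auto simp: Pg_def Pa_def)
  have inner2: "w \<in> ?P \<Longrightarrow> w \<in> {(j, 1), (j, 2)}" "w \<notin> ?P \<Longrightarrow> w \<in> {(j, 0), (Suc j, 0)}"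
    if "w \<in> {(j, 0), (Suc j, 0), (j, 1), (j, 2)}" "2 \<le> j" "Suc j < k + l" for w j
    using that by (auto simp: Pg_def Pa_def)
  have last: "w \<in> ?P \<Longrightarrow> w \<in> {(j, 1), (j, 2)}" "w \<notin> ?P \<Longrightarrow> w \<in> {(k - 1, 0), (0, 0)}"
    if "w \<in> {(k - 1, 0), (0, 0), (j, 1), (j, 2)}" "Suc j = k + l" for w j
  proof -
    have "j \<ge> 2" "j < k + l" "k - 1 \<noteq> 1" using that(2) k3 by auto
    then show "w \<in> ?P \<Longrightarrow> w \<in> {(j, 1), (j, 2)}" "w \<notin> ?P \<Longrightarrow> w \<in> {(k - 1, 0), (0, 0)}"
      using that(1) by (auto simp: Pg_def Pa_def)
  qed
  have proper: "c u \<noteq> c v" if "code_adj k l u v" "u \<in> codes k l - ?P" "v \<in> codes k l - ?P" for u v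
    using that(1)
  proof (cases rule: code_adj_cases)
    case (inner j)
    have uv: "u \<notin> ?P" "v \<notin> ?P" using that by auto
    consider "j = 0" | "j = 1" | "j \<ge> 2" by linarith
    then show ?thesis
    proof cases
      case 1
      then show ?thesis using inner(2) inner0(2)[of u] inner0(2)[of v] inner(3,4) uv by (auto simp: c_def)
    next
      case 2
      then show ?thesis using inner(2) inner1(2)[of u] inner1(2)[of v] inner(3,4) uv by (auto simp: c_def)
    next
      case 3
      have "u \<in> {(j, 0), (Suc j, 0)}" "v \<in> {(j, 0), (Suc j, 0)}"
        using inner2(2)[OF inner(3) 3 inner(1) uv(1)] inner2(2)[OF inner(4) 3 inner(1) uv(2)] by auto
      then show ?thesis using inner(2) 3 by (cases "even j") (auto simp: c_def)
    qed
  next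
    case (chord j)
    have "u \<in> {(k - 1, 0), (0, 0)}" "v \<in> {(k - 1, 0), (0, 0)}"
      using last(2)[OF chord(3,1)] last(2)[OF chord(4,1)] that(2,3) by auto
    then show ?thesis using chord(2) even_k1 k3 by (auto simp: c_def)
  qed
  have good': "real (card (B i - nbrs G x)) \<le> d" if "x \<in> {y1, y2} \<union> e ` ({..<k + l} \<times> {1, 2})" for x i
    using good[OF that] by (simp add: B_def)
  show ?thesis
  proof (rule coloured_embedding[of G Pg Pa \<phi> B c d])
    show "Pg \<union> Pa \<subseteq> codes k l" using k3 by (auto simp: Pg_def Pa_def codes_def)
    show "inj_on \<phi> (Pg \<union> Pa)"
    proof (rule inj_onI)
      fix u v assume uv: "u \<in> Pg \<union> Pa" "v \<in> Pg \<union> Pa" "\<phi> u = \<phi> v"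
      let ?E = "{2..<k + l} \<times> {1, 2::nat}"
      have P: "Pg \<union> Pa = {(1, 0), (0, 1), (1, 1)} \<union> ?E" by (auto simp: Pg_def Pa_def)
      have e: "\<phi> w = e w" "\<phi> w \<notin> {z, y1, y2}" "w \<in> {..<k + l} \<times> {1, 2}" if "w \<in> ?E" for w
      proof -
        show 1: "\<phi> w = e w" "w \<in> {..<k + l} \<times> {1, 2}" using that by (auto simp: \<phi>_def)
        show "\<phi> w \<notin> {z, y1, y2}" unfolding 1 using avoid 1(2) by blast
      qed
      have s: "\<phi> (1, 0) = z" "\<phi> (0, 1) = y1" "\<phi> (1, 1) = y2" by (auto simp: \<phi>_def)
      consider "u \<in> ?E" "v \<in> ?E" | "u \<in> ?E" "v \<in> {(1, 0), (0, 1), (1, 1)}"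
        | "v \<in> ?E" "u \<in> {(1, 0), (0, 1), (1, 1)}" | "u \<in> {(1, 0), (0, 1), (1, 1)}" "v \<in> {(1, 0), (0, 1), (1, 1)}"
        using uv(1,2) unfolding P by blast
      then show "u = v"
      proof cases
        case 1
        then show ?thesis using inj_onD[OF inj, of u v] e(1,3)[of u] e(1,3)[of v] uv(3) by metis
      next
        case 2
        then show ?thesis using e(2)[of u] uv(3) s by auto
      next
        case 3
        then show ?thesis using e(2)[of v] uv(3) s by auto
      next
        case 4
        then show ?thesis using s uv(3) zy z(3) by auto
      qed
    qed
    show "\<phi> v \<in> nbrs G (\<phi> u)" if "u \<in> ?P" "v \<in> ?P" "code_adj k l u v" for u v
    proof -
      have pair: "\<phi> v \<in> nbrs G (\<phi> u)" if "u \<noteq> v" "u \<in> {a, b}" "v \<in> {a, b}" "\<phi> b \<in> nbrs G (\<phi> a)" for a b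
        using that nbrs_sym by fastforce
      have m: "\<phi> (j, 2) \<in> nbrs G (\<phi> (j, 1))" if "2 \<le> j" "j < k + l" for j
        using that matching by (auto simp: \<phi>_def)
      show ?thesis using that(3)
      proof (cases rule: code_adj_cases)
        case (inner j)
        consider "j = 0" | "j = 1" | "j \<ge> 2" by linarith
        then show ?thesis
        proof cases
          case 1
          then have "u \<in> {(1, 0), (0, 1)}" "v \<in> {(1, 0), (0, 1)}"
            using inner0(1)[of u] inner0(1)[of v] inner(3,4) that by auto
          then show ?thesis by (rule pair[OF inner(2)]) (use z in \<open>auto simp: \<phi>_def\<close>)
        next
          case 2
          then have "u \<in> {(1, 0), (1, 1)}" "v \<in> {(1, 0), (1, 1)}"
            using inner1(1)[of u] inner1(1)[of v] inner(3,4) that by auto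
          then show ?thesis by (rule pair[OF inner(2)]) (use z in \<open>auto simp: \<phi>_def\<close>)
        next
          case 3
          show ?thesis
            using inner2(1)[OF inner(3) 3 inner(1) that(1)] inner2(1)[OF inner(4) 3 inner(1) that(2)]
            by (rule pair[OF inner(2)]) (use m 3 inner(1) in auto)
        qed
      next
        case (chord j)
        show ?thesis
          using last(1)[OF chord(3,1) that(1)] last(1)[OF chord(4,1) that(2)]
          by (rule pair[OF chord(2)]) (use m[of j] chord(1) k3 in auto)
      qed
    qed
    show "real (card (B (c v) - nbrs G x)) \<le> d"
      if "u \<in> codes k l - (Pg \<union> Pa)" "v \<in> codes k l - (Pg \<union> Pa)" "code_adj k l u v" "x \<in> B (c u)" for u v x
    proof -
      have "c u \<in> {1, 2}" "c v \<in> {1, 2}" by (auto simp: c_def split: prod.split)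
      then show ?thesis using proper[OF that(3,1,2)] that(4) B12 B21 by (auto simp: B_def)
    qed
    show "real (card (B (c v) - nbrs G (\<phi> u))) \<le> d" if "u \<in> Pg" for u v
      using that by (intro good') (auto simp: \<phi>_def Pg_def)
    show "3 * (k + l) * (2 * d + 1) < real (card {y \<in> B (c v). \<forall>u\<in>Pa. code_adj k l u v \<longrightarrow> y \<in> nbrs G (\<phi> u)})" for v
    proof -
      have "B (c v) \<inter> nbrs G z \<subseteq> {y \<in> B (c v). \<forall>u\<in>Pa. code_adj k l u v \<longrightarrow> y \<in> nbrs G (\<phi> u)}"
        by (auto simp: Pa_def \<phi>_def)
      moreover have "finite (B (c v))" using fin by (simp add: B_def)
      ultimately have "card (B (c v) \<inter> nbrs G z) \<le> card {y \<in> B (c v). \<forall>u\<in>Pa. code_adj k l u v \<longrightarrow> y \<in> nbrs G (\<phi> u)}"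
        by (intro card_mono) auto
      moreover have "real (card (B (c v) \<inter> nbrs G z)) > 3 * (k + l) * (2 * d + 1)"
        using big by (simp add: B_def)
      ultimately show ?thesis by linarith
    qed
    show "finite (B (c v))" for v using fin by (simp add: B_def)
  qed (use sg \<open>d \<ge> 0\<close> in auto)
qed

text \<open>The vertices \<open>\<sigma> r\<close> play the positive even vertices \<open>2 r\<close>. The edge \<open>x y\<close> supplies both new vertices
  of the only clique not met by them.\<close>
lemma full_apices_edge_not_free:
  fixes B :: "nat \<Rightarrow> 'a set" and d :: real and \<sigma> :: "nat \<Rightarrow> 'a"
  assumes sg: "simple_graph G" and fin: "\<And>i. i < 3 \<Longrightarrow> finite (B i)" and "d \<ge> 0"
    and inj: "inj_on \<sigma> {1..(k + l - 1) div 2}"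
    and xy: "y \<in> nbrs G x" "{x, y} \<inter> \<sigma> ` {1..(k + l - 1) div 2} = {}"
    and good_xy: "\<And>u i. u \<in> {x, y} \<Longrightarrow> i \<in> {1, 2} \<Longrightarrow> real (card (B i - nbrs G u)) \<le> d"
    and good_\<sigma>: "\<And>r i. r \<in> {1..(k + l - 1) div 2} \<Longrightarrow> i < 3 \<Longrightarrow> real (card (B i - nbrs G (\<sigma> r))) \<le> d"
    and miss: "\<And>i j u. i < 3 \<Longrightarrow> j < 3 \<Longrightarrow> i \<noteq> j \<Longrightarrow> u \<in> B i \<Longrightarrow> real (card (B j - nbrs G u)) \<le> d"
    and big: "\<And>i. i < 3 \<Longrightarrow> real (card (B i)) > 3 * (k + l) * (2 * d + 1)"
  shows "\<not> graph_free F G"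
proof -
  \<comment> \<open>A prescribed even vertex leaves three places in its clique: the odd vertices get
    2, vertex 0 gets 1, and the new vertices the two other colours. In the clique on
    \<open>{0, 1}\<close> only the vertices 0 and 1 remain to be placed, in colours 1 and 2. Hence
    \<open>x\<close> and \<open>y\<close> need many neighbours in parts 1 and 2 only and may both
    lie in part 0.\<close>
  define c :: "nat \<times> nat \<Rightarrow> nat" where "c = (\<lambda>(i, b). if b = 0 then if i = 0 then 1 else 2
    else if b = 1 then 0 else if Suc i = k + l then 2 else 1)"
  have c3: "c v < 3" for v by (auto simp: c_def split: prod.split)
  define Pe where "Pe = {(i, 0::nat) | i. even i \<and> 2 \<le> i \<and> i < k + l}"
  define Pg where "Pg = Pe \<union> {(0, 1), (0, 2)}"
  define \<phi> where "\<phi> u = (if u = (0, 1) then x else if u = (0, 2) then y else \<sigma> (fst u div 2))" for u :: "nat \<times> nat"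
  have Pe: "\<phi> u \<in> \<sigma> ` {1..(k + l - 1) div 2}" "fst u div 2 \<in> {1..(k + l - 1) div 2}" "\<phi> u = \<sigma> (fst u div 2)" if uPe: "u \<in> Pe" for u
  proof -
    obtain i where i: "u = (i, 0)" "even i" "2 \<le> i" "i < k + l" using uPe unfolding Pe_def by blast
    then show "fst u div 2 \<in> {1..(k + l - 1) div 2}" by (auto intro: div_le_mono)
    moreover show "\<phi> u = \<sigma> (fst u div 2)" using i by (auto simp: \<phi>_def)
    ultimately show "\<phi> u \<in> \<sigma> ` {1..(k + l - 1) div 2}" by auto
  qed
  have proper: "c u \<noteq> c v" if "code_adj k l u v" "u \<in> codes k l - (Pg \<union> {})" "v \<in> codes k l - (Pg \<union> {})" for u v
    using that(1)
  proof (cases rule: code_adj_cases)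
    case (inner j)
    consider "j = 0" | "j \<noteq> 0" "even j" | "odd j" by blast
    then show ?thesis
    proof cases
      case 1
      then have "u \<in> {(0, 0), (1, 0)}" "v \<in> {(0, 0), (1, 0)}"
        using inner(3,4) that(2,3) by (auto simp: Pg_def)
      then show ?thesis using inner(2) by (auto simp: c_def)
    next
      case 2
      then have "j \<ge> 2" by presburger
      then have "w \<in> {(Suc j, 0), (j, 1), (j, 2)}" if "w \<in> {(j, 0), (Suc j, 0), (j, 1), (j, 2)}" "w \<notin> Pg" for w
        using that inner(1) 2 by (auto simp: Pg_def Pe_def)
      from this[OF inner(3)] this[OF inner(4)] that(2,3)
      have "u \<in> {(Suc j, 0), (j, 1), (j, 2)}" "v \<in> {(Suc j, 0), (j, 1), (j, 2)}" by simp_all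
      then show ?thesis using inner(1,2) 2(1) by (auto simp: c_def)
    next
      case 3
      then have "Suc j \<ge> 2" by presburger
      then have "w \<in> {(j, 0), (j, 1), (j, 2)}" if "w \<in> {(j, 0), (Suc j, 0), (j, 1), (j, 2)}" "w \<notin> Pg" for w
        using that inner(1) 3 by (auto simp: Pg_def Pe_def)
      from this[OF inner(3)] this[OF inner(4)] that(2,3)
      have "u \<in> {(j, 0), (j, 1), (j, 2)}" "v \<in> {(j, 0), (j, 1), (j, 2)}" by simp_all
      moreover have "j \<noteq> 0" using 3 by presburger
      ultimately show ?thesis using inner(1,2) by (auto simp: c_def)
    qed
  next
    case (chord j)
    have "(k - 1, 0) \<in> Pg" using even_k1 by (auto simp: Pg_def Pe_def)
    then have "u \<in> {(0, 0), (j, 1), (j, 2)}" "v \<in> {(0, 0), (j, 1), (j, 2)}"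
      using chord(3,4) that(2,3) by auto
    then show ?thesis using chord(1,2) k3 by (auto simp: c_def)
  qed
  have xny: "x \<noteq> y" using xy(1) nbrs_irrefl[OF sg] by auto
  show ?thesis
  proof (rule coloured_embedding[of G Pg "{}" \<phi> B c d])
    show "Pg \<union> {} \<subseteq> codes k l" using k3 by (auto simp: Pg_def Pe_def codes_def)
    show "inj_on \<phi> (Pg \<union> {})"
    proof (rule inj_onI)
      fix u v assume uv: "u \<in> Pg \<union> {}" "v \<in> Pg \<union> {}" "\<phi> u = \<phi> v"
      have s: "\<phi> (0, 1) = x" "\<phi> (0, 2) = y" by (auto simp: \<phi>_def)
      consider "u \<in> Pe" "v \<in> Pe" | "u \<in> Pe" "v \<in> {(0, 1), (0, 2)}" | "v \<in> Pe" "u \<in> {(0, 1), (0, 2)}"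
        | "u \<in> {(0, 1), (0, 2)}" "v \<in> {(0, 1), (0, 2)}" using uv(1,2) by (auto simp: Pg_def)
      then show "u = v"
      proof cases
        case 1
        then have "fst u div 2 = fst v div 2"
          using inj_onD[OF inj, of "fst u div 2" "fst v div 2"] Pe(2,3)[of u] Pe(2,3)[of v] uv(3) by metis
        moreover have "even (fst u)" "even (fst v)" "snd u = snd v" using 1 by (auto simp: Pe_def)
        ultimately show ?thesis by (metis dvd_mult_div_cancel prod_eqI)
      next
        case 2
        then show ?thesis using Pe(1)[of u] uv(3) s xy(2) by auto
      next
        case 3
        then show ?thesis using Pe(1)[of v] uv(3) s xy(2) by auto
      next
        case 4
        then show ?thesis using uv(3) s xny by auto
      qed
    qed
    show "\<phi> v \<in> nbrs G (\<phi> u)" if "u \<in> Pg \<union> {}" "v \<in> Pg \<union> {}" "code_adj k l u v" for u v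
      using that(3)
    proof (cases rule: code_adj_cases)
      case (inner j)
      show ?thesis
      proof (cases "j = 0")
        case True
        have "w \<in> {(0, 1), (0, 2)}" if "w \<in> {(j, 0), (Suc j, 0), (j, 1), (j, 2)}" "w \<in> Pg \<union> {}" for w
          using that True by (auto simp: Pg_def Pe_def)
        then have "u \<in> {(0, 1), (0, 2)}" "v \<in> {(0, 1), (0, 2)}" using inner(3,4) \<open>u \<in> Pg \<union> {}\<close> \<open>v \<in> Pg \<union> {}\<close> by blast+
        then show ?thesis using inner(2) xy(1) nbrs_sym[of y G x] by (auto simp: \<phi>_def)
      next
        case False
        have "w = (if even j then j else Suc j, 0)" if "w \<in> {(j, 0), (Suc j, 0), (j, 1), (j, 2)}" "w \<in> Pg \<union> {}" for w
          using that False by (auto simp: Pg_def Pe_def)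
        from this[OF inner(3) \<open>u \<in> Pg \<union> {}\<close>] this[OF inner(4) \<open>v \<in> Pg \<union> {}\<close>] have "u = v" by simp
        then show ?thesis using inner(2) by blast
      qed
    next
      case (chord j)
      have "w = (k - 1, 0)" if "w \<in> {(k - 1, 0), (0, 0), (j, 1), (j, 2)}" "w \<in> Pg \<union> {}" for w
        using that chord(1) k3 by (auto simp: Pg_def Pe_def)
      from this[OF chord(3) \<open>u \<in> Pg \<union> {}\<close>] this[OF chord(4) \<open>v \<in> Pg \<union> {}\<close>] have "u = v" by simp
      then show ?thesis using chord(2) by blast
    qed
    show "real (card (B (c v) - nbrs G u')) \<le> d"
      if "u \<in> codes k l - (Pg \<union> {})" "v \<in> codes k l - (Pg \<union> {})" "code_adj k l u v" "u' \<in> B (c u)" for u v u'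
      using miss[OF c3 c3 proper[OF that(3,1,2)] that(4)] .
    show "real (card (B (c v) - nbrs G (\<phi> u))) \<le> d"
      if "u \<in> Pg" "v \<in> codes k l - (Pg \<union> {})" "code_adj k l u v" for u v
    proof (cases "u \<in> Pe")
      case True
      then show ?thesis using Pe[of u] good_\<sigma> c3 by auto
    next
      case False
      then have u: "u \<in> {(0, 1), (0, 2)}" using that(1) by (auto simp: Pg_def)
      have "v \<in> {(0, 0), (1, 0)}"
        using that(3)
      proof (cases rule: code_adj_cases)
        case (inner j)
        then show ?thesis using u that(2) by (auto simp: Pg_def)
      next
        case (chord j)
        then show ?thesis using u k3 by auto
      qed
      then have "c v \<in> {1, 2}" by (auto simp: c_def)
      moreover have "\<phi> u \<in> {x, y}" using u by (auto simp: \<phi>_def)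
      ultimately show ?thesis using good_xy by blast
    qed
    show "3 * (k + l) * (2 * d + 1) < real (card {y \<in> B (c v). \<forall>u\<in>{}. code_adj k l u v \<longrightarrow> y \<in> nbrs G (\<phi> u)})" for v
      using big[OF c3] by simp
  qed (use sg \<open>d \<ge> 0\<close> fin c3 in auto)
qed

end

context odd_lollipop
begin

text \<open>Now \<open>\<sigma> 0\<close> is a new vertex of the clique on the edge \<open>{0, 1}\<close> and \<open>\<sigma> r\<close> plays \<open>2 r\<close> for \<open>r > 0\<close>. An
  odd vertex is placed in a part where its two apex neighbours have many common neighbours; the
  adjacent vertices \<open>0\<close> and \<open>1\<close> need different parts.\<close>
lemma apices_not_free:
  fixes B :: "nat \<Rightarrow> 'a set" and d :: real and \<sigma> :: "nat \<Rightarrow> 'a"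
  assumes sg: "simple_graph G" and fin: "\<And>i. i < 3 \<Longrightarrow> finite (B i)" and "d \<ge> 0"
    and inj: "inj_on \<sigma> {..(k + l - 1) div 2}"
    and miss: "\<And>i j u. i < 3 \<Longrightarrow> j < 3 \<Longrightarrow> i \<noteq> j \<Longrightarrow> u \<in> B i \<Longrightarrow> real (card (B j - nbrs G u)) \<le> d"
    and single: "\<And>r i. r \<le> (k + l - 1) div 2 \<Longrightarrow> i < 3 \<Longrightarrow>
      real (card (B i \<inter> nbrs G (\<sigma> r))) > 3 * (k + l) * (2 * d + 1)"
    and pair: "\<And>r r'. r \<le> (k + l - 1) div 2 \<Longrightarrow> r' \<le> (k + l - 1) div 2 \<Longrightarrow>
      \<exists>i<3. real (card (B i \<inter> nbrs G (\<sigma> r) \<inter> nbrs G (\<sigma> r'))) > 3 * (k + l) * (2 * d + 1)"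
    and two: "i1 < 3" "i2 < 3" "i1 \<noteq> i2" "\<And>i. i \<in> {i1, i2} \<Longrightarrow>
      real (card (B i \<inter> nbrs G (\<sigma> 0) \<inter> nbrs G (\<sigma> 1))) > 3 * (k + l) * (2 * d + 1)"
  shows "\<not> graph_free F G"
proof -
  define s where "s = (k + l - 1) div 2"
  define ok where "ok r r' i \<longleftrightarrow> i < 3 \<and>
    real (card (B i \<inter> nbrs G (\<sigma> r) \<inter> nbrs G (\<sigma> r'))) > 3 * (k + l) * (2 * d + 1)" for r r' i
  define g where "g r r' = (SOME i. ok r r' i)" for r r'
  have g: "ok r r' (g r r')" if "r \<le> s" "r' \<le> s" for r r'
  proof -
    have "\<exists>i. ok r r' i" using pair[of r r'] that unfolding s_def ok_def by simp
    then show ?thesis unfolding g_def by (rule someI_ex)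
  qed
  have ok1: "ok r r i" if "r \<le> s" "i < 3" for r i
    using single[of r i] that by (simp add: ok_def s_def Int_assoc)
  have k1s: "(k - 1) div 2 \<le> s" by (simp add: s_def div_le_mono)
  \<comment> \<open>Vertex 0 sees two apices: \<open>\<sigma> 0\<close> in the clique on
    \<open>{0, 1}\<close> and, across the chord, the one that plays \<open>k - 1\<close>.\<close>
  define h0 where "h0 = g 0 ((k - 1) div 2)"
  have h0: "ok 0 ((k - 1) div 2) h0" using g k1s by (simp add: h0_def)
  \<comment> \<open>Vertex 1 sees \<open>\<sigma> 0\<close> and \<open>\<sigma> 1\<close>. Being
    adjacent to 0, it needs another part; this is where two suitable parts for this pair are
    used.\<close>
  obtain h1 where h1: "h1 \<noteq> h0" "ok 0 1 h1"
  proof (cases "h0 = i1")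
    case True
    then show ?thesis using that[of i2] two by (auto simp: ok_def)
  next
    case False
    then show ?thesis using that[of i1] two by (auto simp: ok_def)
  qed
  have h3: "h0 < 3" "h1 < 3" using h0 h1 by (auto simp: ok_def)
  \<comment> \<open>An odd vertex \<open>j\<close> > 1 lies between the apices that play
    \<open>j - 1\<close> and \<open>j + 1\<close>; at the end of the tail only the former exists and
    is taken twice.\<close>
  define h where "h j = (if j = 0 then h0 else if j = 1 then h1
    else if Suc j < k + l then g ((j - 1) div 2) (Suc j div 2) else g ((j - 1) div 2) ((j - 1) div 2))" for j
  have hodd: "ok ((j - 1) div 2) (if Suc j < k + l then Suc j div 2 else (j - 1) div 2) (h j)"
    if "odd j" "j \<noteq> 1" "j < k + l" for j
  proof -
    have "(j - 1) div 2 \<le> s" using that(3) unfolding s_def by (intro div_le_mono) linarith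
    moreover have "Suc j div 2 \<le> s" if "Suc j < k + l"
      using that unfolding s_def by (intro div_le_mono) linarith
    ultimately show ?thesis using that g odd_pos[OF that(1)] by (simp add: h_def)
  qed
  have hlt: "h j < 3" if "j = 0 \<or> odd j" "j < k + l" for j
  proof (cases "j \<le> 1")
    case True
    then show ?thesis using h3 by (auto simp: h_def)
  next
    case False
    then have "odd j" "j \<noteq> 1" using that by auto
    then show ?thesis using hodd[of j] that(2) by (simp add: ok_def)
  qed
  \<comment> \<open>On every clique except that of index 0, this is the one vertex of the lollipop
    that is not an apex.\<close>
  define free where "free j = (if Suc j = k + l then 0 else if odd j then j else Suc j)" for j
  \<comment> \<open>The two new vertices of a clique get the two parts different from that of its
    vertex \<open>free i\<close>. In the clique of index 0 one new vertex is
    \<open>\<sigma> 0\<close>, and the other gets the third part, which is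
    \<open>3 - (h 0 + h 1)\<close> because 0, 1, 2 sum to 3.\<close>
  define c :: "nat \<times> nat \<Rightarrow> nat" where "c = (\<lambda>(i, b). if b = 0 then h i
    else if i = 0 then 3 - (h 0 + h 1) else (h (free i) + b) mod 3)"
  define Pe where "Pe = {(i, 0::nat) | i. even i \<and> 2 \<le> i \<and> i < k + l}"
  define Pa where "Pa = Pe \<union> {(0, 1)}"
  define \<phi> where "\<phi> u = (if u = (0, 1) then \<sigma> 0 else \<sigma> (fst u div 2))" for u :: "nat \<times> nat"
  let ?P = "{} \<union> Pa"
  have inner0: "w \<in> Pa \<Longrightarrow> w = (0, 1)" "w \<notin> Pa \<Longrightarrow> w \<in> {(0, 0), (1, 0), (0, 2)}"
    if "w \<in> {(0, 0), (Suc 0, 0), (0, 1), (0, 2)}" for w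
    using that by (auto simp: Pa_def Pe_def)
  have inner1: "w \<in> Pa \<Longrightarrow> w = (if even j then j else Suc j, 0)" "w \<notin> Pa \<Longrightarrow> w \<in> {(free j, 0), (j, 1), (j, 2)}"
    if "w \<in> {(j, 0), (Suc j, 0), (j, 1), (j, 2)}" "j \<noteq> 0" "Suc j < k + l" for w j
  proof -
    have "Suc j \<ge> 2" "even j \<Longrightarrow> j \<ge> 2" using that(2) by presburger+
    with that show "w \<in> Pa \<Longrightarrow> w = (if even j then j else Suc j, 0)" "w \<notin> Pa \<Longrightarrow> w \<in> {(free j, 0), (j, 1), (j, 2)}"
      by (auto simp: Pa_def Pe_def free_def)
  qed
  have k1P: "(k - 1, 0) \<in> Pa" using even_k1 by (auto simp: Pa_def Pe_def)
  have last: "w \<in> Pa \<Longrightarrow> w = (k - 1, 0)" "w \<notin> Pa \<Longrightarrow> w \<in> {(0, 0), (j, 1), (j, 2)}"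
    if "w \<in> {(k - 1, 0), (0, 0), (j, 1), (j, 2)}" "Suc j = k + l" for w j
    using that k1P k3 by (auto simp: Pa_def Pe_def)
  have free: "free j = 0 \<or> odd (free j)" "free j < k + l" if "j < k + l" for j
    using that by (auto simp: free_def)
  have c3: "c v < 3" if vc: "v \<in> codes k l" "v \<notin> Pa" for v
  proof -
    obtain i b where v: "v = (i, b)" "i < k + l" "b < 3" using vc(1) by (auto simp: codes_def)
    show ?thesis
    proof (cases "b = 0")
      case True
      have "i = 0 \<or> odd i"
      proof (rule ccontr)
        assume "\<not> ?thesis"
        then have "even i" "2 \<le> i" by presburger+
        then show False using vc(2) v True by (auto simp: Pa_def Pe_def)
      qed
      then show ?thesis using hlt v True by (auto simp: c_def)
    next
      case False
      have "3 - (h 0 + h 1) < 3" using h1(1) by (auto simp: h_def)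
      then show ?thesis using v False by (auto simp: c_def)
    qed
  qed
  have h01: "3 - (h0 + h1) \<noteq> h0" "3 - (h0 + h1) \<noteq> h1" 
  proof -
    have "h0 \<in> {0, 1, 2}" "h1 \<in> {0, 1, 2}" using h3 by auto
    then show "3 - (h0 + h1) \<noteq> h0" "3 - (h0 + h1) \<noteq> h1" using h1(1) by auto
  qed
  have m3: "(a + 1) mod 3 \<noteq> a" "(a + 2) mod 3 \<noteq> a" "(a + 1) mod 3 \<noteq> (a + 2) mod 3" if "a < 3" for a :: nat
    using that by presburger+
  have proper: "c u \<noteq> c v" if "code_adj k l u v" "u \<notin> Pa" "v \<notin> Pa" for u v
    using that(1)
  proof (cases rule: code_adj_cases)
    case (inner j)
    show ?thesis
    proof (cases "j = 0")
      case True
      have "u \<in> {(0, 0), (1, 0), (0, 2)}" "v \<in> {(0, 0), (1, 0), (0, 2)}"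
        using inner0(2)[of u] inner0(2)[of v] inner(3,4) that(2,3) unfolding True by blast+
      then show ?thesis using inner(2) h01 h1(1) by (auto simp: c_def h_def)
    next
      case False
      have "h (free j) < 3" using hlt free[of j] inner(1) by simp
      moreover have "u \<in> {(free j, 0), (j, 1), (j, 2)}" "v \<in> {(free j, 0), (j, 1), (j, 2)}"
        using inner1(2)[OF inner(3) False inner(1) that(2)] inner1(2)[OF inner(4) False inner(1) that(3)] by blast+
      ultimately show ?thesis using inner(2) False m3[of "h (free j)"] by (auto simp: c_def)
    qed
  next
    case (chord j)
    then have j: "free j = 0" "j \<noteq> 0" using k3 by (auto simp: free_def)
    have "u \<in> {(0, 0), (j, 1), (j, 2)}" "v \<in> {(0, 0), (j, 1), (j, 2)}"
      using last(2)[OF chord(3,1) that(2)] last(2)[OF chord(4,1) that(3)] by blast+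
    then show ?thesis using chord(2) j m3[of "h 0"] hlt[of 0] k3 by (auto simp: c_def)
  qed
  \<comment> \<open>No code to be placed is adjacent to more than two apices, and the parts of the
    lollipop vertices were chosen for exactly these. A new vertex of a clique sees one apex only,
    which has enough neighbours in every part.\<close>
  have nb: "\<exists>r r'. ok r r' (c v) \<and> (\<forall>u\<in>Pa. code_adj k l u v \<longrightarrow> \<phi> u \<in> {\<sigma> r, \<sigma> r'})"
    if v: "v \<in> codes k l" "v \<notin> Pa" for v
  proof -
    obtain i b where ib: "v = (i, b)" "i < k + l" "b < 3" using v(1) by (auto simp: codes_def)
    consider "b = 0" "i = 0" | "b = 0" "i = 1" | "b = 0" "i > 1" | "b \<noteq> 0" "i = 0" | "b \<noteq> 0" "i \<noteq> 0" by linarith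
    then show ?thesis
    proof cases
      case 1
      have "u \<in> {(0, 1), (k - 1, 0)}" if u: "u \<in> Pa" "code_adj k l u v" for u
        using u(2)
      proof (cases rule: code_adj_cases)
        case (inner j)
        then have "j = 0" using ib 1 by auto
        then show ?thesis using inner0(1) inner(3) u(1) by auto
      next
        case (chord j)
        then show ?thesis using last(1)[OF chord(3,1) u(1)] by auto
      qed
      then have "\<forall>u\<in>Pa. code_adj k l u v \<longrightarrow> \<phi> u \<in> {\<sigma> 0, \<sigma> ((k - 1) div 2)}"
        using k3 by (fastforce simp: \<phi>_def)
      moreover have "c v = h0" using ib 1 by (simp add: c_def h_def)
      ultimately show ?thesis using h0 by metis
    next
      case 2
      have "u \<in> {(0, 1), (2, 0)}" if u: "u \<in> Pa" "code_adj k l u v" for u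
        using u(2)
      proof (cases rule: code_adj_cases)
        case (inner j)
        then have "j = 0 \<or> j = 1" using ib 2 by auto
        then show ?thesis
        proof
          assume "j = 0"
          then show ?thesis using inner0(1) inner(3) u(1) by auto
        next
          assume "j = 1"
          then show ?thesis using inner1(1)[OF inner(3) _ inner(1) u(1)] by (auto simp: numeral_2_eq_2)
        qed
      next
        case (chord j)
        then show ?thesis using ib 2 k3 by auto
      qed
      then have "\<forall>u\<in>Pa. code_adj k l u v \<longrightarrow> \<phi> u \<in> {\<sigma> 0, \<sigma> 1}"
        by (fastforce simp: \<phi>_def)
      moreover have "c v = h1" using ib 2 by (simp add: c_def h_def)
      ultimately show ?thesis using h1 by metis
    next
      case 3
      have i: "odd i" "i \<noteq> 1"
      proof -
        show "odd i"
        proof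
          assume "even i"
          then have "v \<in> Pa" using ib 3 by (auto simp: Pa_def Pe_def)
          then show False using v by blast
        qed
      qed (use 3 in simp)
      have "u = (i - 1, 0) \<or> (u = (Suc i, 0) \<and> Suc i < k + l)" if u: "u \<in> Pa" "code_adj k l u v" for u
        using u(2)
      proof (cases rule: code_adj_cases)
        case (inner j)
        then have "j = i \<or> Suc j = i" using ib 3 by auto
        then show ?thesis
        proof
          assume "j = i"
          then show ?thesis using inner1(1)[OF inner(3) _ inner(1) u(1)] inner(1) i 3 by auto
        next
          assume "Suc j = i"
          moreover from this have "even j" "j \<noteq> 0" using i by auto
          ultimately show ?thesis using inner1(1)[OF inner(3) _ inner(1) u(1)] by auto
        qed
      next
        case (chord j)
        then show ?thesis using ib 3 k3 i even_k1 by auto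
      qed
      then have "\<forall>u\<in>Pa. code_adj k l u v \<longrightarrow>
          \<phi> u \<in> {\<sigma> ((i - 1) div 2), \<sigma> (if Suc i < k + l then Suc i div 2 else (i - 1) div 2)}"
        by (fastforce simp: \<phi>_def)
      moreover have "c v = h i" using ib 3 by (simp add: c_def)
      ultimately show ?thesis using hodd[OF i ib(2)] by metis
    next
      case 4
      have b: "b = 2" using v 4 ib by (cases "b = 1") (auto simp: Pa_def)
      have "u = (0, 1)" if u: "u \<in> Pa" "code_adj k l u v" for u
        using u(2)
      proof (cases rule: code_adj_cases)
        case (inner j)
        then have "j = 0" using ib 4 b by auto
        then show ?thesis using inner0(1) inner(3) u(1) by auto
      next
        case (chord j)
        then show ?thesis using ib 4 b k3 by auto
      qed
      then have "\<forall>u\<in>Pa. code_adj k l u v \<longrightarrow> \<phi> u \<in> {\<sigma> 0, \<sigma> 0}"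
        by (fastforce simp: \<phi>_def)
      moreover have "ok 0 0 (c v)" using ok1 c3[OF v] by simp
      ultimately show ?thesis by metis
    next
      case 5
      define e where "e = (if Suc i = k + l then k - 1 else if even i then i else Suc i)"
      have "e < k + l" using ib by (auto simp: e_def)
      then have e: "e div 2 \<le> s" unfolding s_def by (intro div_le_mono) linarith
      have "u = (e, 0)" if u: "u \<in> Pa" "code_adj k l u v" for u
        using u(2)
      proof (cases rule: code_adj_cases)
        case (inner j)
        then have "j = i" using ib 5 by auto
        then show ?thesis using inner1(1)[OF inner(3) _ inner(1) u(1)] 5 inner(1) by (auto simp: e_def)
      next
        case (chord j)
        then have "j = i" using ib 5 by auto
        then show ?thesis using last(1)[OF chord(3,1) u(1)] chord(1) by (auto simp: e_def)
      qed
      then have "\<forall>u\<in>Pa. code_adj k l u v \<longrightarrow> \<phi> u \<in> {\<sigma> (e div 2), \<sigma> (e div 2)}"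
        by (fastforce simp: \<phi>_def)
      moreover have "ok (e div 2) (e div 2) (c v)" using ok1[OF e] c3[OF v] by simp
      ultimately show ?thesis by metis
    qed
  qed
  show ?thesis
  proof (rule coloured_embedding[of G "{}" Pa \<phi> B c d])
    show "?P \<subseteq> codes k l" using k3 by (auto simp: Pa_def Pe_def codes_def)
    show "inj_on \<phi> ?P"
    proof (rule inj_onI)
      fix u v assume "u \<in> ?P" "v \<in> ?P" and eq: "\<phi> u = \<phi> v"
      define num where "num w = (if w = (0, 1) then 0 else fst w div 2)" for w :: "nat \<times> nat"
      have n: "\<phi> w = \<sigma> (num w)" "num w \<in> {..s}" "w = (if num w = 0 then (0, 1) else (2 * num w, 0))" if "w \<in> Pa" for w
      proof -
        show "\<phi> w = \<sigma> (num w)" by (simp add: \<phi>_def num_def)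
        have "i div 2 \<le> s" if "i < k + l" for i
          using that unfolding s_def by (intro div_le_mono) linarith
        then show "num w \<in> {..s}" using that by (auto simp: num_def Pa_def Pe_def)
        show "w = (if num w = 0 then (0, 1) else (2 * num w, 0))"
          using that by (auto simp: num_def Pa_def Pe_def)
      qed
      have uv: "u \<in> Pa" "v \<in> Pa" using \<open>u \<in> ?P\<close> \<open>v \<in> ?P\<close> by auto
      have "num u = num v"
        using inj_onD[OF inj, of "num u" "num v"] n(1,2)[OF uv(1)] n(1,2)[OF uv(2)] eq unfolding s_def by metis
      then show "u = v" using n(3)[OF uv(1)] n(3)[OF uv(2)] by metis
    qed
    show "\<phi> v \<in> nbrs G (\<phi> u)" if "u \<in> ?P" "v \<in> ?P" "code_adj k l u v" for u v
    proof -
      have uv: "u \<in> Pa" "v \<in> Pa" using that by auto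
      have "u = v"
        using that(3)
      proof (cases rule: code_adj_cases)
        case (inner j)
        show ?thesis
        proof (cases "j = 0")
          case True
          then show ?thesis using inner0(1)[of u] inner0(1)[of v] inner(3,4) uv by auto
        next
          case False
          show ?thesis
            using inner1(1)[OF inner(3) False inner(1) uv(1)] inner1(1)[OF inner(4) False inner(1) uv(2)] by simp
        qed
      next
        case (chord j)
        show ?thesis using last(1)[OF chord(3,1) uv(1)] last(1)[OF chord(4,1) uv(2)] by simp
      qed
      then show ?thesis using that(3) by (simp add: code_adj_def)
    qed
    show "real (card (B (c v) - nbrs G x)) \<le> d"
      if "u \<in> codes k l - ?P" "v \<in> codes k l - ?P" "code_adj k l u v" "x \<in> B (c u)" for u v x
      using miss[OF c3 c3 proper[OF that(3)] that(4)] that by auto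
    show "finite (B (c v))" if "v \<in> codes k l - ?P" for v
      using fin c3 that by auto
    show "3 * (k + l) * (2 * d + 1) < real (card {y \<in> B (c v). \<forall>u\<in>Pa. code_adj k l u v \<longrightarrow> y \<in> nbrs G (\<phi> u)})"
      if "v \<in> codes k l - ?P" for v
    proof -
      have v: "v \<in> codes k l" "v \<notin> Pa" using that by auto
      obtain r r' where r: "ok r r' (c v)" "\<forall>u\<in>Pa. code_adj k l u v \<longrightarrow> \<phi> u \<in> {\<sigma> r, \<sigma> r'}"
        using nb[OF v] by blast
      let ?S = "{y \<in> B (c v). \<forall>u\<in>Pa. code_adj k l u v \<longrightarrow> y \<in> nbrs G (\<phi> u)}"
      have "B (c v) \<inter> nbrs G (\<sigma> r) \<inter> nbrs G (\<sigma> r') \<subseteq> ?S" using r(2) by fastforce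
      then have "card (B (c v) \<inter> nbrs G (\<sigma> r) \<inter> nbrs G (\<sigma> r')) \<le> card ?S"
        using fin[OF c3[OF v]] by (intro card_mono) auto
      then show ?thesis using r(1) unfolding ok_def by linarith
    qed
  qed (use sg \<open>d \<ge> 0\<close> in auto)
qed

end

section \<open>Matchings and complete multipartite subgraphs\<close>

text \<open>A matching is extended edge by edge. If it stops before having \<open>r\<close> edges,
  its ends meet all edges inside \<open>X\<close>. The ends of the \<open>j\<close>-th edge carry
  the codes \<open>(j, 1)\<close> and \<open>(j, 2)\<close> of the new vertices whose places they
  will take.\<close>

lemma matching_or_cover:
  assumes "finite X"
  shows "(\<exists>e :: nat \<times> nat \<Rightarrow> 'a. inj_on e ({..<r} \<times> {1, 2}) \<and> e ` ({..<r} \<times> {1, 2}) \<subseteq> X \<and>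
      (\<forall>j<r. e (j, 2) \<in> nbrs G (e (j, 1)))) \<or>
    (\<exists>T\<subseteq>X. card T \<le> 2 * r \<and> (\<forall>u\<in>X - T. \<forall>v\<in>X - T. u \<noteq> v \<longrightarrow> v \<notin> nbrs G u))"
proof (induction r)
  case 0
  show ?case by (rule disjI1) auto
next
  case (Suc r)
  show ?case
  proof (cases "\<exists>e :: nat \<times> nat \<Rightarrow> 'a. inj_on e ({..<r} \<times> {1, 2}) \<and> e ` ({..<r} \<times> {1, 2}) \<subseteq> X \<and>
      (\<forall>j<r. e (j, 2) \<in> nbrs G (e (j, 1)))")
    case False
    then obtain T where "T \<subseteq> X" "card T \<le> 2 * r" "\<forall>u\<in>X - T. \<forall>v\<in>X - T. u \<noteq> v \<longrightarrow> v \<notin> nbrs G u"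
      using Suc by blast
    then show ?thesis by (intro disjI2 exI[of _ T]) auto
  next
    case True
    then obtain e :: "nat \<times> nat \<Rightarrow> 'a" where e: "inj_on e ({..<r} \<times> {1, 2})" "e ` ({..<r} \<times> {1, 2}) \<subseteq> X"
      "\<And>j. j < r \<Longrightarrow> e (j, 2) \<in> nbrs G (e (j, 1))" by blast
    define T where "T = e ` ({..<r} \<times> {1, 2})"
    have cT: "card T \<le> 2 * r"
      using card_image_le[of "{..<r} \<times> {1, 2::nat}" e] by (simp add: T_def)
    show ?thesis
    proof (cases "\<forall>u\<in>X - T. \<forall>v\<in>X - T. u \<noteq> v \<longrightarrow> v \<notin> nbrs G u")
      case True
      then show ?thesis using e(2) cT by (intro disjI2 exI[of _ T]) (auto simp: T_def)
    next
      case False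
      then obtain u v where uv: "u \<in> X - T" "v \<in> X - T" "u \<noteq> v" "v \<in> nbrs G u" by blast
      define e' where "e' = e((r, 1) := u, (r, 2) := v)"
      have dom: "{..<Suc r} \<times> {1, 2::nat} = {..<r} \<times> {1, 2} \<union> {(r, 1), (r, 2)}" by auto
      have old: "e' w = e w" if "w \<in> {..<r} \<times> {1, 2}" for w using that by (auto simp: e'_def)
      have im: "e' ` ({..<r} \<times> {1, 2}) = T" unfolding T_def by (rule image_cong) (use old in auto)
      have "inj_on e' ({..<Suc r} \<times> {1, 2})"
      proof -
        have "inj_on e' ({..<r} \<times> {1, 2})" using e(1) inj_on_cong[of "{..<r} \<times> {1, 2}" e' e] old by blast
        moreover have "inj_on e' {(r, 1), (r, 2)}" using uv by (auto simp: e'_def)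
        moreover have "e' ` ({..<r} \<times> {1, 2}) \<inter> e' ` {(r, 1), (r, 2)} = {}"
          unfolding im using uv by (auto simp: e'_def)
        ultimately show ?thesis unfolding dom inj_on_Un by blast
      qed
      moreover have "e' ` ({..<Suc r} \<times> {1, 2}) \<subseteq> X"
        unfolding dom image_Un im using uv e(2) by (auto simp: e'_def T_def)
      moreover have "e' (j, 2) \<in> nbrs G (e' (j, 1))" if "j < Suc r" for j
        using that e(3)[of j] uv(4) by (auto simp: e'_def less_Suc_eq)
      ultimately show ?thesis by blast
    qed
  qed
qed

text \<open>Every adjacent ordered pair in \<open>X\<close> has a component in \<open>T\<close>, and
  each vertex of \<open>T\<close> occurs in at most \<open>2 * D\<close> such pairs.\<close>

lemma pairs_le_cover:
  assumes sg: "simple_graph G" and "finite X" "T \<subseteq> X"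
    and cover: "\<And>u v. u \<in> X - T \<Longrightarrow> v \<in> X - T \<Longrightarrow> u \<noteq> v \<Longrightarrow> v \<notin> nbrs G u"
    and deg: "\<And>u. u \<in> X \<Longrightarrow> card (nbrs G u \<inter> X) \<le> D"
  shows "pairs G X X \<le> 2 * card T * D"
proof -
  have fin: "finite T" "finite (X - T)" using assms finite_subset by auto
  have X: "X = T \<union> (X - T)" using assms by auto
  have "pairs G X X = pairs G T X + pairs G (X - T) X"
    by (subst X, subst pairs_Un_left) (use fin in auto)
  also have "pairs G (X - T) X = pairs G (X - T) T + pairs G (X - T) (X - T)"
    using pairs_Un_right[of T "X - T" G "X - T"] X fin by auto
  also have "pairs G (X - T) (X - T) = 0"
  proof -
    have "nbrs G u \<inter> (X - T) = {}" if "u \<in> X - T" for u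
      using cover[OF that] nbrs_irrefl[OF sg, of u] by fastforce
    then show ?thesis by (simp add: pairs_def)
  qed
  also have "pairs G (X - T) T = pairs G T (X - T)" by (rule pairs_sym[OF fin(2,1)])
  also have "\<dots> \<le> pairs G T X" using assms fin by (intro pairs_mono) auto
  finally have "pairs G X X \<le> 2 * pairs G T X" by simp
  also have "pairs G T X \<le> card T * D"
    unfolding pairs_def using sum_bounded_above[of T "\<lambda>x. card (nbrs G x \<inter> X)" D] deg assms by auto
  finally show ?thesis by simp
qed

context odd_lollipop
begin

text \<open>A matching of \<open>k + l\<close> edges in \<open>X\<close> that avoids
  \<open>z\<close>, \<open>y1\<close> and \<open>y2\<close> would yield the blow-up by
  \<open>matching_not_free\<close>. So at most \<open>2 * (k + l)\<close> vertices, together with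
  these three, cover all edges inside \<open>X\<close>, which explains the constant. As
  \<open>z\<close> may lie outside \<open>X\<close>, an apex can take its role later.\<close>

lemma pairs_part_cherry:
  fixes B1 B2 X :: "'a set" and d :: real
  assumes sg: "simple_graph G" and free: "graph_free F G"
    and fin: "finite B1" "finite B2" "finite X" and "d \<ge> 0"
    and good: "\<And>x. x \<in> X \<Longrightarrow> real (card (B1 - nbrs G x)) \<le> d \<and> real (card (B2 - nbrs G x)) \<le> d"
    and B12: "\<And>x. x \<in> B1 \<Longrightarrow> real (card (B2 - nbrs G x)) \<le> d"
    and B21: "\<And>x. x \<in> B2 \<Longrightarrow> real (card (B1 - nbrs G x)) \<le> d"
    and big: "real (card (B1 \<inter> nbrs G z)) > 3 * (k + l) * (2 * d + 1)"
      "real (card (B2 \<inter> nbrs G z)) > 3 * (k + l) * (2 * d + 1)"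
    and y: "y1 \<in> X \<inter> nbrs G z" "y2 \<in> X \<inter> nbrs G z" "y1 \<noteq> y2"
    and deg: "\<And>u. u \<in> X \<Longrightarrow> card (nbrs G u \<inter> X) \<le> D"
  shows "pairs G X X \<le> (4 * (k + l) + 6) * D"
proof -
  let ?X = "X - {z, y1, y2}"
  have "finite ?X" using fin by simp
  from matching_or_cover[OF this, of "k + l" G] show ?thesis
  proof
    assume "\<exists>e :: nat \<times> nat \<Rightarrow> 'a. inj_on e ({..<k + l} \<times> {1, 2}) \<and> e ` ({..<k + l} \<times> {1, 2}) \<subseteq> ?X \<and>
      (\<forall>j<k + l. e (j, 2) \<in> nbrs G (e (j, 1)))"
    then obtain e :: "nat \<times> nat \<Rightarrow> 'a" where e: "inj_on e ({..<k + l} \<times> {1, 2})"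
      "e ` ({..<k + l} \<times> {1, 2}) \<subseteq> ?X" "\<And>j. j < k + l \<Longrightarrow> e (j, 2) \<in> nbrs G (e (j, 1))" by blast
    have "\<not> graph_free F G"
    proof (rule matching_not_free[OF sg fin(1,2) \<open>d \<ge> 0\<close> _ _ y(3) e(1) _ e(3) _ B12 B21 big])
      show "real (card (B1 - nbrs G x)) \<le> d \<and> real (card (B2 - nbrs G x)) \<le> d"
        if "x \<in> {y1, y2} \<union> e ` ({..<k + l} \<times> {1, 2})" for x
        using that e(2) y by (intro good) blast
    qed (use y e(2) in blast)+
    with free show ?thesis by blast
  next
    assume "\<exists>T\<subseteq>?X. card T \<le> 2 * (k + l) \<and> (\<forall>u\<in>?X - T. \<forall>v\<in>?X - T. u \<noteq> v \<longrightarrow> v \<notin> nbrs G u)"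
    then obtain T where T: "T \<subseteq> ?X" "card T \<le> 2 * (k + l)"
      "\<And>u v. u \<in> ?X - T \<Longrightarrow> v \<in> ?X - T \<Longrightarrow> u \<noteq> v \<Longrightarrow> v \<notin> nbrs G u" by blast
    let ?T = "T \<union> (X \<inter> {z, y1, y2})"
    have "pairs G X X \<le> 2 * card ?T * D"
      by (rule pairs_le_cover[OF sg fin(3) _ _ deg]) (use T in auto)
    also have "card ?T \<le> card T + card (X \<inter> {z, y1, y2})" by (rule card_Un_le)
    also have "card (X \<inter> {z, y1, y2}) \<le> card {z, y1, y2}" by (intro card_mono) auto
    also have "card {z, y1, y2} \<le> 3" by (simp add: card_insert_le_m1)
    also have "2 * (card T + 3) * D \<le> (4 * (k + l) + 6) * D" using T(2) by (intro mult_right_mono) auto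
    finally show ?thesis by simp
  qed
qed

text \<open>Either some \<open>z\<close> in \<open>X\<close> has two neighbours in \<open>X\<close>
  and the previous bound applies, or the edges inside \<open>X\<close> form a matching, which
  accounts for the summand \<open>card X\<close>.\<close>

lemma pairs_part:
  fixes B1 B2 X :: "'a set" and d :: real
  assumes sg: "simple_graph G" and free: "graph_free F G"
    and fin: "finite B1" "finite B2" "finite X" and "d \<ge> 0"
    and good: "\<And>x. x \<in> X \<Longrightarrow> real (card (B1 - nbrs G x)) \<le> d \<and> real (card (B2 - nbrs G x)) \<le> d"
    and B12: "\<And>x. x \<in> B1 \<Longrightarrow> real (card (B2 - nbrs G x)) \<le> d"
    and B21: "\<And>x. x \<in> B2 \<Longrightarrow> real (card (B1 - nbrs G x)) \<le> d"
    and big: "\<And>z. z \<in> X \<Longrightarrow> real (card (B1 \<inter> nbrs G z)) > 3 * (k + l) * (2 * d + 1)"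
      "\<And>z. z \<in> X \<Longrightarrow> real (card (B2 \<inter> nbrs G z)) > 3 * (k + l) * (2 * d + 1)"
    and deg: "\<And>u. u \<in> X \<Longrightarrow> card (nbrs G u \<inter> X) \<le> D"
  shows "pairs G X X \<le> card X + (4 * (k + l) + 6) * D"
proof (cases "\<exists>z\<in>X. \<exists>y1\<in>X \<inter> nbrs G z. \<exists>y2\<in>X \<inter> nbrs G z. y1 \<noteq> y2")
  case True
  then obtain z y1 y2 where z: "z \<in> X" "y1 \<in> X \<inter> nbrs G z" "y2 \<in> X \<inter> nbrs G z" "y1 \<noteq> y2" by blast
  from pairs_part_cherry[OF sg free fin \<open>d \<ge> 0\<close> good B12 B21 big(1)[OF z(1)] big(2)[OF z(1)] z(2-4) deg]
  show ?thesis by simp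
next
  case False
  have "card (nbrs G z \<inter> X) \<le> 1" if "z \<in> X" for z
    using False that fin by (subst One_nat_def, subst card_le_Suc0_iff_eq) auto
  then have "pairs G X X \<le> (\<Sum>z\<in>X. 1)" unfolding pairs_def by (intro sum_mono) auto
  then show ?thesis by simp
qed

end

section \<open>Complete multipartite subgraphs by counting\<close>

definition complete_parts :: "'a graph \<Rightarrow> nat \<Rightarrow> nat \<Rightarrow> (nat \<Rightarrow> 'a set) \<Rightarrow> bool" where
  "complete_parts G r m A \<longleftrightarrow> (\<forall>i<r. A i \<subseteq> verts G \<and> card (A i) = m) \<and>
    (\<forall>i<r. \<forall>j<r. i \<noteq> j \<longrightarrow> (\<forall>x\<in>A i. \<forall>y\<in>A j. y \<in> nbrs G x))"

text \<open>The parts have at most \<open>r * M\<close> vertices together, so among more than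
  \<open>m * 2 ^ (r * M)\<close> vertices some \<open>m\<close> have the same set of neighbours in
  them. These form the new part, and the common set contains \<open>m\<close> vertices of each old
  one.\<close>

lemma extend_complete_parts:
  assumes sg: "simple_graph G" and A: "complete_parts G r M A"
    and X: "X \<subseteq> verts G" "\<And>x i. x \<in> X \<Longrightarrow> i < r \<Longrightarrow> m \<le> card (nbrs G x \<inter> A i)"
    and big: "card X > m * 2 ^ (r * M)"
  shows "\<exists>A'. complete_parts G (Suc r) m A'"
proof -
  have finV: "finite (verts G)" using sg by (simp add: simple_graph_def)
  define T where "T = (\<Union>i<r. A i)"
  have finX: "finite X" using X(1) finV finite_subset by blast
  have A1: "A i \<subseteq> verts G" "card (A i) = M" if "i < r" for i using A that by (auto simp: complete_parts_def)
  have finT: "finite T" unfolding T_def using finite_subset[OF A1(1) finV] by auto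
  have "card T \<le> (\<Sum>i<r. card (A i))" unfolding T_def by (rule card_UN_le) simp
  then have cT: "card T \<le> r * M" using A1 by simp
  have "\<exists>S\<in>Pow T. card {x \<in> X. nbrs G x \<inter> T = S} \<ge> m"
  proof (rule ccontr)
    assume neg: "\<not> ?thesis"
    have sub: "X \<subseteq> (\<Union>S\<in>Pow T. {x \<in> X. nbrs G x \<inter> T = S})"
    proof
      fix x assume "x \<in> X"
      then show "x \<in> (\<Union>S\<in>Pow T. {x \<in> X. nbrs G x \<inter> T = S})"
        by (intro UN_I[of "nbrs G x \<inter> T"]) auto
    qed
    have "card X \<le> card (\<Union>S\<in>Pow T. {x \<in> X. nbrs G x \<inter> T = S})"
      by (rule card_mono[OF _ sub]) (use finT finX in auto)
    also have "\<dots> \<le> (\<Sum>S\<in>Pow T. card {x \<in> X. nbrs G x \<inter> T = S})"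
      by (rule card_UN_le) (use finT in simp)
    also have "\<dots> \<le> (\<Sum>S\<in>Pow T. m)" by (intro sum_mono) (use neg in \<open>meson linorder_le_cases\<close>)
    also have "\<dots> = m * 2 ^ card T" using finT by (simp add: card_Pow)
    also have "\<dots> \<le> m * 2 ^ (r * M)" using cT by (intro mult_left_mono power_increasing) auto
    finally show False using big by simp
  qed
  then obtain S where S: "S \<subseteq> T" "card {x \<in> X. nbrs G x \<inter> T = S} \<ge> m" by blast
  then obtain X' where X': "X' \<subseteq> {x \<in> X. nbrs G x \<inter> T = S}" "card X' = m"
    by (meson obtain_subset_with_card_n)
  have "\<exists>Ai. Ai \<subseteq> A i \<and> card Ai = m \<and> (\<forall>x\<in>X'. \<forall>y\<in>Ai. y \<in> nbrs G x)" if i: "i < r" for i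
  proof (cases "X' = {}")
    case True
    then have "m = 0" using X' by simp
    then show ?thesis by (intro exI[of _ "{}"]) auto
  next
    case False
    then obtain x0 where x0: "x0 \<in> X'" by blast
    then have "m \<le> card (nbrs G x0 \<inter> A i)" using X X' i by blast
    then obtain Ai where Ai: "Ai \<subseteq> nbrs G x0 \<inter> A i" "card Ai = m" by (meson obtain_subset_with_card_n)
    have "y \<in> nbrs G x" if "x \<in> X'" "y \<in> Ai" for x y
    proof -
      have "y \<in> nbrs G x0 \<inter> T" using that Ai i by (auto simp: T_def)
      then show ?thesis using X' x0 that by blast
    qed
    with Ai show ?thesis by blast
  qed
  then obtain A' where A': "\<And>i. i < r \<Longrightarrow> A' i \<subseteq> A i" "\<And>i. i < r \<Longrightarrow> card (A' i) = m"
    "\<And>i x y. i < r \<Longrightarrow> x \<in> X' \<Longrightarrow> y \<in> A' i \<Longrightarrow> y \<in> nbrs G x" by metis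
  have "complete_parts G (Suc r) m (A'(r := X'))"
    unfolding complete_parts_def
  proof (intro conjI allI impI ballI)
    fix i assume "i < Suc r"
    then show "(A'(r := X')) i \<subseteq> verts G" "card ((A'(r := X')) i) = m"
      using A'(1,2)[of i] A1(1)[of i] X(1) X' unfolding less_Suc_eq by (auto; blast)+
  next
    fix i j x y assume ij: "i < Suc r" "j < Suc r" "i \<noteq> j" "x \<in> (A'(r := X')) i" "y \<in> (A'(r := X')) j"
    show "y \<in> nbrs G x"
    proof (cases "i = r \<or> j = r")
      case True
      then show ?thesis
      proof
        assume "i = r"
        then show ?thesis using ij A'(3)[of j x y] by auto
      next
        assume "j = r"
        then show ?thesis using ij A'(3)[of i y x] nbrs_sym[of y G x] by auto
      qed
    next
      case False
      then have "i < r" "j < r" "x \<in> A i" "y \<in> A j" using ij A'(1) by (auto simp: less_Suc_eq)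
      then show ?thesis using A ij(3) unfolding complete_parts_def by blast
    qed
  qed
  then show ?thesis by blast
qed

text \<open>The edges between the parts and \<open>verts G\<close> are counted from both sides. A
  vertex outside \<open>X\<close> sees fewer than \<open>M\<close> vertices of some part, hence at
  most \<open>(r - 1) * (4 * M) + M\<close> in all, against an average of at least two thirds of
  \<open>4 * M * r\<close>. For \<open>r = 2\<close> this is 5 M against 16 M / 3, so parts of size
  \<open>4 * M\<close> leave a margin, and \<open>X\<close> contains at least a twelfth of all
  vertices.\<close>

lemma grow_complete_parts:
  assumes sg: "simple_graph G" and n: "card (verts G) = n" and M: "M \<ge> 1"
    and deg: "\<And>v. v \<in> verts G \<Longrightarrow> 2 * n \<le> 3 * card (nbrs G v)"
    and A: "complete_parts G r (4 * M) A" and r: "r \<le> 2"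
    and big: "n > 24 * M * 2 ^ (8 * M)"
  shows "\<exists>A'. complete_parts G (Suc r) M A'"
proof -
  have finV: "finite (verts G)" using sg by (simp add: simple_graph_def)
  define X where "X = {v \<in> verts G. \<forall>i<r. M \<le> card (nbrs G v \<inter> A i)}"
  have XV: "X \<subseteq> verts G" by (auto simp: X_def)
  have Ai: "A i \<subseteq> verts G" "card (A i) = 4 * M" "finite (A i)" if "i < r" for i
    using A that finite_subset[OF _ finV] by (auto simp: complete_parts_def)
  have nb: "nbrs G v \<inter> verts G = nbrs G v" for v using nbrs_subset[OF sg] by blast
  have le4: "card (nbrs G v \<inter> A i) \<le> 4 * M" if "i < r" for v i
    using card_mono[of "A i" "nbrs G v \<inter> A i"] Ai that by auto
  have lower: "2 * n * (4 * M * r) \<le> 3 * (\<Sum>v\<in>verts G. \<Sum>i<r. card (nbrs G v \<inter> A i))"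
  proof -
    have "(\<Sum>v\<in>verts G. \<Sum>i<r. card (nbrs G v \<inter> A i)) = (\<Sum>i<r. pairs G (verts G) (A i))"
      unfolding pairs_def by (rule sum.swap)
    also have "\<dots> = (\<Sum>i<r. pairs G (A i) (verts G))"
      by (intro sum.cong refl pairs_sym) (use finV Ai in auto)
    finally have eq: "(\<Sum>v\<in>verts G. \<Sum>i<r. card (nbrs G v \<inter> A i)) = (\<Sum>i<r. pairs G (A i) (verts G))" .
    have "4 * M * (2 * n) \<le> 3 * pairs G (A i) (verts G)" if "i < r" for i
    proof -
      have "card (A i) * (2 * n) \<le> (\<Sum>v\<in>A i. 3 * card (nbrs G v))"
        using sum_bounded_below[of "A i" "2 * n" "\<lambda>v. 3 * card (nbrs G v)"] deg Ai(1)[OF that] by auto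
      then show ?thesis using Ai(2)[OF that] by (simp add: pairs_def nb sum_distrib_left)
    qed
    then have "(\<Sum>i<r. 4 * M * (2 * n)) \<le> (\<Sum>i<r. 3 * pairs G (A i) (verts G))" by (intro sum_mono) auto
    then show ?thesis unfolding eq by (simp add: sum_distrib_left algebra_simps)
  qed
  have upper: "(\<Sum>i<r. card (nbrs G v \<inter> A i)) \<le> (r - 1) * (4 * M) + M + (if v \<in> X then 4 * M else 0)"
    if v: "v \<in> verts G" for v
  proof (cases "v \<in> X")
    case True
    have "(\<Sum>i<r. card (nbrs G v \<inter> A i)) \<le> r * (4 * M)"
      using sum_bounded_above[of "{..<r}" "\<lambda>i. card (nbrs G v \<inter> A i)" "4 * M"] le4 by auto
    also have "\<dots> \<le> (r - 1) * (4 * M) + 4 * M" by (cases r) auto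
    finally show ?thesis using True by simp
  next
    case False
    then obtain i where i: "i < r" "card (nbrs G v \<inter> A i) < M" using v by (auto simp: X_def)
    have "(\<Sum>j\<in>{..<r} - {i}. card (nbrs G v \<inter> A j)) \<le> card ({..<r} - {i}) * (4 * M)"
      using sum_bounded_above[of "{..<r} - {i}" "\<lambda>i. card (nbrs G v \<inter> A i)" "4 * M"] le4 by auto
    moreover have "(\<Sum>j<r. card (nbrs G v \<inter> A j)) = card (nbrs G v \<inter> A i) + (\<Sum>j\<in>{..<r} - {i}. card (nbrs G v \<inter> A j))"
      using i by (intro sum.remove) auto
    ultimately show ?thesis using i by simp
  qed
  have "(\<Sum>v\<in>verts G. \<Sum>i<r. card (nbrs G v \<inter> A i)) \<le>
      (\<Sum>v\<in>verts G. (r - 1) * (4 * M) + M + (if v \<in> X then 4 * M else 0))"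
    by (rule sum_mono) (rule upper)
  also have "\<dots> = n * ((r - 1) * (4 * M) + M) + (\<Sum>v\<in>verts G. if v \<in> X then 4 * M else 0)"
    by (simp only: sum.distrib sum_constant n of_nat_id add_mult_distrib2)
  also have "(\<Sum>v\<in>verts G. if v \<in> X then 4 * M else 0) = card X * (4 * M)"
    using sum.inter_restrict[OF finV, of "\<lambda>_. 4 * M" X] XV by (simp add: Int_absorb1)
  finally have "(\<Sum>v\<in>verts G. \<Sum>i<r. card (nbrs G v \<inter> A i)) \<le> n * ((r - 1) * (4 * M) + M) + card X * (4 * M)" .
  from order_trans[OF lower mult_le_mono2[OF this]]
  have step: "2 * n * (4 * M * r) \<le> 3 * (n * ((r - 1) * (4 * M) + M) + card X * (4 * M))" .
  have main: "2 * n * 4 * r \<le> 3 * (n * ((r - 1) * 4 + 1) + card X * 4)"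
  proof -
    have "M * (2 * n * 4 * r) \<le> M * (3 * (n * ((r - 1) * 4 + 1) + card X * 4))"
      using step by (simp add: algebra_simps)
    then show ?thesis using M by simp
  qed
  have "n \<le> 12 * card X"
  proof -
    consider "r = 0" | "r = 1" | "r = 2" using r by linarith
    then show ?thesis
    proof cases
      case 1
      then have "X = verts G" by (auto simp: X_def)
      then show ?thesis using n by simp
    qed (use main in simp_all)
  qed
  moreover have "24 * M * 2 ^ (r * (4 * M)) \<le> 24 * M * 2 ^ (8 * M)"
    using r by (intro mult_left_mono power_increasing) auto
  ultimately have "card X > M * 2 ^ (r * (4 * M))" using big by linarith
  then show ?thesis by (intro extend_complete_parts[OF sg A XV]) (auto simp: X_def)
qed

lemma complete_3_parts_exist:
  assumes M: "M \<ge> 1"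
  shows "\<exists>N. \<forall>G :: 'a graph. simple_graph G \<longrightarrow> card (verts G) \<ge> N \<longrightarrow>
    (\<forall>v\<in>verts G. 2 * card (verts G) \<le> 3 * card (nbrs G v)) \<longrightarrow> (\<exists>A. complete_parts G 3 M A)"
proof (rule exI, intro allI impI)
  fix G :: "'a graph"
  \<comment> \<open>The part sizes shrink as 16 M, 4 M, M. The size condition of
    \<open>grow_complete_parts\<close> is strongest for 16 M, where its constants 24 and 8 become
    384 and 128.\<close>
  assume sg: "simple_graph G" and n: "card (verts G) \<ge> 384 * M * 2 ^ (128 * M) + 1"
    and deg: "\<forall>v\<in>verts G. 2 * card (verts G) \<le> 3 * card (nbrs G v)"
  have big: "card (verts G) > 24 * (c * M) * 2 ^ (8 * (c * M))" if "c \<le> 16" for c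
  proof -
    have "24 * (c * M) * 2 ^ (8 * (c * M)) \<le> 384 * M * 2 ^ (128 * M)"
    proof (rule mult_mono)
      have "c * M \<le> 16 * M" using that by simp
      then show "24 * (c * M) \<le> 384 * M" "(2::nat) ^ (8 * (c * M)) \<le> 2 ^ (128 * M)"
        by (simp_all add: power_increasing)
    qed auto
    with n show ?thesis by linarith
  qed
  have step: "\<exists>A'. complete_parts G (Suc r) (c * M) A'"
    if "complete_parts G r (4 * (c * M)) A" "r \<le> 2" "1 \<le> c" "c \<le> 16" for r c A
    by (rule grow_complete_parts[OF sg refl _ _ that(1,2) big[OF that(4)]]) (use deg M that in auto)
  have "complete_parts G 0 (4 * (16 * M)) (\<lambda>_. {})" by (simp add: complete_parts_def)
  from step[OF this] obtain A1 where A1: "complete_parts G (Suc 0) (16 * M) A1" by auto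
  have "\<exists>A'. complete_parts G (Suc (Suc 0)) (4 * M) A'" by (rule step[of _ 4 A1]) (use A1 in auto)
  then obtain A2 where A2: "complete_parts G (Suc (Suc 0)) (4 * M) A2" ..
  have "\<exists>A'. complete_parts G (Suc (Suc (Suc 0))) (1 * M) A'" by (rule step[of _ 1 A2]) (use A2 in auto)
  then show "\<exists>A. complete_parts G 3 M A" by (simp add: numeral_3_eq_3)
qed

section \<open>A rough tripartition\<close>

context odd_lollipop
begin

text \<open>Vertices are sorted by their adjacency to a complete tripartite subgraph with parts
  \<open>A i\<close> of constant size \<open>M\<close>. Those with \<open>m\<close> neighbours in
  each \<open>A i\<close> form \<open>Ap\<close>, which is bounded since otherwise a complete
  4-partite subgraph arises. All others see at most \<open>2 * M + m\<close> vertices of the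
  \<open>A i\<close>, and those in \<open>R\<close> at least \<open>D\<close> fewer, whereas the
  average is at least \<open>2 * M\<close>; so \<open>R\<close> is small once \<open>D\<close> is
  large against \<open>m / \<gamma>\<close>. Finally \<open>pairs_part\<close>, with two of the
  \<open>A j\<close> as reservoirs, bounds the edges inside \<open>V i\<close>.\<close>

lemma near_partition:
  fixes \<gamma> :: real
  assumes "\<gamma> > 0"
  shows "\<exists>N. \<forall>G :: 'a graph. simple_graph G \<longrightarrow> graph_free F G \<longrightarrow> card (verts G) \<ge> N \<longrightarrow>
    (\<forall>v\<in>verts G. 2 * card (verts G) \<le> 3 * card (nbrs G v)) \<longrightarrow>
    (\<exists>V :: nat \<Rightarrow> 'a set. (\<forall>i<3. V i \<subseteq> verts G) \<and> (\<forall>i<3. \<forall>j<3. i \<noteq> j \<longrightarrow> V i \<inter> V j = {}) \<and>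
      real (card (verts G - (\<Union>i<3. V i))) \<le> \<gamma> * card (verts G) \<and>
      (\<forall>i<3. pairs G (V i) (V i) \<le> (4 * (k + l) + 7) * card (verts G)))"
proof -
  define m where "m = 3 * (k + l) + 1"
  obtain D :: nat where D: "D > 2 * m / \<gamma>" using reals_Archimedean2 by blast
  then have D\<gamma>: "real m \<le> \<gamma> / 2 * D" and D1: "D \<ge> 1"
  proof -
    have "0 < 2 * m / \<gamma>" using assms by (simp add: m_def)
    with D show "D \<ge> 1" by (cases D) auto
    show "real m \<le> \<gamma> / 2 * D" using D assms by (simp add: field_simps)
  qed
  \<comment> \<open>The summands \<open>m + D\<close> keep the \<open>V i\<close> disjoint, and the
    last one is the room that \<open>pairs_part\<close> asks for in the \<open>A j\<close>.\<close>
  define M where "M = m + D + 3 * (k + l) * (2 * D + 1)"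
  define P where "P = m * 2 ^ (3 * M)"
  obtain N1 where N1: "\<And>G :: 'a graph. simple_graph G \<Longrightarrow> card (verts G) \<ge> N1 \<Longrightarrow>
    (\<forall>v\<in>verts G. 2 * card (verts G) \<le> 3 * card (nbrs G v)) \<Longrightarrow> (\<exists>A. complete_parts G 3 M A)"
    using complete_3_parts_exist[of M] by (auto simp: M_def m_def)
  obtain N2 :: nat where N2: "N2 > 2 * (3 * M * P + P) / \<gamma>" using reals_Archimedean2 by blast
  show ?thesis
  proof (rule exI[of _ "max N1 N2"], intro allI impI)
    fix G :: "'a graph"
    assume sg: "simple_graph G" and free: "graph_free F G" and n: "max N1 N2 \<le> card (verts G)"
      and deg: "\<forall>v\<in>verts G. 2 * card (verts G) \<le> 3 * card (nbrs G v)"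
    have finV: "finite (verts G)" using sg by (simp add: simple_graph_def)
    have "\<exists>A. complete_parts G 3 M A" by (rule N1) (use sg n deg in auto)
    then obtain A where A: "complete_parts G 3 M A" ..
    have Ai: "A i \<subseteq> verts G" "card (A i) = M" "finite (A i)" if "i < 3" for i
      using A that finite_subset[OF _ finV] by (auto simp: complete_parts_def)
    have Aij: "y \<in> nbrs G x" if "i < 3" "j < 3" "i \<noteq> j" "x \<in> A i" "y \<in> A j" for i j x y
      using A that unfolding complete_parts_def by blast
    have split: "card (nbrs G v \<inter> A i) + card (A i - nbrs G v) = M" if "i < 3" for i v
    proof -
      have "card (A i) = card (nbrs G v \<inter> A i) + card (A i - nbrs G v)"
        using Ai(3)[OF that] by (subst card_Un_disjoint[symmetric]) (auto intro!: arg_cong[of _ _ card])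
      then show ?thesis using Ai(2)[OF that] by simp
    qed
    define V where "V i = {v \<in> verts G. card (nbrs G v \<inter> A i) < m \<and>
      (\<forall>j<3. j \<noteq> i \<longrightarrow> card (A j - nbrs G v) < D)}" for i
    define Ap where "Ap = {v \<in> verts G. \<forall>i<3. m \<le> card (nbrs G v \<inter> A i)}"
    define R where "R = verts G - Ap - (\<Union>i<3. V i)"
    have finR: "finite Ap" "finite R" "Ap \<subseteq> verts G" "R \<subseteq> verts G" using finV by (auto simp: Ap_def R_def)
    have cAp: "card Ap \<le> P"
    proof (rule ccontr)
      assume "\<not> ?thesis"
      then have "\<exists>A'. complete_parts G (Suc 3) m A'"
        by (intro extend_complete_parts[OF sg A, of Ap]) (auto simp: Ap_def P_def)
      then obtain A' where A': "complete_parts G 4 m A'" by (auto simp: eval_nat_numeral)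
      have "\<not> graph_free F G"
        by (rule complete_4_partite_not_free[OF sg, of A'])
          (use A' finite_subset[OF _ finV] in \<open>auto simp: complete_parts_def m_def\<close>)
      with free show False by blast
    qed
    let ?a = "\<lambda>v. \<Sum>i<3. card (nbrs G v \<inter> A i)"
    have three: "(\<Sum>i<3. f i) = f 0 + f 1 + f 2" for f :: "nat \<Rightarrow> nat"
      by (simp add: eval_nat_numeral)
    have i3: "i = 0 \<or> i = 1 \<or> i = 2" if "i < 3" for i :: nat using that by auto
    have leM: "card (nbrs G v \<inter> A i) \<le> M" if "i < 3" for v i using split[OF that, of v] by linarith
    have up: "?a v + (if v \<in> R then D else 0) \<le> 2 * M + m + (if v \<in> Ap then M else 0)" if v: "v \<in> verts G" for v
    proof (cases "v \<in> Ap")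
      case True
      then have "v \<notin> R" by (auto simp: R_def)
      with True show ?thesis using leM[of 0 v] leM[of 1 v] leM[of 2 v] by (simp add: three)
    next
      case False
      then obtain i where i: "i < 3" "card (nbrs G v \<inter> A i) < m" using v by (auto simp: Ap_def not_le)
      show ?thesis
      proof (cases "v \<in> R")
        case True
        then have "v \<notin> V i" using i by (auto simp: R_def)
        then obtain j where j: "j < 3" "j \<noteq> i" "D \<le> card (A j - nbrs G v)"
          using v i by (auto simp: V_def not_less)
        have "card (nbrs G v \<inter> A j) + D \<le> M" using split[OF j(1), of v] j(3) by linarith
        then show ?thesis using True i(2) leM[of 0 v] leM[of 1 v] leM[of 2 v] i3[OF i(1)] i3[OF j(1)] j(2)
          by (simp add: three) auto
      next
        case False
        then show ?thesis using i(2) leM[of 0 v] leM[of 1 v] leM[of 2 v] i3[OF i(1)]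
          by (simp add: three) auto
      qed
    qed
    have lower: "2 * M * card (verts G) \<le> (\<Sum>v\<in>verts G. ?a v)"
    proof -
      have nb: "nbrs G v \<inter> verts G = nbrs G v" for v using nbrs_subset[OF sg] by blast
      have "(\<Sum>v\<in>verts G. ?a v) = (\<Sum>i<3. pairs G (verts G) (A i))"
        unfolding pairs_def by (rule sum.swap)
      also have "\<dots> = (\<Sum>i<3. pairs G (A i) (verts G))"
        by (intro sum.cong refl pairs_sym) (use finV Ai in auto)
      finally have eq: "(\<Sum>v\<in>verts G. ?a v) = (\<Sum>i<3. pairs G (A i) (verts G))" .
      have "M * (2 * card (verts G)) \<le> 3 * pairs G (A i) (verts G)" if "i < 3" for i
      proof -
        have "card (A i) * (2 * card (verts G)) \<le> (\<Sum>v\<in>A i. 3 * card (nbrs G v))"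
          using sum_bounded_below[of "A i" "2 * card (verts G)" "\<lambda>v. 3 * card (nbrs G v)"] deg Ai(1)[OF that] by auto
        then show ?thesis using Ai(2)[OF that] by (simp add: pairs_def nb sum_distrib_left)
      qed
      from this[of 0] this[of 1] this[of 2]
      have "2 * M * card (verts G) \<le> (\<Sum>i<3. pairs G (A i) (verts G))" by (simp add: three)
      then show ?thesis unfolding eq .
    qed
    have "(\<Sum>v\<in>verts G. ?a v + (if v \<in> R then D else 0)) \<le>
        (\<Sum>v\<in>verts G. 2 * M + m + (if v \<in> Ap then M else 0))"
      by (rule sum_mono) (rule up)
    moreover have "(\<Sum>v\<in>verts G. if v \<in> R then D else 0) = card R * D"
      using sum.inter_restrict[OF finV, of "\<lambda>_. D" R] finR by (simp add: Int_absorb1)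
    moreover have "(\<Sum>v\<in>verts G. if v \<in> Ap then M else 0) = card Ap * M"
      using sum.inter_restrict[OF finV, of "\<lambda>_. M" Ap] finR by (simp add: Int_absorb1)
    ultimately have le: "(\<Sum>v\<in>verts G. ?a v) + card R * D \<le> card (verts G) * (2 * M + m) + card Ap * M"
      by (simp only: sum.distrib sum_constant of_nat_id add_mult_distrib2)
    have "card R * D \<le> card (verts G) * m + P * M"
    proof -
      have "card Ap * M \<le> P * M" using cAp by (rule mult_right_mono) simp
      moreover have "card (verts G) * (2 * M + m) = 2 * M * card (verts G) + card (verts G) * m"
        by (simp add: algebra_simps)
      ultimately show ?thesis using le lower by linarith
    qed
    then have "real (card R) * D \<le> real (card (verts G)) * real m + real P * real M"
      by (metis of_nat_add of_nat_le_iff of_nat_mult)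
    also have "\<dots> \<le> card (verts G) * (\<gamma> / 2 * D) + real (P * M) * real D"
    proof (rule add_mono)
      show "real (card (verts G)) * real m \<le> card (verts G) * (\<gamma> / 2 * D)" using D\<gamma> by (rule mult_left_mono) simp
      have "P * M * 1 \<le> P * M * D" using D1 by (rule mult_left_mono) simp
      then show "real P * real M \<le> real (P * M) * D" by (metis mult.right_neutral of_nat_le_iff of_nat_mult)
    qed
    also have "\<dots> = (\<gamma> / 2 * card (verts G) + P * M) * D" by (simp add: algebra_simps)
    finally have cR: "real (card R) \<le> \<gamma> / 2 * card (verts G) + P * M" using D1 by simp
    have "2 * (3 * M * P + P) / \<gamma> < card (verts G)" using N2 n by (meson less_le_trans max.bounded_iff of_nat_le_iff)
    then have "real (2 * (3 * M * P + P)) < \<gamma> * card (verts G)" using assms by (simp add: field_simps)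
    moreover have "2 * (P * M + P) \<le> 2 * (3 * M * P + P)" by (simp add: algebra_simps)
    then have "real (2 * (P * M + P)) \<le> real (2 * (3 * M * P + P))" by (rule of_nat_mono)
    ultimately have "real (2 * (P * M + P)) \<le> \<gamma> * card (verts G)" by (rule order_trans[rotated, OF less_imp_le])
    then have "P * M + P \<le> \<gamma> / 2 * card (verts G)" by simp
    moreover have "card (verts G - (\<Union>i<3. V i)) \<le> card (R \<union> Ap)"
      using finR by (intro card_mono) (auto simp: R_def)
    then have "real (card (verts G - (\<Union>i<3. V i))) \<le> card R + P"
      using card_Un_le[of R Ap] cAp by linarith
    ultimately have rest: "real (card (verts G - (\<Union>i<3. V i))) \<le> \<gamma> * card (verts G)"
      using cR by simp
    have disj: "V i \<inter> V j = {}" if "i < 3" "j < 3" "i \<noteq> j" for i j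
    proof -
      have "M < m + D" if "v \<in> V i" "v \<in> V j" for v
        using that split[OF \<open>i < 3\<close>, of v] \<open>i < 3\<close> \<open>i \<noteq> j\<close> by (fastforce simp: V_def)
      then show ?thesis by (fastforce simp: M_def)
    qed
    have dense: "pairs G (V i) (V i) \<le> (4 * (k + l) + 7) * card (verts G)" if i: "i < 3" for i
    proof -
      obtain a b where ab: "a < 3" "b < 3" "a \<noteq> b" "a \<noteq> i" "b \<noteq> i"
      proof -
        have "(i + 1) mod 3 < 3" "(i + 2) mod 3 < 3" "(i + 1) mod 3 \<noteq> (i + 2) mod 3"
          "(i + 1) mod 3 \<noteq> i" "(i + 2) mod 3 \<noteq> i" using i by presburger+
        then show ?thesis using that by blast
      qed
      have Vsub: "V i \<subseteq> verts G" by (auto simp: V_def)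
      have miss: "card (A j - nbrs G v) < D" if "v \<in> V i" "j < 3" "j \<noteq> i" for v j using that by (auto simp: V_def)
      have bigA: "real (card (A j \<inter> nbrs G v)) > 3 * (k + l) * (2 * real D + 1)"
        if "v \<in> V i" "j < 3" "j \<noteq> i" for v j
      proof -
        have "card (A j \<inter> nbrs G v) > 3 * (k + l) * (2 * D + 1)"
          using miss[OF that] split[OF that(2), of v] by (simp add: M_def Int_commute)
        then have "real (card (A j \<inter> nbrs G v)) > real (3 * (k + l) * (2 * D + 1))" by linarith
        then show ?thesis by (simp add: algebra_simps)
      qed
      have none: "real (card (A j' - nbrs G x)) \<le> D" if "j < 3" "j' < 3" "j \<noteq> j'" "x \<in> A j" for j j' x
      proof -
        have "A j' - nbrs G x = {}" using Aij[OF that(1-4)] by blast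
        then show ?thesis by (simp only: card.empty of_nat_0 of_nat_0_le_iff)
      qed
      have "pairs G (V i) (V i) \<le> card (V i) + (4 * (k + l) + 6) * card (verts G)"
      proof (rule pairs_part[OF sg free, of "A a" "A b" "V i" "real D"])
        show "real (card (A a - nbrs G x)) \<le> real D \<and> real (card (A b - nbrs G x)) \<le> real D" if "x \<in> V i" for x
          using miss[OF that, of a] miss[OF that, of b] ab by simp
        show "card (nbrs G u \<inter> V i) \<le> card (verts G)" for u
          using Vsub finV by (intro card_mono) auto
      qed (use Ai ab finV Vsub finite_subset bigA none in auto)
      also have "card (V i) \<le> card (verts G)" using Vsub finV by (rule card_mono[rotated])
      finally show ?thesis by (simp add: algebra_simps)
    qed
    show "\<exists>V :: nat \<Rightarrow> 'a set. (\<forall>i<3. V i \<subseteq> verts G) \<and> (\<forall>i<3. \<forall>j<3. i \<noteq> j \<longrightarrow> V i \<inter> V j = {}) \<and>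
      real (card (verts G - (\<Union>i<3. V i))) \<le> \<gamma> * card (verts G) \<and>
      (\<forall>i<3. pairs G (V i) (V i) \<le> (4 * (k + l) + 7) * card (verts G))"
      using disj rest dense by (intro exI[of _ V]) (auto simp: V_def)
  qed
qed

end

section \<open>Apex vertices\<close>

lemma card_two_subsets:
  assumes "finite S" "S1 \<subseteq> S" "S2 \<subseteq> S"
  shows "card S1 + card S2 \<le> card S + card (S1 \<inter> S2)"
proof -
  have "card S1 + card S2 = card (S1 \<union> S2) + card (S1 \<inter> S2)"
    using assms finite_subset by (intro card_Un_Int) auto
  also have "card (S1 \<union> S2) \<le> card S" using assms by (intro card_mono) auto
  finally show ?thesis by simp
qed

lemma card_three_subsets:
  assumes "finite S" "S1 \<subseteq> S" "S2 \<subseteq> S" "S3 \<subseteq> S"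
  shows "card S1 + card S2 + card S3 \<le> card S + card (S1 \<inter> S2) + card (S1 \<inter> S3) + card (S2 \<inter> S3)"
proof -
  have fin: "finite S1" "finite S2" "finite S3" using assms by (auto intro: finite_subset)
  have "card S1 + card S2 = card (S1 \<union> S2) + card (S1 \<inter> S2)"
    using fin by (intro card_Un_Int) auto
  moreover have "card (S1 \<union> S2) + card S3 \<le> card S + card ((S1 \<union> S2) \<inter> S3)"
    using assms by (intro card_two_subsets) auto
  moreover have "card ((S1 \<union> S2) \<inter> S3) \<le> card (S1 \<inter> S3) + card (S2 \<inter> S3)"
    unfolding Int_Un_distrib2 by (rule card_Un_le)
  ultimately show ?thesis by linarith
qed

text \<open>One parameter \<open>\<gamma>\<close> measures all errors. The pairs inside a part are
  bounded by its square, so that at most \<open>\<gamma> * n\<close> vertices of a part have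
  \<open>\<gamma> * n\<close> or more neighbours in it.\<close>

locale rough_partition = odd_lollipop +
  fixes G :: "'a graph" and V :: "nat \<Rightarrow> 'a set" and \<gamma> n :: real
  assumes sg: "simple_graph G" and free: "graph_free F G"
    and n_def: "n = real (card (verts G))" and n0: "n > 0"
    and deg: "\<And>v. v \<in> verts G \<Longrightarrow> 2 * n \<le> 3 * real (card (nbrs G v))"
    and V_sub: "\<And>i. i < 3 \<Longrightarrow> V i \<subseteq> verts G"
    and V_disj: "\<And>i j. i < 3 \<Longrightarrow> j < 3 \<Longrightarrow> i \<noteq> j \<Longrightarrow> V i \<inter> V j = {}"
    and rest: "real (card (verts G - (\<Union>i<3. V i))) \<le> \<gamma> * n"
    and dense: "\<And>i. i < 3 \<Longrightarrow> real (pairs G (V i) (V i)) \<le> \<gamma>\<^sup>2 * n\<^sup>2"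
    and \<gamma>: "0 < \<gamma>" "\<gamma> \<le> 1 / 1000"
begin

lemma finV: "finite (verts G)" using sg by (simp add: simple_graph_def)

lemma fin: "i < 3 \<Longrightarrow> finite (V i)"
  using V_sub finV finite_subset by blast

lemma parts_sum:
  assumes "S \<subseteq> verts G"
  shows "real (card S) \<le> real (card (S \<inter> V 0)) + real (card (S \<inter> V 1)) + real (card (S \<inter> V 2)) + \<gamma> * n"
proof -
  let ?R = "verts G - (\<Union>i<3. V i)"
  have "S \<subseteq> (S \<inter> V 0) \<union> (S \<inter> V 1) \<union> (S \<inter> V 2) \<union> ?R"
  proof
    fix x assume x: "x \<in> S"
    show "x \<in> (S \<inter> V 0) \<union> (S \<inter> V 1) \<union> (S \<inter> V 2) \<union> ?R"
    proof (cases "x \<in> (\<Union>i<3. V i)")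
      case True
      then obtain i where "i < 3" "x \<in> V i" by blast
      moreover have "i = 0 \<or> i = 1 \<or> i = 2" using \<open>i < 3\<close> by auto
      ultimately show ?thesis using x by auto
    next
      case False
      then show ?thesis using x assms by blast
    qed
  qed
  then have "card S \<le> card ((S \<inter> V 0) \<union> (S \<inter> V 1) \<union> (S \<inter> V 2) \<union> ?R)"
    using fin finV by (intro card_mono) auto
  also have "\<dots> \<le> card ((S \<inter> V 0) \<union> (S \<inter> V 1) \<union> (S \<inter> V 2)) + card ?R" by (rule card_Un_le)
  also have "card ((S \<inter> V 0) \<union> (S \<inter> V 1) \<union> (S \<inter> V 2)) \<le> card ((S \<inter> V 0) \<union> (S \<inter> V 1)) + card (S \<inter> V 2)" by (rule card_Un_le)
  also have "card ((S \<inter> V 0) \<union> (S \<inter> V 1)) \<le> card (S \<inter> V 0) + card (S \<inter> V 1)" by (rule card_Un_le)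
  finally have "card S \<le> card (S \<inter> V 0) + card (S \<inter> V 1) + card (S \<inter> V 2) + card ?R" by simp
  then have "real (card S) \<le> real (card (S \<inter> V 0)) + real (card (S \<inter> V 1)) + real (card (S \<inter> V 2)) + real (card ?R)" by linarith
  then show ?thesis using rest by linarith
qed

text \<open>The vertices of \<open>V i\<close> have degree at least 2 n / 3 and on average only few
  neighbours in \<open>V i\<close>, so the complement of \<open>V i\<close> cannot be much smaller
  than 2 n / 3.\<close>

lemma card_V_upper:
  assumes i: "i < 3" shows "real (card (V i)) \<le> n / 3 + \<gamma> * n"
proof (rule ccontr)
  assume neg: "\<not> ?thesis"
  define v where "v = real (card (V i))"
  have nb: "nbrs G x \<inter> verts G = nbrs G x" for x using nbrs_subset[OF sg] by blast
  have "verts G = V i \<union> (verts G - V i)" using V_sub[OF i] by blast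
  then have "pairs G (V i) (verts G) = pairs G (V i) (V i) + pairs G (V i) (verts G - V i)"
    using pairs_Un_right[of "V i" "verts G - V i" G "V i"] fin[OF i] finV by auto
  also have "pairs G (V i) (verts G - V i) \<le> card (V i) * card (verts G - V i)"
    using finV by (intro pairs_le) auto
  also have "card (verts G - V i) = card (verts G) - card (V i)"
    using V_sub[OF i] fin[OF i] by (intro card_Diff_subset) auto
  finally have "real (pairs G (V i) (verts G)) \<le> real (pairs G (V i) (V i)) + real (card (V i) * (card (verts G) - card (V i)))"
    by linarith
  also have "real (card (V i) * (card (verts G) - card (V i))) = v * (n - v)"
    using card_mono[OF finV V_sub[OF i]] by (simp add: v_def n_def of_nat_diff)
  finally have up: "real (pairs G (V i) (verts G)) \<le> \<gamma>\<^sup>2 * n\<^sup>2 + v * (n - v)" using dense[OF i] by linarith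
  have "v * (2 * n / 3) \<le> (\<Sum>x\<in>V i. real (card (nbrs G x)))"
    using sum_bounded_below[of "V i" "2 * n / 3" "\<lambda>x. real (card (nbrs G x))"] deg V_sub[OF i]
    by (fastforce simp: v_def)
  also have "\<dots> = real (pairs G (V i) (verts G))" by (simp add: pairs_def nb)
  finally have "v * (2 * n / 3) \<le> \<gamma>\<^sup>2 * n\<^sup>2 + v * (n - v)" using up by linarith
  then have le: "v * (v - n / 3) \<le> \<gamma>\<^sup>2 * n\<^sup>2" by (simp add: algebra_simps)
  have "\<gamma> * n > 0" using n0 \<gamma> by simp
  then have "v > n / 3" "v - n / 3 > \<gamma> * n" using neg unfolding v_def by linarith+
  then have "n / 3 * (\<gamma> * n) < v * (v - n / 3)" using n0 \<gamma> by (intro mult_strict_mono) auto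
  moreover have "\<gamma>\<^sup>2 * n\<^sup>2 \<le> n / 3 * (\<gamma> * n)"
  proof -
    have "\<gamma> * (\<gamma> * n\<^sup>2) \<le> (1 / 3) * (\<gamma> * n\<^sup>2)" using \<gamma> by (intro mult_right_mono) auto
    then show ?thesis by (simp add: power2_eq_square mult_ac)
  qed
  ultimately show False using le by linarith
qed

lemma card_V_lower:
  assumes "i < 3" shows "real (card (V i)) \<ge> n / 3 - 3 * \<gamma> * n"
proof -
  have "n \<le> real (card (V 0)) + real (card (V 1)) + real (card (V 2)) + \<gamma> * n"
    using parts_sum[of "verts G"] V_sub by (simp add: n_def Int_absorb1)
  moreover have "i = 0 \<or> i = 1 \<or> i = 2" using assms by auto
  ultimately show ?thesis
    using card_V_upper[of 0] card_V_upper[of 1] card_V_upper[of 2] by auto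
qed

section \<open>Degrees into the parts and thresholds\<close>

definition dg :: "nat \<Rightarrow> 'a \<Rightarrow> real" where
  "dg i v = real (card (nbrs G v \<inter> V i))"

lemma dg_sum: "v \<in> verts G \<Longrightarrow> 2 * n / 3 - \<gamma> * n \<le> dg 0 v + dg 1 v + dg 2 v"
  using deg[of v] parts_sum[OF nbrs_subset[OF sg], of v] by (simp add: dg_def)

lemma dg_upper: "i < 3 \<Longrightarrow> dg i v \<le> real (card (V i))"
  unfolding dg_def by (intro of_nat_mono card_mono fin) auto

lemma dg_upper': "i < 3 \<Longrightarrow> dg i v \<le> n / 3 + \<gamma> * n"
  using dg_upper[of i v] card_V_upper[of i] by linarith

lemma dg_compl: "i < 3 \<Longrightarrow> real (card (V i - nbrs G v)) = real (card (V i)) - dg i v"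
proof -
  assume i: "i < 3"
  have "card (V i) = card (nbrs G v \<inter> V i) + card (V i - nbrs G v)"
    using fin[OF i] by (subst card_Un_disjoint[symmetric]) (auto intro!: arg_cong[of _ _ card])
  then show ?thesis by (simp add: dg_def)
qed

definition W :: "real \<Rightarrow> 'a set" where
  "W \<epsilon> = {v \<in> verts G. \<forall>i<3. \<epsilon> * n \<le> dg i v}"

definition U :: "real \<Rightarrow> nat \<Rightarrow> 'a set" where
  "U \<epsilon> i = {v \<in> verts G. dg i v < \<epsilon> * n}"

text \<open>The typical vertices of a part. By the degree condition they are adjacent to nearly all
  of the two other parts, so the cores serve as reservoirs for greedy embeddings.\<close>

definition core :: "real \<Rightarrow> nat \<Rightarrow> 'a set" where
  "core \<epsilon> i = V i \<inter> U \<epsilon> i"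

text \<open>No part exceeds n / 3 by much, so a vertex with few neighbours in part \<open>i\<close>
  reaches its degree of 2 n / 3 only by nearly exhausting both other parts.\<close>

lemma U_dg:
  assumes "v \<in> U \<epsilon> i" "i < 3" "j < 3" "i \<noteq> j"
  shows "dg j v \<ge> n / 3 - \<epsilon> * n - 2 * \<gamma> * n"
proof -
  have "i = 0 \<or> i = 1 \<or> i = 2" "j = 0 \<or> j = 1 \<or> j = 2" using assms by auto
  then show ?thesis
    using dg_sum[of v] dg_upper'[of 0 v] dg_upper'[of 1 v] dg_upper'[of 2 v] assms
    by (auto simp: U_def)
qed

lemma U_miss:
  assumes "v \<in> U \<epsilon> i" "i < 3" "j < 3" "i \<noteq> j"
  shows "real (card (V j - nbrs G v)) \<le> \<epsilon> * n + 3 * \<gamma> * n"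
  using U_dg[OF assms] dg_compl[OF assms(3), of v] card_V_upper[OF assms(3)] by linarith

lemma U_disj:
  assumes "i < 3" "j < 3" "i \<noteq> j" "\<epsilon> \<le> 1 / 20"
  shows "U \<epsilon> i \<inter> U \<epsilon> j = {}"
proof -
  have "\<epsilon> * n \<le> 1 / 20 * n" "\<gamma> * n \<le> 1 / 1000 * n" using assms \<gamma> n0 by (auto intro: mult_right_mono)
  then have "\<epsilon> * n \<le> dg j v" if "v \<in> U \<epsilon> i" for v
    using U_dg[OF that assms(1-3)] n0 by linarith
  then show ?thesis by (fastforce simp: U_def)
qed

text \<open>Each vertex of \<open>V i\<close> outside the core contributes at least
  \<open>\<epsilon> * n\<close> to the at most \<open>\<gamma>\<^sup>2 * n\<^sup>2\<close> pairs
  inside \<open>V i\<close>.\<close>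

lemma card_core:
  assumes i: "i < 3" and "\<gamma> \<le> \<epsilon>"
  shows "real (card (V i - core \<epsilon> i)) \<le> \<gamma> * n"
proof -
  have "real (card (V i - core \<epsilon> i)) * (\<epsilon> * n) \<le> (\<Sum>v\<in>V i - core \<epsilon> i. dg i v)"
    using sum_bounded_below[of "V i - core \<epsilon> i" "\<epsilon> * n" "dg i"] V_sub[OF i]
    by (fastforce simp: core_def U_def)
  also have "\<dots> \<le> (\<Sum>v\<in>V i. dg i v)"
    using fin[OF i] by (intro sum_mono2) (auto simp: dg_def)
  also have "\<dots> = real (pairs G (V i) (V i))" by (simp add: dg_def pairs_def)
  also have "\<dots> \<le> \<gamma>\<^sup>2 * n\<^sup>2" by (rule dense[OF i])
  also have "\<dots> \<le> (\<gamma> * n) * (\<epsilon> * n)"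
    using mult_left_mono[OF assms(2), of "\<gamma> * n * n"] \<gamma> n0 by (simp add: power2_eq_square mult_ac)
  finally show ?thesis using assms n0 \<gamma> by (simp add: mult_le_cancel_right)
qed

lemma finite_core: "i < 3 \<Longrightarrow> finite (core \<epsilon> i)"
  using fin by (auto simp: core_def)

lemma core_inter:
  assumes "i < 3" "\<gamma> \<le> \<epsilon>"
  shows "real (card (S \<inter> V i)) - \<gamma> * n \<le> real (card (core \<epsilon> i \<inter> S))"
proof -
  have "card (S \<inter> V i) \<le> card ((core \<epsilon> i \<inter> S) \<union> (V i - core \<epsilon> i))"
    using fin[OF assms(1)] finite_core[OF assms(1)] by (intro card_mono) auto
  also have "\<dots> \<le> card (core \<epsilon> i \<inter> S) + card (V i - core \<epsilon> i)" by (rule card_Un_le)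
  finally have "real (card (S \<inter> V i)) \<le> real (card (core \<epsilon> i \<inter> S)) + real (card (V i - core \<epsilon> i))" by linarith
  then show ?thesis using card_core[OF assms] by linarith
qed

lemma core_parts_sum:
  assumes "S \<subseteq> verts G" "\<gamma> \<le> \<epsilon>"
  shows "real (card S) - 4 * \<gamma> * n \<le> real (card (core \<epsilon> 0 \<inter> S)) + real (card (core \<epsilon> 1 \<inter> S)) + real (card (core \<epsilon> 2 \<inter> S))"
  using parts_sum[OF assms(1)] core_inter[of 0 \<epsilon> S] core_inter[of 1 \<epsilon> S] core_inter[of 2 \<epsilon> S] assms(2)
  by simp

lemma common_nbrs:
  assumes "v \<in> verts G" "w \<in> verts G"
  shows "real (card (nbrs G v \<inter> nbrs G w)) \<ge> n / 3"
proof -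
  have "real (card (nbrs G v)) + real (card (nbrs G w)) \<le> n + real (card (nbrs G v \<inter> nbrs G w))"
    using card_two_subsets[OF finV nbrs_subset[OF sg] nbrs_subset[OF sg], of v w] unfolding n_def by linarith
  then show ?thesis using deg[OF assms(1)] deg[OF assms(2)] by linarith
qed

text \<open>Suppose each pair has more than \<open>\<tau>\<close> common neighbours in at most one
  part. Two vertices have at least n / 3 common neighbours, so each pair nearly fills one part, and
  this part turns out to be the same for all three pairs. In the two other parts the three
  neighbourhoods are almost disjoint, so the three degrees sum to at most about n + 2 n / 3, short
  of the required 2 n.\<close>

lemma two_common_parts:
  fixes \<epsilon> \<epsilon>' \<tau> :: real
  assumes w: "w1 \<in> W \<epsilon>" "w2 \<in> W \<epsilon>" "w3 \<in> W \<epsilon>"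
    and \<epsilon>': "\<gamma> \<le> \<epsilon>'" and \<epsilon>: "40 * \<gamma> \<le> \<epsilon>" "\<epsilon> \<le> 1 / 20" and \<tau>: "\<tau> \<le> \<epsilon> * n / 20"
  shows "\<exists>a\<in>{w1, w2, w3}. \<exists>b\<in>{w1, w2, w3}. (a, b) \<in> {(w1, w2), (w1, w3), (w2, w3)} \<and>
    (\<exists>i<3. \<exists>j<3. i \<noteq> j \<and> real (card (core \<epsilon>' i \<inter> nbrs G a \<inter> nbrs G b)) > \<tau> \<and>
      real (card (core \<epsilon>' j \<inter> nbrs G a \<inter> nbrs G b)) > \<tau>)"
proof (rule ccontr)
  assume neg: "\<not> ?thesis"
  define x where "x i a b = real (card (core \<epsilon>' i \<inter> nbrs G a \<inter> nbrs G b))" for i a b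
  define y where "y i a = real (card (core \<epsilon>' i \<inter> nbrs G a))" for i a
  let ?Pairs = "{(w1, w2), (w1, w3), (w2, w3)}"
  have one: "x i a b \<le> \<tau> \<or> x j a b \<le> \<tau>" if "(a, b) \<in> ?Pairs" "i < 3" "j < 3" "i \<noteq> j" for a b i j
  proof (rule ccontr)
    assume "\<not> ?thesis"
    then have "x i a b > \<tau>" "x j a b > \<tau>" by auto
    then show False using neg that unfolding x_def by blast
  qed
  have wv: "w1 \<in> verts G" "w2 \<in> verts G" "w3 \<in> verts G" using w by (auto simp: W_def)
  have e1: "\<gamma> * n \<le> \<epsilon> * n / 40" "\<epsilon> * n \<le> n / 20"
    using mult_right_mono[OF \<epsilon>(1), of n] mult_right_mono[OF \<epsilon>(2), of n] n0 by auto
  have \<epsilon>n: "\<epsilon> * n > 0" using \<epsilon> \<gamma> n0 by auto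
  have sumx: "n / 3 - 4 * \<gamma> * n \<le> x 0 a b + x 1 a b + x 2 a b" if "a \<in> verts G" "b \<in> verts G" for a b
    using core_parts_sum[of "nbrs G a \<inter> nbrs G b", OF _ \<epsilon>'] common_nbrs[OF that] nbrs_subset[OF sg]
    by (fastforce simp: x_def Int_assoc)
  have sumy: "2 * n / 3 - 4 * \<gamma> * n \<le> y 0 a + y 1 a + y 2 a" if "a \<in> verts G" for a
    using core_parts_sum[of "nbrs G a", OF _ \<epsilon>'] deg[OF that] nbrs_subset[OF sg] by (fastforce simp: y_def)
  have cu: "real (card (core \<epsilon>' i)) \<le> n / 3 + \<gamma> * n" if "i < 3" for i
  proof -
    have "card (core \<epsilon>' i) \<le> card (V i)" using fin[OF that] by (intro card_mono) (auto simp: core_def)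
    then show ?thesis using card_V_upper[OF that] by linarith
  qed
  have yu: "y i a \<le> n / 3 + \<gamma> * n" if "i < 3" for i a
  proof -
    have "card (core \<epsilon>' i \<inter> nbrs G a) \<le> card (core \<epsilon>' i)" using finite_core[OF that] by (intro card_mono) auto
    then show ?thesis using cu[OF that] unfolding y_def by linarith
  qed
  have yl: "y i a \<ge> \<epsilon> * n - \<gamma> * n" if "i < 3" "a \<in> W \<epsilon>" for i a
    using core_inter[OF that(1) \<epsilon>', of "nbrs G a"] that by (fastforce simp: W_def y_def dg_def)
  have xy: "x i a b \<le> y i a" if "i < 3" for i a b
    unfolding x_def y_def using finite_core[OF that] by (intro of_nat_mono card_mono) auto
  have ie: "y i a + y i b \<le> n / 3 + \<gamma> * n + x i a b" if "i < 3" for i a b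
  proof -
    have "card (core \<epsilon>' i \<inter> nbrs G a) + card (core \<epsilon>' i \<inter> nbrs G b) \<le>
      card (core \<epsilon>' i) + card ((core \<epsilon>' i \<inter> nbrs G a) \<inter> (core \<epsilon>' i \<inter> nbrs G b))"
      by (rule card_two_subsets) (use finite_core[OF that] in auto)
    also have "(core \<epsilon>' i \<inter> nbrs G a) \<inter> (core \<epsilon>' i \<inter> nbrs G b) = core \<epsilon>' i \<inter> nbrs G a \<inter> nbrs G b" by blast
    finally show ?thesis using cu[OF that] unfolding x_def y_def by linarith
  qed
  have ie3: "y i w1 + y i w2 + y i w3 \<le> n / 3 + \<gamma> * n + x i w1 w2 + x i w1 w3 + x i w2 w3" if "i < 3" for i
  proof -
    have I: "(core \<epsilon>' i \<inter> nbrs G a) \<inter> (core \<epsilon>' i \<inter> nbrs G b) = core \<epsilon>' i \<inter> nbrs G a \<inter> nbrs G b" for a b by blast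
    have "card (core \<epsilon>' i \<inter> nbrs G w1) + card (core \<epsilon>' i \<inter> nbrs G w2) + card (core \<epsilon>' i \<inter> nbrs G w3) \<le>
      card (core \<epsilon>' i) + card (core \<epsilon>' i \<inter> nbrs G w1 \<inter> nbrs G w2) +
        card (core \<epsilon>' i \<inter> nbrs G w1 \<inter> nbrs G w3) + card (core \<epsilon>' i \<inter> nbrs G w2 \<inter> nbrs G w3)"
      using card_three_subsets[of "core \<epsilon>' i" "core \<epsilon>' i \<inter> nbrs G w1" "core \<epsilon>' i \<inter> nbrs G w2" "core \<epsilon>' i \<inter> nbrs G w3"]
        finite_core[OF that] unfolding I by auto
    then show ?thesis using cu[OF that] unfolding x_def y_def by linarith
  qed
  have conc: "\<exists>c<3. n / 3 - 4 * \<gamma> * n - 2 * \<tau> \<le> x c a b \<and> (\<forall>j<3. j \<noteq> c \<longrightarrow> x j a b \<le> \<tau>)"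
    if ab: "(a, b) \<in> ?Pairs" for a b
  proof -
    have "a \<in> verts G" "b \<in> verts G" using ab wv by auto
    note s = sumx[OF this]
    have small: "3 * \<tau> < n / 3 - 4 * \<gamma> * n" using e1 \<tau> n0 \<epsilon>n by linarith
    have "\<exists>c<3. x c a b > \<tau>"
    proof (rule ccontr)
      assume no: "\<not> ?thesis"
      have "x c a b \<le> \<tau>" if "c < 3" for c using no that by (meson not_le)
      from this[of 0] this[of 1] this[of 2] show False using s small by simp
    qed
    then obtain c where c: "c < 3" "x c a b > \<tau>" by blast
    then have o: "x j a b \<le> \<tau>" if "j < 3" "j \<noteq> c" for j using one[OF ab c(1) that(1)] that by auto
    have "c = 0 \<or> c = 1 \<or> c = 2" using c by auto
    then have "n / 3 - 4 * \<gamma> * n - 2 * \<tau> \<le> x c a b" using s o[of 0] o[of 1] o[of 2] by auto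
    then show ?thesis using c(1) o by blast
  qed
  obtain c12 where c12: "c12 < 3" "n / 3 - 4 * \<gamma> * n - 2 * \<tau> \<le> x c12 w1 w2" "\<And>j. j < 3 \<Longrightarrow> j \<noteq> c12 \<Longrightarrow> x j w1 w2 \<le> \<tau>"
    using conc[of w1 w2] by auto
  obtain c13 where c13: "c13 < 3" "n / 3 - 4 * \<gamma> * n - 2 * \<tau> \<le> x c13 w1 w3" "\<And>j. j < 3 \<Longrightarrow> j \<noteq> c13 \<Longrightarrow> x j w1 w3 \<le> \<tau>"
    using conc[of w1 w3] by auto
  obtain c23 where c23: "c23 < 3" "n / 3 - 4 * \<gamma> * n - 2 * \<tau> \<le> x c23 w2 w3" "\<And>j. j < 3 \<Longrightarrow> j \<noteq> c23 \<Longrightarrow> x j w2 w3 \<le> \<tau>"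
    using conc[of w2 w3] by auto
  \<comment> \<open>In part \<open>c13\<close> nearly all vertices are adjacent to \<open>w1\<close>
    and about \<open>\<epsilon> * n\<close> to \<open>w2\<close>, so these two would have more than
    \<open>\<tau>\<close> common neighbours there as well.\<close>
  have eq13: "c13 = c12"
  proof (rule ccontr)
    assume "c13 \<noteq> c12"
    then have "x c13 w1 w2 \<le> \<tau>" using c12(3)[OF c13(1)] by simp
    moreover have "y c13 w1 \<ge> n / 3 - 4 * \<gamma> * n - 2 * \<tau>" using c13(2) xy[OF c13(1), of w1 w3] by linarith
    moreover have "y c13 w2 \<ge> \<epsilon> * n - \<gamma> * n" using yl[OF c13(1) w(2)] .
    ultimately show False using ie[OF c13(1), of w1 w2] e1 \<tau> \<epsilon>n by linarith
  qed
  have eq23: "c23 = c12"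
  proof (rule ccontr)
    assume "c23 \<noteq> c12"
    then have "x c23 w1 w2 \<le> \<tau>" using c12(3)[OF c23(1)] by simp
    moreover have "y c23 w2 \<ge> n / 3 - 4 * \<gamma> * n - 2 * \<tau>" using c23(2) xy[OF c23(1), of w2 w3] by linarith
    moreover have "y c23 w1 \<ge> \<epsilon> * n - \<gamma> * n" using yl[OF c23(1) w(1)] .
    ultimately show False using ie[OF c23(1), of w1 w2] e1 \<tau> \<epsilon>n by linarith
  qed
  have bound: "y j w1 + y j w2 + y j w3 \<le> n / 3 + \<gamma> * n + 3 * \<tau>" if "j < 3" "j \<noteq> c12" for j
    using ie3[OF that(1)] c12(3)[OF that] c13(3)[OF that(1)] c23(3)[OF that(1)] that eq13 eq23 by auto
  note sums = sumy[OF wv(1)] sumy[OF wv(2)] sumy[OF wv(3)] yu[OF c12(1), of w1] yu[OF c12(1), of w2] yu[OF c12(1), of w3] e1 \<tau> \<epsilon>n n0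
  consider "c12 = 0" | "c12 = 1" | "c12 = 2" using c12(1) by linarith
  then show False
  proof cases
    case 1
    have "y 1 w1 + y 1 w2 + y 1 w3 \<le> n / 3 + \<gamma> * n + 3 * \<tau>" "y 2 w1 + y 2 w2 + y 2 w3 \<le> n / 3 + \<gamma> * n + 3 * \<tau>"
      using 1 by (auto intro!: bound)
    with sums[unfolded 1] show False by linarith
  next
    case 2
    have "y 0 w1 + y 0 w2 + y 0 w3 \<le> n / 3 + \<gamma> * n + 3 * \<tau>" "y 2 w1 + y 2 w2 + y 2 w3 \<le> n / 3 + \<gamma> * n + 3 * \<tau>"
      using 2 by (auto intro!: bound)
    with sums[unfolded 2] show False by linarith
  next
    case 3
    have "y 0 w1 + y 0 w2 + y 0 w3 \<le> n / 3 + \<gamma> * n + 3 * \<tau>" "y 1 w1 + y 1 w2 + y 1 w3 \<le> n / 3 + \<gamma> * n + 3 * \<tau>"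
      using 3 by (auto intro!: bound)
    with sums[unfolded 3] show False by linarith
  qed
qed

text \<open>One vertex too many in \<open>W \<epsilon>\<close> would supply the apices for
  \<open>apices_not_free\<close>, with the pair from \<open>two_common_parts\<close> in the roles 0
  and 1. Any two apices have about n / 3 common neighbours, hence many in some part.\<close>

lemma card_W_le:
  fixes \<epsilon> \<epsilon>' :: real
  assumes \<epsilon>: "\<epsilon> \<le> 1 / 20" and \<epsilon>': "3 * \<gamma> \<le> \<epsilon>'" "\<epsilon>' * (300 * (k + l)) \<le> \<epsilon>" and big: "1 \<le> \<epsilon>' * n"
  shows "card (W \<epsilon>) \<le> (k + l - 1) div 2"
proof (rule ccontr)
  assume neg: "\<not> ?thesis"
  define s where "s = (k + l - 1) div 2"
  have s2: "s \<ge> 2" using k3 l2 by (simp add: s_def)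
  have finW: "finite (W \<epsilon>)" using finV by (simp add: W_def)
  have kl: "real (k + l) \<ge> 5" using k3 l2 by simp
  \<comment> \<open>A core vertex misses at most \<open>\<epsilon>' * n + 3 * \<gamma> * n\<close>
    vertices of another part, which is at most \<open>d\<close>. Then \<open>\<tau>\<close> is at
    most 15 (k + l) \<epsilon>' n, and the factor 300 = 15 * 20 in the hypothesis turns this into
    \<open>\<epsilon> * n / 20\<close>.\<close>
  define d where "d = 2 * \<epsilon>' * n"
  define \<tau> where "\<tau> = 3 * (k + l) * (2 * d + 1)"
  have \<gamma>': "\<gamma> \<le> \<epsilon>'" "\<epsilon>' > 0" using \<epsilon>' \<gamma> by linarith+
  have "\<tau> \<le> 3 * (k + l) * (5 * (\<epsilon>' * n))" unfolding \<tau>_def using big by (intro mult_left_mono) (auto simp: d_def)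
  also have "\<dots> = (\<epsilon>' * (300 * (k + l))) * n / 20" by simp
  also have "\<dots> \<le> \<epsilon> * n / 20" using \<epsilon>'(2) n0 by (intro divide_right_mono mult_right_mono) auto
  finally have \<tau>: "\<tau> \<le> \<epsilon> * n / 20" .
  have "\<epsilon>' * 1500 \<le> \<epsilon>' * (300 * (k + l))" using kl \<gamma>'(2) by (intro mult_left_mono) auto
  then have g: "40 * \<gamma> \<le> \<epsilon>" using \<epsilon>' \<gamma> by linarith
  have e1: "\<gamma> * n \<le> \<epsilon> * n / 40" "\<epsilon> * n \<le> n / 20"
    using mult_right_mono[OF g, of n] mult_right_mono[OF \<epsilon>, of n] n0 by auto
  have \<epsilon>n: "\<epsilon> * n > 0" using g \<gamma> n0 by auto
  obtain T where T: "T \<subseteq> W \<epsilon>" "card T = Suc s"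
    using neg obtain_subset_with_card_n[of "Suc s" "W \<epsilon>"] by (auto simp: s_def not_le Suc_le_eq)
  obtain w1 w2 w3 T3 where w: "T = insert w1 (insert w2 (insert w3 T3))" "w1 \<noteq> w2" "w1 \<noteq> w3" "w2 \<noteq> w3"
  proof -
    have "3 \<le> card T" using T s2 by simp
    then obtain T' where "T' \<subseteq> T" "card T' = 3" by (meson obtain_subset_with_card_n)
    then obtain a b c where "T' = {a, b, c}" "a \<noteq> b" "a \<noteq> c" "b \<noteq> c" by (auto simp: card_3_iff)
    then show ?thesis using that[of a b c T] \<open>T' \<subseteq> T\<close> by blast
  qed
  have wW: "w1 \<in> W \<epsilon>" "w2 \<in> W \<epsilon>" "w3 \<in> W \<epsilon>" using w T by auto
  obtain a b i1 i2 where ab: "(a, b) \<in> {(w1, w2), (w1, w3), (w2, w3)}" and i12: "i1 < 3" "i2 < 3" "i1 \<noteq> i2"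
    "real (card (core \<epsilon>' i1 \<inter> nbrs G a \<inter> nbrs G b)) > \<tau>" "real (card (core \<epsilon>' i2 \<inter> nbrs G a \<inter> nbrs G b)) > \<tau>"
    using two_common_parts[OF wW \<gamma>'(1) g \<epsilon> \<tau>] by blast
  have abT: "a \<in> T" "b \<in> T" "a \<noteq> b" using ab w by auto
  have finT: "finite T" using T finW finite_subset by blast
  have "card (T - {a, b}) = s - 1" using abT T finT by (simp add: card_Diff_subset)
  then obtain h where h: "bij_betw h {0..<s - 1} (T - {a, b})"
    using ex_bij_betw_nat_finite[of "T - {a, b}"] finT by auto
  define \<sigma> where "\<sigma> r = (if r = 0 then a else if r = 1 then b else h (r - 2))" for r :: nat
  have hin: "h (r - 2) \<in> T - {a, b}" if "2 \<le> r" "r \<le> s" for r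
    using bij_betwE[OF h] that s2 by auto
  have hinj: "r = r'" if "2 \<le> r" "r \<le> s" "2 \<le> r'" "r' \<le> s" "h (r - 2) = h (r' - 2)" for r r'
  proof -
    have "r - 2 = r' - 2" using bij_betw_imp_inj_on[OF h] that by (auto dest!: inj_onD)
    then show ?thesis using that by simp
  qed
  have \<sigma>W: "\<sigma> r \<in> W \<epsilon>" if "r \<le> s" for r
    using hin[of r] that abT T(1) by (auto simp: \<sigma>_def)
  have \<sigma>inj: "inj_on \<sigma> {..s}"
  proof (rule inj_onI)
    fix r r' assume "r \<in> {..s}" "r' \<in> {..s}" and eq: "\<sigma> r = \<sigma> r'"
    then have rs: "r \<le> s" "r' \<le> s" by auto
    consider "2 \<le> r" "2 \<le> r'" | "2 \<le> r" "r' \<le> 1" | "r \<le> 1" "2 \<le> r'" | "r \<le> 1" "r' \<le> 1" by linarith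
    then show "r = r'"
    proof cases
      case 1
      then show ?thesis using hinj[of r r'] rs eq by (auto simp: \<sigma>_def)
    next
      case 2
      then show ?thesis using hin[of r] rs eq by (auto simp: \<sigma>_def split: if_splits)
    next
      case 3
      then show ?thesis using hin[of r'] rs eq by (auto simp: \<sigma>_def split: if_splits)
    next
      case 4
      then show ?thesis using eq abT(3) by (auto simp: \<sigma>_def le_Suc_eq)
    qed
  qed
  have "\<not> graph_free F G"
  proof (rule apices_not_free[OF sg finite_core _ \<sigma>inj[unfolded s_def] _ _ _ i12(1-3)])
    show "0 \<le> d" using \<gamma>' n0 by (simp add: d_def)
    show "real (card (core \<epsilon>' j - nbrs G u)) \<le> d" if "i < 3" "j < 3" "i \<noteq> j" "u \<in> core \<epsilon>' i" for i j u
    proof -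
      have "card (core \<epsilon>' j - nbrs G u) \<le> card (V j - nbrs G u)"
        using fin[OF that(2)] by (intro card_mono) (auto simp: core_def)
      moreover have "real (card (V j - nbrs G u)) \<le> \<epsilon>' * n + 3 * \<gamma> * n"
        by (rule U_miss) (use that in \<open>auto simp: core_def\<close>)
      moreover have "3 * \<gamma> * n \<le> \<epsilon>' * n" using \<epsilon>'(1) n0 by (intro mult_right_mono) auto
      ultimately show ?thesis unfolding d_def by linarith
    qed
    show "3 * (k + l) * (2 * d + 1) < real (card (core \<epsilon>' i \<inter> nbrs G (\<sigma> r)))"
      if "r \<le> (k + l - 1) div 2" "i < 3" for r i
    proof -
      have "\<epsilon> * n \<le> dg i (\<sigma> r)" using \<sigma>W[of r] that by (auto simp: W_def s_def)
      then show ?thesis using core_inter[OF that(2) \<gamma>'(1), of "nbrs G (\<sigma> r)"] \<tau> e1 \<epsilon>n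
        unfolding dg_def \<tau>_def by linarith
    qed
    show "\<exists>i<3. 3 * (k + l) * (2 * d + 1) < real (card (core \<epsilon>' i \<inter> nbrs G (\<sigma> r) \<inter> nbrs G (\<sigma> r')))"
      if "r \<le> (k + l - 1) div 2" "r' \<le> (k + l - 1) div 2" for r r'
    proof (rule ccontr)
      assume "\<not> ?thesis"
      then have "real (card (core \<epsilon>' i \<inter> nbrs G (\<sigma> r) \<inter> nbrs G (\<sigma> r'))) \<le> \<tau>" if "i < 3" for i
        using that unfolding \<tau>_def by (meson not_le)
      from this[of 0] this[of 1] this[of 2]
      have "real (card (core \<epsilon>' 0 \<inter> (nbrs G (\<sigma> r) \<inter> nbrs G (\<sigma> r')))) + real (card (core \<epsilon>' 1 \<inter> (nbrs G (\<sigma> r) \<inter> nbrs G (\<sigma> r'))))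
        + real (card (core \<epsilon>' 2 \<inter> (nbrs G (\<sigma> r) \<inter> nbrs G (\<sigma> r')))) \<le> 3 * \<tau>" by (simp add: Int_assoc)
      moreover have "\<sigma> r \<in> verts G" "\<sigma> r' \<in> verts G" using \<sigma>W that by (auto simp: W_def s_def)
      moreover have "nbrs G (\<sigma> r) \<inter> nbrs G (\<sigma> r') \<subseteq> verts G" using nbrs_subset[OF sg] by blast
      ultimately have "n / 3 - 4 * \<gamma> * n \<le> 3 * \<tau>"
        using common_nbrs[of "\<sigma> r" "\<sigma> r'"] core_parts_sum[of "nbrs G (\<sigma> r) \<inter> nbrs G (\<sigma> r')", OF _ \<gamma>'(1)] by linarith
      then show False using \<tau> e1 \<epsilon>n n0 by linarith
    qed
    show "3 * (k + l) * (2 * d + 1) < real (card (core \<epsilon>' i \<inter> nbrs G (\<sigma> 0) \<inter> nbrs G (\<sigma> 1)))"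
      if "i \<in> {i1, i2}" for i
      using that i12(4,5) by (auto simp: \<sigma>_def \<tau>_def)
  qed auto
  with free show False by blast
qed

end

text \<open>The \<open>B i\<close> are large reservoirs inside the classes \<open>U i\<close>, and
  \<open>d\<close> bounds the irregularities of the classes. The last condition is the room that
  \<open>coloured_embedding\<close> requires around an apex for this same \<open>d\<close>; it is
  the reason for working with two separate thresholds.\<close>

definition (in odd_lollipop) apex_partition ::
  "'a graph \<Rightarrow> 'a set \<Rightarrow> (nat \<Rightarrow> 'a set) \<Rightarrow> (nat \<Rightarrow> 'a set) \<Rightarrow> real \<Rightarrow> bool" where
  "apex_partition G W U B d \<longleftrightarrow>
    verts G = W \<union> (\<Union>i<3. U i) \<and> (\<forall>i<3. W \<inter> U i = {}) \<and>
    (\<forall>i<3. \<forall>j<3. i \<noteq> j \<longrightarrow> U i \<inter> U j = {}) \<and>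
    (\<forall>i<3. B i \<subseteq> U i \<and> card (verts G) \<le> 4 * card (B i)) \<and>
    (\<forall>i<3. \<forall>j<3. i \<noteq> j \<longrightarrow> (\<forall>u\<in>U i. real (card (B j - nbrs G u)) \<le> d)) \<and>
    (\<forall>i<3. \<forall>u\<in>U i. real (card (nbrs G u \<inter> U i)) \<le> d) \<and>
    (\<forall>i<3. \<forall>w\<in>W. real (card (B i \<inter> nbrs G w)) > 3 * (k + l) * (2 * (d :: real) + 1))"

context rough_partition
begin

lemma W_mono: "\<epsilon>' \<le> \<epsilon> \<Longrightarrow> W \<epsilon> \<subseteq> W \<epsilon>'"
proof -
  assume "\<epsilon>' \<le> \<epsilon>"
  then have "\<epsilon>' * n \<le> \<epsilon> * n" using n0 by (intro mult_right_mono) auto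
  then show ?thesis by (fastforce simp: W_def)
qed

text \<open>If both thresholds define the same apices, no vertex is in between: a vertex outside
  \<open>W \<epsilon>\<close> has fewer than \<open>\<epsilon>' * n\<close> neighbours in some part,
  while an apex has at least \<open>\<epsilon> * n\<close> in every part, far more than the room
  needed for \<open>d = 2 * \<epsilon>' * n\<close>.\<close>

lemma apex_partition_gap:
  fixes \<epsilon> \<epsilon>' :: real
  assumes eq: "W \<epsilon> = W \<epsilon>'"
    and \<epsilon>: "\<epsilon> \<le> 1 / 20" and \<epsilon>': "3 * \<gamma> \<le> \<epsilon>'" "\<epsilon>' * (300 * (k + l)) \<le> \<epsilon>" and big: "1 \<le> \<epsilon>' * n"
  shows "apex_partition G (W \<epsilon>) (U \<epsilon>') (core \<epsilon>') (2 * \<epsilon>' * n)"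
proof -
  have kl: "real (k + l) \<ge> 5" using k3 l2 by simp
  have \<gamma>': "\<gamma> \<le> \<epsilon>'" "\<epsilon>' > 0" using \<epsilon>' \<gamma> by linarith+
  have "\<epsilon>' * 1500 \<le> \<epsilon>' * (300 * (k + l))" using kl \<gamma>'(2) by (intro mult_left_mono) auto
  then have g: "1500 * \<epsilon>' \<le> \<epsilon>" "40 * \<gamma> \<le> \<epsilon>" "\<epsilon>' \<le> 1 / 20" using \<epsilon>' \<gamma> \<epsilon> by linarith+
  have e1: "\<gamma> * n \<le> \<epsilon> * n / 40" "3 * (\<gamma> * n) \<le> \<epsilon>' * n" "\<gamma> * n \<le> n / 1000"
    using mult_right_mono[OF g(2), of n] mult_right_mono[OF \<epsilon>'(1), of n] mult_right_mono[OF \<gamma>(2), of n] n0 by auto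
  have \<epsilon>n: "\<epsilon> * n > 0" using g \<gamma> n0 by auto
  have "3 * (k + l) * (2 * (2 * \<epsilon>' * n) + 1) \<le> 3 * (k + l) * (5 * (\<epsilon>' * n))"
    using big by (intro mult_left_mono) auto
  also have "\<dots> = (\<epsilon>' * (300 * (k + l))) * n / 20" by simp
  also have "\<dots> \<le> \<epsilon> * n / 20" using \<epsilon>'(2) n0 by (intro divide_right_mono mult_right_mono) auto
  finally have \<tau>: "3 * (k + l) * (2 * (2 * \<epsilon>' * n) + 1) \<le> \<epsilon> * n / 20" .
  have core_U: "core \<epsilon>' i \<subseteq> U \<epsilon>' i" for i by (auto simp: core_def)
  show ?thesis
    unfolding apex_partition_def
  proof (intro conjI allI impI ballI)
    show "verts G = W \<epsilon> \<union> (\<Union>i<3. U \<epsilon>' i)"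
      unfolding eq by (auto simp: W_def U_def not_le)
    show "W \<epsilon> \<inter> U \<epsilon>' i = {}" if "i < 3" for i
      unfolding eq using that by (auto simp: W_def U_def not_le)
    show "U \<epsilon>' i \<inter> U \<epsilon>' j = {}" if "i < 3" "j < 3" "i \<noteq> j" for i j
      using U_disj that g by blast
    show "core \<epsilon>' i \<subseteq> U \<epsilon>' i" for i by (rule core_U)
    show "card (verts G) \<le> 4 * card (core \<epsilon>' i)" if "i < 3" for i
    proof -
      have "real (card (V i)) - \<gamma> * n \<le> real (card (core \<epsilon>' i))"
        using core_inter[OF that \<gamma>'(1), of "verts G"] V_sub[OF that] by (simp add: Int_absorb1 core_def Int_absorb2 le_infI1)
      then have "n \<le> 4 * real (card (core \<epsilon>' i))" using card_V_lower[OF that] e1(3) n0 by linarith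
      then show ?thesis unfolding n_def by linarith
    qed
    show "real (card (core \<epsilon>' j - nbrs G u)) \<le> 2 * \<epsilon>' * n" if "i < 3" "j < 3" "i \<noteq> j" "u \<in> U \<epsilon>' i" for i j u
    proof -
      have "card (core \<epsilon>' j - nbrs G u) \<le> card (V j - nbrs G u)"
        using fin[OF that(2)] by (intro card_mono) (auto simp: core_def)
      then show ?thesis using U_miss[OF that(4,1,2,3)] e1(2) by linarith
    qed
    show "real (card (nbrs G u \<inter> U \<epsilon>' i)) \<le> 2 * \<epsilon>' * n" if i: "i < 3" and u: "u \<in> U \<epsilon>' i" for i u
    proof -
      obtain a b where ab: "a < 3" "b < 3" "a \<noteq> b" "a \<noteq> i" "b \<noteq> i" "{..<3} = {i, a, b}"
      proof -
        have l3: "{..<3::nat} = {0, 1, 2}" by auto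
        consider "i = 0" | "i = 1" | "i = 2" using i by linarith
        then show ?thesis
        proof cases
          case 1 then show ?thesis using that[of 1 2] l3 by auto
        next
          case 2 then show ?thesis using that[of 0 2] l3 by auto
        next
          case 3 then show ?thesis using that[of 0 1] l3 by auto
        qed
      qed
      let ?R = "verts G - (\<Union>i<3. V i)"
      \<comment> \<open>A vertex of \<open>U \<epsilon>' i\<close> that lies in another part
        \<open>V a\<close> is outside the core of \<open>V a\<close>, because the classes are
        disjoint; such vertices are few.\<close>
      have "nbrs G u \<inter> U \<epsilon>' i \<subseteq> (nbrs G u \<inter> V i) \<union> ?R \<union> (V a - core \<epsilon>' a) \<union> (V b - core \<epsilon>' b)"
        using U_disj[of i a \<epsilon>'] U_disj[of i b \<epsilon>'] ab(1-5) i g(3) nbrs_subset[OF sg, of u] unfolding ab(6) core_def by fastforce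
      then have "card (nbrs G u \<inter> U \<epsilon>' i) \<le> card ((nbrs G u \<inter> V i) \<union> ?R \<union> (V a - core \<epsilon>' a) \<union> (V b - core \<epsilon>' b))"
        using fin i ab finV by (intro card_mono) auto
      also have "\<dots> \<le> card ((nbrs G u \<inter> V i) \<union> ?R \<union> (V a - core \<epsilon>' a)) + card (V b - core \<epsilon>' b)" by (rule card_Un_le)
      also have "card ((nbrs G u \<inter> V i) \<union> ?R \<union> (V a - core \<epsilon>' a)) \<le> card ((nbrs G u \<inter> V i) \<union> ?R) + card (V a - core \<epsilon>' a)" by (rule card_Un_le)
      also have "card ((nbrs G u \<inter> V i) \<union> ?R) \<le> card (nbrs G u \<inter> V i) + card ?R" by (rule card_Un_le)
      finally have "real (card (nbrs G u \<inter> U \<epsilon>' i)) \<le> dg i u + card ?R + card (V a - core \<epsilon>' a) + card (V b - core \<epsilon>' b)"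
        unfolding dg_def by linarith
      moreover have "dg i u < \<epsilon>' * n" using u by (simp add: U_def)
      ultimately show ?thesis
        using rest card_core[OF ab(1) \<gamma>'(1)] card_core[OF ab(2) \<gamma>'(1)] e1(2) by linarith
    qed
    show "3 * (k + l) * (2 * (2 * \<epsilon>' * n) + 1) < real (card (core \<epsilon>' i \<inter> nbrs G w))"
      if "i < 3" "w \<in> W \<epsilon>" for i w
    proof -
      have "\<epsilon> * n \<le> dg i w" using that by (auto simp: W_def)
      then show ?thesis using core_inter[OF that(1) \<gamma>'(1), of "nbrs G w"] \<tau> e1 \<epsilon>n
        unfolding dg_def by linarith
    qed
  qed
qed

end

lemma bounded_mono_gap:
  fixes c :: "nat \<Rightarrow> nat"
  assumes "\<And>i. i \<le> s \<Longrightarrow> c i \<le> c (Suc i)" "\<And>i. i \<le> Suc s \<Longrightarrow> c i \<le> s"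
  shows "\<exists>i\<le>s. c i = c (Suc i)"
proof (rule ccontr)
  assume no: "\<not> ?thesis"
  have "i \<le> Suc s \<Longrightarrow> i \<le> c i" for i
  proof (induction i)
    case (Suc i)
    then have "i \<le> s" by simp
    then have "c i < c (Suc i)" using assms(1)[of i] no by (metis le_neq_implies_less)
    then show ?case using Suc by simp
  qed simp
  from this[of "Suc s"] assms(2)[of "Suc s"] show False by simp
qed

text \<open>The set of apex vertices grows as the threshold decreases, but it never has more than
  \<open>(k + l - 1) div 2\<close> elements. So along a geometric sequence of thresholds it is once the same
  for two consecutive ones.\<close>
lemma (in odd_lollipop) apex_partition_exists:
  fixes \<delta> :: real
  assumes "\<delta> > 0"
  shows "\<exists>N. \<forall>G :: 'a graph. simple_graph G \<longrightarrow> graph_free F G \<longrightarrow> card (verts G) \<ge> N \<longrightarrow>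
    (\<forall>v\<in>verts G. 2 * card (verts G) \<le> 3 * card (nbrs G v)) \<longrightarrow>
    (\<exists>W U B d. apex_partition G W U B d \<and> card W \<le> (k + l - 1) div 2 \<and> 0 \<le> d \<and> d \<le> \<delta> * card (verts G))"
proof -
  define s where "s = (k + l - 1) div 2"
  \<comment> \<open>The ratio that \<open>card_W_le\<close> and \<open>apex_partition_gap\<close>
    require between consecutive thresholds.\<close>
  define \<rho> :: real where "\<rho> = 1 / (300 * (k + l))"
  have kl: "real (k + l) \<ge> 5" using k3 l2 by simp
  have \<rho>: "0 < \<rho>" "\<rho> \<le> 1" using kl by (auto simp: \<rho>_def)
  define \<epsilon>0 where "\<epsilon>0 = min (1 / 20) (\<delta> / 2)"
  have \<epsilon>0: "0 < \<epsilon>0" "\<epsilon>0 \<le> 1 / 20" "2 * \<epsilon>0 \<le> \<delta>" using assms by (auto simp: \<epsilon>0_def)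
  define \<epsilon> where "\<epsilon> i = \<epsilon>0 * \<rho> ^ i" for i
  have \<epsilon>pos: "\<epsilon> i > 0" for i using \<epsilon>0 \<rho> by (simp add: \<epsilon>_def)
  have \<epsilon>anti: "\<epsilon> j \<le> \<epsilon> i" if "i \<le> j" for i j
    unfolding \<epsilon>_def using \<epsilon>0 \<rho> that by (intro mult_left_mono power_decreasing) auto
  have \<epsilon>le: "\<epsilon> i \<le> \<epsilon>0" for i using \<epsilon>anti[of 0 i] by (simp add: \<epsilon>_def)
  have \<epsilon>step: "\<epsilon> (Suc i) * (300 * (k + l)) \<le> \<epsilon> i" for i
  proof -
    have "\<rho> * (300 * (k + l)) = 1" using kl by (simp add: \<rho>_def)
    then have "\<epsilon> (Suc i) * (300 * (k + l)) = \<epsilon> i" by (simp add: \<epsilon>_def mult_ac)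
    then show ?thesis by simp
  qed
  \<comment> \<open>The bound on \<open>W (\<epsilon> i)\<close> uses
    \<open>\<epsilon> (Suc i)\<close> and is needed up to \<open>i = s + 1\<close>. So
    \<open>s + 2\<close> is the index of the last threshold, and \<open>\<gamma>\<close> has to be
    at most a third of it.\<close>
  define \<gamma> where "\<gamma> = min (1 / 1000) (\<epsilon> (s + 2) / 3)"
  have gam: "0 < \<gamma>" "\<gamma> \<le> 1 / 1000" "3 * \<gamma> \<le> \<epsilon> (s + 2)" using \<epsilon>pos[of "s + 2"] by (auto simp: \<gamma>_def)
  define C where "C = 4 * (k + l) + 7"
  obtain N1 where N1: "\<And>G :: 'a graph. simple_graph G \<Longrightarrow> graph_free F G \<Longrightarrow> card (verts G) \<ge> N1 \<Longrightarrow>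
    (\<forall>v\<in>verts G. 2 * card (verts G) \<le> 3 * card (nbrs G v)) \<Longrightarrow>
    (\<exists>V :: nat \<Rightarrow> 'a set. (\<forall>i<3. V i \<subseteq> verts G) \<and> (\<forall>i<3. \<forall>j<3. i \<noteq> j \<longrightarrow> V i \<inter> V j = {}) \<and>
      real (card (verts G - (\<Union>i<3. V i))) \<le> \<gamma> * card (verts G) \<and>
      (\<forall>i<3. pairs G (V i) (V i) \<le> C * card (verts G)))"
    using near_partition[OF gam(1), where 'a = 'a] unfolding C_def by blast
  obtain N2 :: nat where N2: "N2 > C / \<gamma>\<^sup>2" using reals_Archimedean2 by blast
  obtain N3 :: nat where N3: "N3 > 1 / \<epsilon> (s + 2)" using reals_Archimedean2 by blast
  show ?thesis
  proof (rule exI[of _ "Max {N1, N2, N3, 1}"], intro allI impI)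
    fix G :: "'a graph"
    assume sg: "simple_graph G" and free: "graph_free F G" and n: "Max {N1, N2, N3, 1} \<le> card (verts G)"
      and deg: "\<forall>v\<in>verts G. 2 * card (verts G) \<le> 3 * card (nbrs G v)"
    define n' where "n' = real (card (verts G))"
    have n's: "N1 \<le> card (verts G)" "real N2 \<le> n'" "real N3 \<le> n'" "n' > 0" using n by (auto simp: n'_def)
    obtain V :: "nat \<Rightarrow> 'a set" where V: "\<And>i. i < 3 \<Longrightarrow> V i \<subseteq> verts G" "\<And>i j. i < 3 \<Longrightarrow> j < 3 \<Longrightarrow> i \<noteq> j \<Longrightarrow> V i \<inter> V j = {}"
      "real (card (verts G - (\<Union>i<3. V i))) \<le> \<gamma> * card (verts G)"
      "\<And>i. i < 3 \<Longrightarrow> pairs G (V i) (V i) \<le> C * card (verts G)"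
      using N1[OF sg free n's(1) deg] by blast
    have "C / \<gamma>\<^sup>2 \<le> n'" using N2 n's by linarith
    then have C: "C \<le> \<gamma>\<^sup>2 * n'" using gam by (simp add: field_simps)
    interpret rough_partition k l G V \<gamma> n'
    proof unfold_locales
      show "real (pairs G (V i) (V i)) \<le> \<gamma>\<^sup>2 * n'\<^sup>2" if "i < 3" for i
      proof -
        have "real (pairs G (V i) (V i)) \<le> real C * n'" using V(4)[OF that] unfolding n'_def by (metis of_nat_le_iff of_nat_mult)
        also have "\<dots> \<le> (\<gamma>\<^sup>2 * n') * n'" using C n's by (intro mult_right_mono) auto
        finally show ?thesis by (simp add: power2_eq_square)
      qed
      show "2 * n' \<le> 3 * real (card (nbrs G v))" if "v \<in> verts G" for v
      proof -
        have "2 * card (verts G) \<le> 3 * card (nbrs G v)" using deg that by blast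
        then show ?thesis unfolding n'_def by linarith
      qed
    qed (use sg free V n's gam n'_def in auto)
    have big: "1 \<le> \<epsilon> i * n'" if "i \<le> s + 2" for i
    proof -
      have "1 / \<epsilon> (s + 2) \<le> n'" using N3 n's by linarith
      then have "1 \<le> \<epsilon> (s + 2) * n'" using \<epsilon>pos[of "s + 2"] by (simp add: field_simps)
      also have "\<dots> \<le> \<epsilon> i * n'" using \<epsilon>anti[OF that] n's by (intro mult_right_mono) auto
      finally show ?thesis .
    qed
    have e20: "\<epsilon> i \<le> 1 / 20" for i using \<epsilon>le[of i] \<epsilon>0 by linarith
    have g3: "3 * \<gamma> \<le> \<epsilon> i" if "i \<le> s + 2" for i using \<epsilon>anti[OF that] gam by linarith
    have cW: "card (W (\<epsilon> i)) \<le> s" if "i \<le> Suc s" for i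
      unfolding s_def by (rule card_W_le[OF e20 g3 \<epsilon>step big]) (use that in auto)
    have finW: "finite (W e)" for e using finV by (simp add: W_def)
    have sub: "W (\<epsilon> i) \<subseteq> W (\<epsilon> (Suc i))" for i by (rule W_mono) (rule \<epsilon>anti, simp)
    have "\<exists>i\<le>s. card (W (\<epsilon> i)) = card (W (\<epsilon> (Suc i)))"
      by (rule bounded_mono_gap) (use cW card_mono[OF finW sub] in auto)
    then obtain i where i: "i \<le> s" "card (W (\<epsilon> i)) = card (W (\<epsilon> (Suc i)))" by blast
    have eq: "W (\<epsilon> i) = W (\<epsilon> (Suc i))" using card_subset_eq[OF finW sub i(2)] .
    have "apex_partition G (W (\<epsilon> i)) (U (\<epsilon> (Suc i))) (core (\<epsilon> (Suc i))) (2 * \<epsilon> (Suc i) * n')"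
      by (rule apex_partition_gap[OF eq e20 g3 \<epsilon>step big]) (use i in auto)
    moreover have "2 * \<epsilon> (Suc i) * n' \<le> \<delta> * card (verts G)"
      unfolding n'_def[symmetric] using \<epsilon>le[of "Suc i"] \<epsilon>0(3) n's by (intro mult_right_mono) auto
    moreover have "0 \<le> 2 * \<epsilon> (Suc i) * n'" using \<epsilon>pos[of "Suc i"] n's by simp
    ultimately show "\<exists>W U B d. apex_partition G W U B d \<and> card W \<le> (k + l - 1) div 2 \<and> 0 \<le> d \<and> d \<le> \<delta> * card (verts G)"
      using cW[of i] i(1) unfolding s_def by (metis le_SucI)
  qed
qed

section \<open>Edge counts\<close>

text \<open>The three quotients are the balanced part sizes, so this is the number of edges of
  T_3(N).\<close>

definition turan_number3 :: "nat \<Rightarrow> nat" where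
  "turan_number3 N = (let x = N div 3; y = (N + 1) div 3; z = (N + 2) div 3 in x * y + y * z + z * x)"

lemma mod3_cases:
  obtains (0) q where "N = 3 * q" | (1) q where "N = 3 * q + 1" | (2) q where "N = 3 * q + (2 :: nat)"
proof -
  have e: "3 * (N div 3) + N mod 3 = N" by simp
  consider "N mod 3 = 0" | "N mod 3 = 1" | "N mod 3 = 2" by linarith
  then show ?thesis
  proof cases
    case 1
    show ?thesis by (rule that(1)[of "N div 3"]) (use e 1 in linarith)
  next
    case 2
    show ?thesis by (rule that(2)[of "N div 3"]) (use e 2 in linarith)
  next
    case 3
    show ?thesis by (rule that(3)[of "N div 3"]) (use e 3 in linarith)
  qed
qed

lemma turan_number3_simps:
  "turan_number3 (3 * q) = 3 * q * q"
  "turan_number3 (3 * q + 1) = 3 * q * q + 2 * q"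
  "turan_number3 (3 * q + 2) = 3 * q * q + 4 * q + 1"
proof -
  have d: "(3 * q) div 3 = q" "(3 * q + 1) div 3 = q" "(3 * q + 2) div 3 = q" "(3 * q + 1 + 1) div 3 = q"
    "(3 * q + 1 + 2) div 3 = q + 1" "(3 * q + 2 + 1) div 3 = q + 1" "(3 * q + 2 + 2) div 3 = q + 1"
    by presburger+
  show "turan_number3 (3 * q) = 3 * q * q" unfolding turan_number3_def Let_def d by (simp add: algebra_simps)
  show "turan_number3 (3 * q + 1) = 3 * q * q + 2 * q" unfolding turan_number3_def Let_def d by (simp add: algebra_simps)
  show "turan_number3 (3 * q + 2) = 3 * q * q + 4 * q + 1" unfolding turan_number3_def Let_def d by (simp add: algebra_simps)
qed

text \<open>A new vertex put into a smallest part, of size \<open>N div 3\<close>, is adjacent to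
  all old vertices outside that part. The additive form avoids subtraction on naturals.\<close>

lemma turan_number3_Suc: "turan_number3 (Suc N) + N div 3 = turan_number3 N + N"
proof (cases N rule: mod3_cases)
  case (0 q)
  then have "Suc N = 3 * q + 1" "N div 3 = q" by simp_all
  then show ?thesis using 0 by (simp only: turan_number3_simps)
next
  case (1 q)
  then have "Suc N = 3 * q + 2" "N div 3 = q" by simp_all
  then show ?thesis using 1 by (simp only: turan_number3_simps)
next
  case (2 q)
  then have "Suc N = 3 * (q + 1)" "N div 3 = q" by simp_all
  then show ?thesis using 2 by (simp only: turan_number3_simps) (simp add: algebra_simps)
qed

lemma turan_number3_int:
  fixes q :: int
  assumes "N = nat (3 * q + r)" "q \<ge> 0" "0 \<le> r" "r \<le> 2"
  shows "int (turan_number3 N) = 3 * q * q + 2 * q * r + (if r = 2 then 1 else 0)"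
proof -
  obtain q' where q': "q = int q'" using assms(2) nonneg_int_cases by blast
  have "r = 0 \<or> r = 1 \<or> r = 2" using assms by linarith
  then show ?thesis
  proof (elim disjE)
    assume r: "r = 0"
    then have "N = 3 * q'" using assms q' by simp
    then have "turan_number3 N = turan_number3 (3 * q')" by simp
    then show ?thesis unfolding turan_number3_simps using r q' by simp
  next
    assume r: "r = 1"
    then have "N = 3 * q' + 1" using assms q' by simp
    then have "turan_number3 N = turan_number3 (3 * q' + 1)" by simp
    then show ?thesis unfolding turan_number3_simps using r q' by simp
  next
    assume r: "r = 2"
    then have "N = 3 * q' + 2" using assms q' by simp
    then have "turan_number3 N = turan_number3 (3 * q' + 2)" by simp
    then show ?thesis unfolding turan_number3_simps using r q' by simp
  qed
qed

text \<open>Measured from q = (a + b + c) div 3, the sizes are integers x, y, z with sum r, and 2 (x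
  y + y z + z x) = r r - (x x + y y + z z). As u \<le> u u for every integer, with equality only for
  0 and 1, the balanced sizes are exactly the optimal ones.\<close>

lemma turan3:
  fixes a b c :: nat
  shows "a * b + b * c + c * a \<le> turan_number3 (a + b + c)"
    and "a * b + b * c + c * a = turan_number3 (a + b + c) \<Longrightarrow>
      {a, b, c} \<subseteq> {(a + b + c) div 3, (a + b + c) div 3 + 1}"
proof -
  define q where "q = int ((a + b + c) div 3)"
  define r where "r = int ((a + b + c) mod 3)"
  define x y z where "x = int a - q" and "y = int b - q" and "z = int c - q"
  have qr: "int (a + b + c) = 3 * q + r" "q \<ge> 0" "0 \<le> r" "r \<le> 2"
    unfolding q_def r_def by (simp_all add: zdiv_int zmod_int)
  have sum: "x + y + z = r" using qr(1) unfolding x_def y_def z_def by simp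
  have tn: "int (turan_number3 (a + b + c)) = 3 * q * q + 2 * q * r + (if r = 2 then 1 else 0)"
    by (rule turan_number3_int) (use qr in auto)
  have lhs: "int (a * b + b * c + c * a) = 3 * q * q + 2 * q * r + (x * y + y * z + z * x)"
  proof -
    have "int a = q + x" "int b = q + y" "int c = q + z" by (auto simp: x_def y_def z_def)
    then have "int (a * b + b * c + c * a) = (q + x) * (q + y) + (q + y) * (q + z) + (q + z) * (q + x)" by simp
    also have "\<dots> = 3 * q * q + 2 * q * (x + y + z) + (x * y + y * z + z * x)" by (simp add: algebra_simps)
    finally show ?thesis unfolding sum .
  qed
  have sq: "2 * (x * y + y * z + z * x) = r * r - (x * x + y * y + z * z)"
    unfolding sum[symmetric] by (simp add: algebra_simps)
  have ge: "u \<le> u * u" "u = u * u \<Longrightarrow> u = 0 \<or> u = 1" for u :: int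
  proof -
    show "u \<le> u * u" by (cases "u \<le> 0") (auto intro: order_trans[OF _ zero_le_square] simp: mult_le_cancel_left1)
    show "u = u * u \<Longrightarrow> u = 0 \<or> u = 1" by auto
  qed
  define t :: int where "t = (if r = 2 then 1 else 0)"
  have rr: "r * r - r = 2 * t" 
  proof -
    have "r = 0 \<or> r = 1 \<or> r = 2" using qr(3,4) by linarith
    then show ?thesis by (auto simp: t_def)
  qed
  have le: "x * y + y * z + z * x \<le> t"
  proof -
    have "x + y + z \<le> x * x + y * y + z * z" by (intro add_mono ge(1))
    then have "r * r - (x * x + y * y + z * z) \<le> 2 * t" unfolding sum rr[symmetric] by simp
    then show ?thesis unfolding sq[symmetric] by simp
  qed
  then have "int (a * b + b * c + c * a) \<le> int (turan_number3 (a + b + c))" unfolding tn lhs t_def[symmetric] by simp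
  then show "a * b + b * c + c * a \<le> turan_number3 (a + b + c)" by (simp only: of_nat_le_iff)
  assume "a * b + b * c + c * a = turan_number3 (a + b + c)"
  then have "int (a * b + b * c + c * a) = int (turan_number3 (a + b + c))" by (simp only:)
  then have eq: "x * y + y * z + z * x = t" unfolding tn lhs t_def[symmetric] by simp
  have "x = x * x" "y = y * y" "z = z * z"
  proof -
    have "x * x + y * y + z * z = x + y + z" using sq unfolding eq sum rr[symmetric] by simp
    then show "x = x * x" "y = y * y" "z = z * z" using ge(1)[of x] ge(1)[of y] ge(1)[of z] by (smt (verit))+
  qed
  then have "x \<in> {0, 1}" "y \<in> {0, 1}" "z \<in> {0, 1}" using ge(2) by auto
  then have "int a \<in> {q, q + 1}" "int b \<in> {q, q + 1}" "int c \<in> {q, q + 1}" by (auto simp: x_def y_def z_def)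
  then show "{a, b, c} \<subseteq> {(a + b + c) div 3, (a + b + c) div 3 + 1}"
    unfolding q_def by (auto simp del: of_nat_add of_nat_Suc simp add: of_nat_Suc[symmetric] of_nat_eq_iff)
qed

text \<open>Twice the number of edges of \<open>K\<^sub>w \<or> T\<^sub>3(n - w)\<close>; doubling matches \<^const>\<open>pairs\<close>, which counts every edge twice.\<close>
definition join_count :: "nat \<Rightarrow> nat \<Rightarrow> nat" where
  "join_count w n = w * (w - 1) + 2 * w * (n - w) + 2 * turan_number3 (n - w)"

text \<open>T_3(n - w) has a vertex that shares its part with \<open>(n - Suc w) div 3\<close>
  others; it gains exactly these as neighbours when it is made adjacent to everything.\<close>

lemma join_count_Suc:
  assumes "Suc w \<le> n"
  shows "join_count (Suc w) n = join_count w n + 2 * ((n - Suc w) div 3)"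
proof -
  obtain m where m: "n = Suc w + m" using assms le_Suc_ex by blast
  have "w * (w - 1) + 2 * w = Suc w * w" by (cases w) auto
  then show ?thesis
    using turan_number3_Suc[of m] by (simp add: join_count_def m Suc_diff_le algebra_simps)
qed

lemma join_count_mono:
  assumes "w \<le> s" "s \<le> n"
  shows "join_count w n + 2 * (s - w) * ((n - s) div 3) \<le> join_count s n"
  using assms
proof (induction s rule: dec_induct)
  case (step i)
  have "(n - Suc i) div 3 \<le> (n - i) div 3" by (intro div_le_mono) auto
  then have "(i - w) * ((n - Suc i) div 3) \<le> (i - w) * ((n - i) div 3)" by (rule mult_le_mono2)
  moreover have "(Suc i - w) * ((n - Suc i) div 3) = (i - w) * ((n - Suc i) div 3) + (n - Suc i) div 3"
    using step(1) by (simp add: Suc_diff_le)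
  moreover have "join_count w n + 2 * ((i - w) * ((n - i) div 3)) \<le> join_count i n"
    using step by (simp add: mult.assoc)
  ultimately have "join_count w n + 2 * ((Suc i - w) * ((n - Suc i) div 3)) \<le> join_count (Suc i) n"
    using join_count_Suc[of i n] step by linarith
  then show ?case by (simp only: mult.assoc)
qed simp

text \<open>A new vertex outside the clique is adjacent to all \<open>n\<close> old ones except a
  smallest part. Its degree is the benchmark for the degree of a deleted vertex.\<close>

lemma join_count_Suc_n:
  assumes "w \<le> n"
  shows "join_count w (Suc n) + 2 * ((n - w) div 3) = join_count w n + 2 * n"
proof -
  obtain m where m: "n = w + m" using assms le_Suc_ex by blast
  have "w * (w - 1) + 2 * w * Suc m + 2 * m = w * (w - 1) + 2 * w * m + 2 * (w + m)" by simp
  then show ?thesis using turan_number3_Suc[of m] by (simp add: join_count_def m Suc_diff_le)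
qed

text \<open>\<open>K\<^bsub>card W\<^esub> \<or> K\<^bsub>card (U 0), card (U 1), card (U 2)\<^esub>\<close> on the given vertex classes.\<close>
definition apex_tripartite :: "'a graph \<Rightarrow> 'a set \<Rightarrow> (nat \<Rightarrow> 'a set) \<Rightarrow> bool" where
  "apex_tripartite G W U \<longleftrightarrow> verts G = W \<union> U 0 \<union> U 1 \<union> U 2 \<and> (\<forall>i<3. W \<inter> U i = {}) \<and>
    (\<forall>i<3. \<forall>j<3. i \<noteq> j \<longrightarrow> U i \<inter> U j = {}) \<and>
    (\<forall>x\<in>W. nbrs G x = verts G - {x}) \<and> (\<forall>i<3. \<forall>x\<in>U i. nbrs G x = verts G - U i)"

lemma sum_partition:
  fixes f :: "'a \<Rightarrow> nat"
  assumes "finite (W \<union> U 0 \<union> U 1 \<union> U (2::nat))" "\<forall>i<3. W \<inter> U i = {}" "\<forall>i<3. \<forall>j<3. i \<noteq> j \<longrightarrow> U i \<inter> U j = {}"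
  shows "sum f (W \<union> U 0 \<union> U 1 \<union> U 2) = sum f W + sum f (U 0) + sum f (U 1) + sum f (U 2)"
proof -
  have d: "W \<inter> U 0 = {}" "W \<inter> U 1 = {}" "W \<inter> U 2 = {}" "U 0 \<inter> U 1 = {}" "U 0 \<inter> U 2 = {}" "U 1 \<inter> U 2 = {}"
    using assms(2,3) by auto
  have f: "finite W" "finite (U 0)" "finite (U 1)" "finite (U 2)" using assms(1) by auto
  have "sum f (W \<union> U 0 \<union> U 1 \<union> U 2) = sum f (W \<union> U 0 \<union> U 1) + sum f (U 2)"
    using d f by (intro sum.union_disjoint) auto
  also have "sum f (W \<union> U 0 \<union> U 1) = sum f (W \<union> U 0) + sum f (U 1)"
    using d f by (intro sum.union_disjoint) auto
  also have "sum f (W \<union> U 0) = sum f W + sum f (U 0)"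
    using d f by (intro sum.union_disjoint) auto
  finally show ?thesis .
qed

text \<open>Degrees are compared with those in a clique on \<open>W\<close> joined to the complete
  tripartite graph on the \<open>U i\<close>: \<open>miss\<close> counts the absent adjacencies, and
  the pairs inside the \<open>U i\<close> are the excess. The identity is exact, so the structure
  can later be read off from \<open>miss = 0\<close>.\<close>

lemma edge_balance:
  assumes sg: "simple_graph G" and V: "verts G = W \<union> U 0 \<union> U 1 \<union> U (2::nat)"
    and WU: "\<forall>i<3. W \<inter> U i = {}" and UU: "\<forall>i<3. \<forall>j<3. i \<noteq> j \<longrightarrow> U i \<inter> U j = {}"
  defines "miss \<equiv> (\<Sum>x\<in>W. card (verts G - {x} - nbrs G x)) + (\<Sum>i<3. \<Sum>x\<in>U i. card (verts G - U i - nbrs G x))"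
  shows "2 * card (edges G) + miss = card W * (card W - 1) + 2 * card W * (card (verts G) - card W) +
      2 * (card (U 0) * card (U 1) + card (U 1) * card (U 2) + card (U 2) * card (U 0)) +
      (\<Sum>i<3. pairs G (U i) (U i))"
    and "card (verts G) = card W + (card (U 0) + card (U 1) + card (U 2))"
proof -
  have finV: "finite (verts G)" using sg by (simp add: simple_graph_def)
  have three: "(\<Sum>i<3. f i) = f 0 + f 1 + f 2" for f :: "nat \<Rightarrow> nat" by (simp add: eval_nat_numeral)
  have sub: "U i \<subseteq> verts G" if "i < 3" for i
  proof -
    have "i = 0 \<or> i = 1 \<or> i = 2" using that by auto
    then show ?thesis using V by auto
  qed
  note part = sum_partition[OF finV[unfolded V] WU UU, folded V]
  have nb: "nbrs G x \<inter> verts G = nbrs G x" for x using nbrs_subset[OF sg] by blast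
  have n: "card (verts G) = card W + (card (U 0) + card (U 1) + card (U 2))"
    using part[of "\<lambda>_. 1"] by simp
  then show "card (verts G) = card W + (card (U 0) + card (U 1) + card (U 2))" .
  have cW: "card (nbrs G x) + card (verts G - {x} - nbrs G x) = card (verts G) - 1" if "x \<in> W" for x
  proof -
    have "verts G - {x} = nbrs G x \<union> (verts G - {x} - nbrs G x)"
      using nbrs_subset[OF sg, of x] nbrs_irrefl[OF sg, of x] by blast
    then have "card (verts G - {x}) = card (nbrs G x) + card (verts G - {x} - nbrs G x)"
      using finV finite_nbrs[OF sg, of x] card_Un_disjoint[of "nbrs G x" "verts G - {x} - nbrs G x"] by auto
    moreover have "x \<in> verts G" using that V by blast
    ultimately show ?thesis by simp
  qed
  have cU: "card (nbrs G x) + card (verts G - U i - nbrs G x) = (card (verts G) - card (U i)) + card (nbrs G x \<inter> U i)"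
    if "i < 3" for i x
  proof -
    have "card (verts G - U i) = card (nbrs G x \<inter> (verts G - U i)) + card (verts G - U i - nbrs G x)"
      using finV by (subst card_Un_disjoint[symmetric]) (auto intro!: arg_cong[of _ _ card])
    moreover have "card (nbrs G x) = card (nbrs G x \<inter> U i) + card (nbrs G x \<inter> (verts G - U i))"
      using finite_nbrs[OF sg, of x] nbrs_subset[OF sg, of x]
      by (subst card_Un_disjoint[symmetric]) (auto intro!: arg_cong[of _ _ card])
    moreover have "card (verts G - U i) = card (verts G) - card (U i)"
      using sub[OF that] finV finite_subset by (intro card_Diff_subset) auto
    ultimately show ?thesis by linarith
  qed
  have SW: "(\<Sum>x\<in>W. card (nbrs G x)) + (\<Sum>x\<in>W. card (verts G - {x} - nbrs G x)) = card W * (card (verts G) - 1)"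
    unfolding sum.distrib[symmetric] using cW by simp
  have SU: "(\<Sum>x\<in>U i. card (nbrs G x)) + (\<Sum>x\<in>U i. card (verts G - U i - nbrs G x)) =
      card (U i) * (card (verts G) - card (U i)) + pairs G (U i) (U i)" if "i < 3" for i
    unfolding pairs_def sum.distrib[symmetric] using cU[OF that] by (simp add: sum.distrib)
  have "2 * card (edges G) = (\<Sum>x\<in>verts G. card (nbrs G x))"
    using handshake[OF sg] by (simp add: pairs_def nb)
  also have "\<dots> = (\<Sum>x\<in>W. card (nbrs G x)) + (\<Sum>x\<in>U 0. card (nbrs G x)) + (\<Sum>x\<in>U 1. card (nbrs G x)) + (\<Sum>x\<in>U 2. card (nbrs G x))"
    by (rule part)
  finally have "2 * card (edges G) + miss = card W * (card (verts G) - 1) +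
     (card (U 0) * (card (verts G) - card (U 0)) + card (U 1) * (card (verts G) - card (U 1)) +
      card (U 2) * (card (verts G) - card (U 2))) + (\<Sum>i<3. pairs G (U i) (U i))"
    unfolding miss_def three using SW SU[of 0] SU[of 1] SU[of 2] by simp
  moreover have "card W * (card (verts G) - 1) = card W * (card W - 1) + card W * (card (U 0) + card (U 1) + card (U 2))"
    unfolding n by (cases "card W") (auto simp: algebra_simps)
  moreover define T where "T = card W * (card W - 1)"
  ultimately have "2 * card (edges G) + miss = T + card W * (card (U 0) + card (U 1) + card (U 2)) +
     (card (U 0) * (card (verts G) - card (U 0)) + card (U 1) * (card (verts G) - card (U 1)) +
      card (U 2) * (card (verts G) - card (U 2))) + (\<Sum>i<3. pairs G (U i) (U i))" by simp
  then have "2 * card (edges G) + miss = T + 2 * card W * (card (verts G) - card W) +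
      2 * (card (U 0) * card (U 1) + card (U 1) * card (U 2) + card (U 2) * card (U 0)) +
      (\<Sum>i<3. pairs G (U i) (U i))"
    unfolding n by (simp add: algebra_simps)
  then show "2 * card (edges G) + miss = card W * (card W - 1) + 2 * card W * (card (verts G) - card W) +
      2 * (card (U 0) * card (U 1) + card (U 1) * card (U 2) + card (U 2) * card (U 0)) +
      (\<Sum>i<3. pairs G (U i) (U i))"
    unfolding T_def .
qed

section \<open>Structure of dense graphs without the blow-up\<close>

context odd_lollipop
begin

text \<open>Let w be the number of apices and Q the number of pairs inside the classes. Each apex
  short of \<open>s\<close> costs about 2 n / 3 in the doubled count. If w = 0, then Q is at most
  about n, but at least two apices are lacking, at a cost of about 4 n / 3; if w > 0, then Q is only
  a small fraction of n. Hence w = \<open>s\<close> and \<open>miss\<close> \<le> Q, so every apex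
  is adjacent to almost everything. Now \<open>full_apices_edge_not_free\<close> forbids edges
  inside the classes, and Q = \<open>miss\<close> = 0.\<close>

lemma extremal_structure:
  defines "s \<equiv> (k + l - 1) div 2"
  shows "\<exists>N. \<forall>G :: 'a graph. simple_graph G \<longrightarrow> graph_free F G \<longrightarrow> card (verts G) \<ge> N \<longrightarrow>
    (\<forall>v\<in>verts G. 2 * card (verts G) \<le> 3 * card (nbrs G v)) \<longrightarrow>
    join_count s (card (verts G)) \<le> 2 * card (edges G) \<longrightarrow>
    2 * card (edges G) = join_count s (card (verts G)) \<and>
    (\<exists>W U. apex_tripartite G W U \<and> card W = s \<and>
      (\<forall>i<3. card (U i) \<in> {(card (verts G) - s) div 3, (card (verts G) - s) div 3 + 1}))"
proof -
  define c where "c = 4 * (k + l) + 6"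
  \<comment> \<open>Chosen so that c d \<le> n / 5000 and (k + l) \<open>d2\<close> \<le> 3 n / 1000
    below; the former uses k + l \<ge> 5.\<close>
  define \<delta> :: real where "\<delta> = 1 / (1000 * (k + l) * c)"
  have kl: "real (k + l) \<ge> 5" using k3 l2 by simp
  have c: "real c \<ge> 26" using k3 l2 by (simp add: c_def)
  have \<delta>0: "\<delta> > 0" using kl c by (simp add: \<delta>_def)
  have \<delta>: "\<delta> * ((k + l) * c) = 1 / 1000" using kl c by (simp add: \<delta>_def)
  have s2: "s \<ge> 2" using k3 l2 by (simp add: s_def)
  obtain N1 where N1: "\<And>G :: 'a graph. simple_graph G \<Longrightarrow> graph_free F G \<Longrightarrow> card (verts G) \<ge> N1 \<Longrightarrow>
    (\<forall>v\<in>verts G. 2 * card (verts G) \<le> 3 * card (nbrs G v)) \<Longrightarrow>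
    (\<exists>W U B d. apex_partition G W U B d \<and> card W \<le> s \<and> 0 \<le> d \<and> d \<le> \<delta> * card (verts G))"
    using apex_partition_exists[OF \<delta>0, where 'a = 'a] unfolding s_def by blast
  show ?thesis
  proof (rule exI[of _ "max N1 (100 * (k + l + s + 2))"], intro allI impI)
    fix G :: "'a graph"
    assume sg: "simple_graph G" and free: "graph_free F G" and N: "max N1 (100 * (k + l + s + 2)) \<le> card (verts G)"
      and deg: "\<forall>v\<in>verts G. 2 * card (verts G) \<le> 3 * card (nbrs G v)"
      and E: "join_count s (card (verts G)) \<le> 2 * card (edges G)"
    define n where "n = card (verts G)"
    have finV: "finite (verts G)" using sg by (simp add: simple_graph_def)
    have n: "N1 \<le> n" "100 * (k + l + s + 2) \<le> n" using N by (auto simp: n_def)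
    obtain W U B d where ap: "apex_partition G W U B d" and cW: "card W \<le> s" and d: "0 \<le> d" "d \<le> \<delta> * n"
      using N1[OF sg free _ deg] n unfolding n_def by blast
    have V: "verts G = W \<union> U 0 \<union> U 1 \<union> U 2"
    proof -
      have "{..<3::nat} = {0, 1, 2}" by auto
      moreover have "verts G = W \<union> (\<Union>i<3. U i)" using ap by (simp add: apex_partition_def)
      ultimately show ?thesis by auto
    qed
    have WU: "\<forall>i<3. W \<inter> U i = {}" and UU: "\<forall>i<3. \<forall>j<3. i \<noteq> j \<longrightarrow> U i \<inter> U j = {}"
      using ap by (simp_all add: apex_partition_def)
    have BU: "B i \<subseteq> U i" "n \<le> 4 * card (B i)" if "i < 3" for i
      using ap that unfolding apex_partition_def n_def by blast+
    have missB: "real (card (B j - nbrs G u)) \<le> d" if "i < 3" "j < 3" "i \<noteq> j" "u \<in> U i" for i j u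
      using ap that by (simp add: apex_partition_def)
    have inU: "real (card (nbrs G u \<inter> U i)) \<le> d" if "i < 3" "u \<in> U i" for i u
      using ap that by (simp add: apex_partition_def)
    have apexB: "real (card (B i \<inter> nbrs G w)) > 3 * (k + l) * (2 * d + 1)" if "i < 3" "w \<in> W" for i w
      using ap that by (simp add: apex_partition_def)
    have subU: "U i \<subseteq> verts G" if "i < 3" for i
    proof -
      have "i = 0 \<or> i = 1 \<or> i = 2" using that by auto
      then show ?thesis using V by auto
    qed
    have finU: "finite (U i)" "finite (B i)" if "i < 3" for i
      using subU[OF that] BU(1)[OF that] finV by (meson finite_subset order_trans)+
    have finW: "finite W" "W \<subseteq> verts G" using finV V by auto
    have cdn: "c * d \<le> n / 5000"
    proof -
      have "real c * d \<le> c * (\<delta> * n)" using d by (intro mult_left_mono) auto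
      also have "\<dots> * 5 \<le> c * (\<delta> * n) * (k + l)" using kl \<delta>0 by (intro mult_left_mono) auto
      also have "\<dots> = (\<delta> * ((k + l) * c)) * n" by (simp add: mult_ac)
      finally show ?thesis unfolding \<delta> by simp
    qed
    \<comment> \<open>The bound on \<open>Q\<close> in the presence of an apex. It will also bound
      the number of vertices missed by an apex, so the last embedding works with \<open>d2\<close>
      in place of \<open>d\<close>.\<close>
    define d2 where "d2 = 3 * (c * d)"
    have kd2: "(k + l) * d2 \<le> 3 * n / 1000"
    proof -
      have "(k + l) * (c * d) \<le> (k + l) * (c * (\<delta> * n))" using d by (intro mult_left_mono) auto
      also have "\<dots> = (\<delta> * ((k + l) * c)) * n" by (simp add: mult_ac)
      finally have "(k + l) * (c * d) \<le> n / 1000" unfolding \<delta> by simp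
      moreover have "(k + l) * d2 = 3 * ((k + l) * (c * d))" by (simp add: d2_def)
      ultimately show ?thesis by linarith
    qed
    have dd2: "d \<le> d2"
    proof -
      have "1 * d \<le> (3 * c) * d" using c d by (intro mult_right_mono) auto
      then show ?thesis by (simp add: d2_def)
    qed
    have dn: "d2 \<le> n / 1000" using cdn by (simp add: d2_def)
    have room: "3 * (k + l) * (2 * d2 + 1) < n / 4 - d2"
    proof -
      define K where "K = real (k + l)"
      define a where "a = K * d2"
      have "3 * (k + l) * (2 * d2 + 1) = 6 * a + 3 * K" by (simp add: algebra_simps a_def K_def)
      moreover have "100 * K \<le> n" using n(2) by (simp add: K_def)
      moreover have "1000 * a \<le> 3 * real n" using kd2 by (simp add: a_def K_def)
      moreover have "K \<ge> 5" using kl by (simp add: K_def)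
      ultimately show ?thesis using dn by linarith
    qed
    have roomd: "3 * (k + l) * (2 * d + 1) \<le> 3 * (k + l) * (2 * d2 + 1)"
      using dd2 by (intro mult_left_mono) auto
    define Q where "Q = (\<Sum>i<3. pairs G (U i) (U i))"
    have three: "(\<Sum>i<3. f i) = f 0 + f 1 + f 2" for f :: "nat \<Rightarrow> nat" by (simp add: eval_nat_numeral)
    obtain oth1 oth2 :: "nat \<Rightarrow> nat" where oth: "\<And>i. i < 3 \<Longrightarrow> oth1 i < 3 \<and> oth2 i < 3 \<and> oth1 i \<noteq> oth2 i \<and> oth1 i \<noteq> i \<and> oth2 i \<noteq> i"
    proof (rule that[of "\<lambda>i. (i + 1) mod 3" "\<lambda>i. (i + 2) mod 3"])
      fix i :: nat assume "i < 3"
      then have "i = 0 \<or> i = 1 \<or> i = 2" by auto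
      then show "(i + 1) mod 3 < 3 \<and> (i + 2) mod 3 < 3 \<and> (i + 1) mod 3 \<noteq> (i + 2) mod 3 \<and> (i + 1) mod 3 \<noteq> i \<and> (i + 2) mod 3 \<noteq> i"
        by auto
    qed
    have goodU: "real (card (B (oth1 i) - nbrs G x)) \<le> d \<and> real (card (B (oth2 i) - nbrs G x)) \<le> d" if "i < 3" "x \<in> U i" for i x
      using missB[of i "oth1 i" x] missB[of i "oth2 i" x] oth[OF that(1)] that by metis
    have B12: "real (card (B (oth2 i) - nbrs G x)) \<le> d" if "i < 3" "x \<in> B (oth1 i)" for i x
      using missB[of "oth1 i" "oth2 i" x] oth[OF that(1)] BU(1)[of "oth1 i"] that by blast
    have B21: "real (card (B (oth1 i) - nbrs G x)) \<le> d" if "i < 3" "x \<in> B (oth2 i)" for i x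
      using missB[of "oth2 i" "oth1 i" x] oth[OF that(1)] BU(1)[of "oth2 i"] that by (metis subsetD)
    have floor: "card (nbrs G u \<inter> U i) \<le> nat \<lfloor>d\<rfloor>" if "i < 3" "u \<in> U i" for i u
      using inU[OF that] d(1) by (simp add: le_nat_floor)
    have cfl: "real ((4 * (k + l) + 6) * nat \<lfloor>d\<rfloor>) \<le> c * d"
      using d(1) unfolding c_def of_nat_mult by (intro mult_left_mono) auto
    have bigU: "real (card (B j \<inter> nbrs G z)) > 3 * (k + l) * (2 * d + 1)" if "i < 3" "j < 3" "i \<noteq> j" "z \<in> U i" for i j z
    proof -
      have "card (B j) = card (B j \<inter> nbrs G z) + card (B j - nbrs G z)"
        using finU(2)[OF that(2)] by (subst card_Un_disjoint[symmetric]) (auto intro!: arg_cong[of _ _ card])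
      then have "real n / 4 \<le> card (B j \<inter> nbrs G z) + d"
        using BU(2)[OF that(2)] missB[OF that] by linarith
      then show ?thesis using room roomd dd2 by linarith
    qed
    have Q0: "real Q \<le> n + 3 * (c * d)"
    proof -
      have "pairs G (U i) (U i) \<le> card (U i) + (4 * (k + l) + 6) * nat \<lfloor>d\<rfloor>" if i: "i < 3" for i
        by (rule pairs_part[OF sg free, of "B (oth1 i)" "B (oth2 i)" _ d])
          (use i oth[OF i] finU goodU B12 B21 d floor bigU in auto)
      from this[of 0] this[of 1] this[of 2]
      have "Q \<le> (card (U 0) + card (U 1) + card (U 2)) + 3 * ((4 * (k + l) + 6) * nat \<lfloor>d\<rfloor>)"
        unfolding Q_def three by simp
      also have "card (U 0) + card (U 1) + card (U 2) \<le> n"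
        using edge_balance(2)[OF sg V WU UU] by (simp add: n_def)
      finally have "real Q \<le> n + 3 * real ((4 * (k + l) + 6) * nat \<lfloor>d\<rfloor>)"
        by linarith
      then show ?thesis using cfl by linarith
    qed
    \<comment> \<open>An apex has two neighbours in each class, so \<open>pairs_part_cherry\<close>
      always applies and the linear summand of \<open>Q0\<close> disappears.\<close>
    have QW: "real Q \<le> 3 * (c * d)" if Wne: "W \<noteq> {}"
    proof -
      obtain w where w: "w \<in> W" using Wne by blast
      have "pairs G (U i) (U i) \<le> (4 * (k + l) + 6) * nat \<lfloor>d\<rfloor>" if i: "i < 3" for i
      proof -
        have "3 * (k + l) * (2 * d + 1) \<ge> 15"
        proof -
          have "15 \<le> real (3 * (k + l)) * 1" using kl by simp
          also have "\<dots> \<le> real (3 * (k + l)) * (2 * d + 1)" using d by (intro mult_left_mono) auto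
          finally show ?thesis .
        qed
        then have "2 \<le> card (B i \<inter> nbrs G w)" using apexB[OF i w] by linarith
        then obtain Y where "Y \<subseteq> B i \<inter> nbrs G w" "card Y = 2" by (meson obtain_subset_with_card_n)
        then obtain y1 y2 where y: "y1 \<in> B i \<inter> nbrs G w" "y2 \<in> B i \<inter> nbrs G w" "y1 \<noteq> y2" by (auto simp: card_2_iff)
        show ?thesis
          by (rule pairs_part_cherry[OF sg free, of "B (oth1 i)" "B (oth2 i)" _ d w y1 y2])
            (use i oth[OF i] finU goodU B12 B21 d floor apexB w y BU(1)[OF i] in auto)
      qed
      from this[of 0] this[of 1] this[of 2]
      have "Q \<le> 3 * ((4 * (k + l) + 6) * nat \<lfloor>d\<rfloor>)" unfolding Q_def three by simp
      then have "real Q \<le> 3 * real ((4 * (k + l) + 6) * nat \<lfloor>d\<rfloor>)" by linarith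
      then show ?thesis using cfl by linarith
    qed
    define miss where "miss = (\<Sum>x\<in>W. card (verts G - {x} - nbrs G x)) + (\<Sum>i<3. \<Sum>x\<in>U i. card (verts G - U i - nbrs G x))"
    define w where "w = card W"
    define P where "P = card (U 0) * card (U 1) + card (U 1) * card (U 2) + card (U 2) * card (U 0)"
    have nw: "n = w + (card (U 0) + card (U 1) + card (U 2))"
      using edge_balance(2)[OF sg V WU UU] by (simp add: n_def w_def)
    have bal: "2 * card (edges G) + miss = w * (w - 1) + 2 * w * (n - w) + 2 * P + Q"
      using edge_balance(1)[OF sg V WU UU] unfolding miss_def w_def n_def P_def Q_def .
    have P: "P \<le> turan_number3 (n - w)" using turan3(1) nw unfolding P_def by simp
    \<comment> \<open>The hypothesis \<open>E\<close> combined with \<open>bal\<close>; the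
      subtracted term is the loss through unbalanced classes.\<close>
    have count: "join_count s n + miss \<le> join_count w n + Q - 2 * (turan_number3 (n - w) - P)"
      using bal E P unfolding n_def[symmetric] join_count_def by linarith
    have ws: "w = s"
    proof (rule ccontr)
      assume "w \<noteq> s"
      then have lt: "w < s" using cW by (simp add: w_def)
      have "join_count w n + 2 * (s - w) * ((n - s) div 3) \<le> join_count s n"
        using n lt by (intro join_count_mono) auto
      then have le: "2 * (s - w) * ((n - s) div 3) \<le> Q" using count by linarith
      have "n - s \<le> 3 * ((n - s) div 3) + 2" by simp
      then have q': "real n - s - 2 \<le> 3 * real ((n - s) div 3)" using n(2) by linarith
      define X where "X = real ((n - s) div 3)"
      have q: "real n - s - 2 \<le> 3 * X" using q' by (simp add: X_def)
      have "100 * (s + 2) \<le> n" using n(2) by simp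
      then have "real (100 * (s + 2)) \<le> real n" by (simp only: of_nat_le_iff)
      then have s100: "100 * (real s + 2) \<le> n" "real s \<ge> 2" using s2 by simp_all
      show False
      proof (cases "w = 0")
        case True
        then have "2 * 2 * ((n - s) div 3) \<le> 2 * (s - w) * ((n - s) div 3)" using s2 by (intro mult_le_mono) auto
        then have "4 * ((n - s) div 3) \<le> Q" using le by linarith
        then have "real (4 * ((n - s) div 3)) \<le> real Q" by (simp only: of_nat_le_iff)
        then have "4 * X \<le> real Q" by (simp add: X_def)
        moreover have False if "4 * X \<le> Q'" "Q' \<le> n' + 3 * a" "a \<le> n' / 5000" "n' - s' - 2 \<le> 3 * X"
            "100 * (s' + 2) \<le> n'" "2 \<le> s'" for Q' n' a s' :: real
          using that by (simp add: field_simps)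
        ultimately show False using Q0 cdn q s100 by blast
      next
        case False
        then have "W \<noteq> {}" by (auto simp: w_def)
        have "2 * 1 * ((n - s) div 3) \<le> 2 * (s - w) * ((n - s) div 3)" using lt by (intro mult_le_mono) auto
        then have "2 * ((n - s) div 3) \<le> Q" using le by linarith
        then have "real (2 * ((n - s) div 3)) \<le> real Q" by (simp only: of_nat_le_iff)
        then have "2 * X \<le> real Q" by (simp add: X_def)
        moreover have False if "2 * X \<le> Q'" "Q' \<le> 3 * a" "a \<le> n' / 5000" "n' - s' - 2 \<le> 3 * X"
            "100 * (s' + 2) \<le> n'" "2 \<le> s'" for Q' n' a s' :: real
          using that by (simp add: field_simps)
        ultimately show False using QW[OF \<open>W \<noteq> {}\<close>] cdn q s100 by blast
      qed
    qed
    have "W \<noteq> {}" using ws s2 by (auto simp: w_def)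
    note QW = QW[OF this]
    have missQ: "miss \<le> Q" using count unfolding ws by linarith
    have noedge: "v \<notin> nbrs G u" if i: "i < 3" and uv: "u \<in> U i" "v \<in> U i" for i u v
    proof
      assume adj: "v \<in> nbrs G u"
      obtain h where h: "bij_betw h {1..s} W" using ex_bij_betw_nat_finite_1[OF finW(1)] ws by (auto simp: w_def)
      \<comment> \<open>The classes are rotated so that the one containing \<open>u\<close> and
        \<open>v\<close> becomes part 0, since these two are known to be well joined only to the
        other classes.\<close>
      define B' where "B' j = B ((i + j) mod 3)" for j
      have m3: "(i + j) mod 3 < 3" for j by simp
      have mne: "(i + j) mod 3 \<noteq> (i + j') mod 3" if "j < 3" "j' < 3" "j \<noteq> j'" for j j'
      proof -
        have "i \<in> {0, 1, 2}" "j \<in> {0, 1, 2}" "j' \<in> {0, 1, 2}" using that i by auto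
        then show ?thesis using that(3) by auto
      qed
      have mi: "(i + j) mod 3 \<noteq> i" if "j \<in> {1, 2}" for j
        using mne[of j 0] that i by auto
      \<comment> \<open>Each vertex of \<open>B j\<close> not adjacent to the apex \<open>x\<close>
        is counted in \<open>miss\<close>, which is at most \<open>Q\<close> and so at most
        \<open>d2\<close>.\<close>
      have missw: "real (card (B j - nbrs G x)) \<le> d2" if "x \<in> W" "j < 3" for x j
      proof -
        have "x \<notin> B j" using BU(1)[OF that(2)] WU that by blast
        then have "card (B j - nbrs G x) \<le> card (verts G - {x} - nbrs G x)"
          using BU(1)[OF that(2)] subU[OF that(2)] finV by (intro card_mono) auto
        also have "\<dots> \<le> (\<Sum>x\<in>W. card (verts G - {x} - nbrs G x))"
          using finW that by (intro member_le_sum) auto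
        also have "\<dots> \<le> Q" using missQ unfolding miss_def by linarith
        finally show ?thesis using QW unfolding d2_def by linarith
      qed
      have hW: "h r \<in> W" if "r \<in> {1..s}" for r using bij_betwE[OF h] that by blast
      have "\<not> graph_free F G"
      proof (rule full_apices_edge_not_free[OF sg, of B' d2 h v u])
        show "finite (B' j)" for j using finU(2)[OF m3] by (simp add: B'_def)
        show "inj_on h {1..(k + l - 1) div 2}" using h unfolding s_def by (rule bij_betw_imp_inj_on)
        show "{u, v} \<inter> h ` {1..(k + l - 1) div 2} = {}"
        proof -
          have "W \<inter> U i = {}" using WU i by blast
          then show ?thesis
            using uv bij_betw_imp_surj_on[OF h] unfolding s_def[symmetric] by auto
        qed
        show "real (card (B' j - nbrs G u')) \<le> d2" if "u' \<in> {u, v}" "j \<in> {1, 2}" for u' j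
          using missB[OF i m3 mi[OF that(2), symmetric], of u'] that uv dd2 by (auto simp: B'_def)
        show "real (card (B' j - nbrs G (h r))) \<le> d2" if "r \<in> {1..(k + l - 1) div 2}" for r j
          using missw[OF hW m3] that by (simp add: B'_def s_def)
        show "real (card (B' j' - nbrs G u')) \<le> d2" if "j < 3" "j' < 3" "j \<noteq> j'" "u' \<in> B' j" for j j' u'
          using missB[OF m3 m3 mne[OF that(1-3)], of u'] that(4) BU(1)[OF m3] dd2 unfolding B'_def by force
        show "3 * (k + l) * (2 * d2 + 1) < real (card (B' j))" for j
        proof -
          have "real n \<le> real (4 * card (B' j))"
            using BU(2)[OF m3[of j]] unfolding B'_def by (simp only: of_nat_le_iff)
          then have "real n / 4 \<le> card (B' j)" by simp
          then show ?thesis using room dd2 d by linarith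
        qed
      qed (use dd2 d adj in auto)
      with free show False by blast
    qed
    have "Q = 0"
    proof -
      have "nbrs G u \<inter> U i = {}" if "i < 3" "u \<in> U i" for i u using noedge[OF that] by blast
      then show ?thesis by (simp add: Q_def pairs_def)
    qed
    then have "miss = 0" using missQ by simp
    have eqE: "2 * card (edges G) = join_count s n" and eqP: "P = turan_number3 (n - w)"
      using bal E P \<open>Q = 0\<close> \<open>miss = 0\<close> unfolding n_def[symmetric] join_count_def ws by linarith+
    have "n - w = card (U 0) + card (U 1) + card (U 2)" using nw by simp
    then have "{card (U 0), card (U 1), card (U 2)} \<subseteq> {(n - w) div 3, (n - w) div 3 + 1}"
      using turan3(2)[of "card (U 0)" "card (U 1)" "card (U 2)"] eqP unfolding P_def by simp
    then have sizes: "card (U i) \<in> {(n - s) div 3, (n - s) div 3 + 1}" if "i < 3" for i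
    proof -
      have "i = 0 \<or> i = 1 \<or> i = 2" using that by auto
      then show ?thesis using \<open>{card (U 0), card (U 1), card (U 2)} \<subseteq> _\<close> unfolding ws by auto
    qed
    have "apex_tripartite G W U"
      unfolding apex_tripartite_def
    proof (intro conjI V WU UU ballI allI impI)
      show "nbrs G x = verts G - {x}" if "x \<in> W" for x
      proof -
        have "card (verts G - {x} - nbrs G x) = 0"
          using \<open>miss = 0\<close> finW that unfolding miss_def by auto
        then show ?thesis using finV nbrs_subset[OF sg, of x] nbrs_irrefl[OF sg, of x] by auto
      qed
      show "nbrs G x = verts G - U i" if "i < 3" "x \<in> U i" for i x
      proof -
        have "(\<Sum>x\<in>U i. card (verts G - U i - nbrs G x)) = 0"
          using \<open>miss = 0\<close> that(1) unfolding miss_def by simp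
        then have "card (verts G - U i - nbrs G x) = 0" using finU(1)[OF that(1)] that(2) by simp
        then have "verts G - U i \<subseteq> nbrs G x" using finV by auto
        then show ?thesis using nbrs_subset[OF sg, of x] noedge[OF that] by blast
      qed
    qed
    then show "2 * card (edges G) = join_count s (card (verts G)) \<and>
      (\<exists>W U. apex_tripartite G W U \<and> card W = s \<and>
        (\<forall>i<3. card (U i) \<in> {(card (verts G) - s) div 3, (card (verts G) - s) div 3 + 1}))"
      using eqE sizes ws unfolding n_def w_def by blast
  qed
qed

end

section \<open>Reduction to large minimum degree\<close>

definition delete_vertex :: "'a graph \<Rightarrow> 'a \<Rightarrow> 'a graph" where
  "delete_vertex G v = \<lparr>verts = verts G - {v}, edges = {e \<in> edges G. v \<notin> e}\<rparr>"

lemma simple_delete_vertex: "simple_graph G \<Longrightarrow> simple_graph (delete_vertex G v)"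
  by (auto simp: simple_graph_def delete_vertex_def)

lemma free_delete_vertex: "graph_free F G \<Longrightarrow> graph_free F (delete_vertex G v)"
  unfolding graph_free_def subgraph_def delete_vertex_def by auto

lemma edges_delete_vertex:
  assumes "simple_graph G" "v \<in> verts G"
  shows "card (edges G) = card (edges (delete_vertex G v)) + card (nbrs G v)"
proof -
  have "bij_betw (\<lambda>y. {v, y}) (nbrs G v) {e \<in> edges G. v \<in> e}"
  proof (rule bij_betw_imageI)
    show "inj_on (\<lambda>y. {v, y}) (nbrs G v)" by (auto simp: inj_on_def doubleton_eq_iff)
    show "(\<lambda>y. {v, y}) ` nbrs G v = {e \<in> edges G. v \<in> e}"
    proof (intro equalityI subsetI)
      fix e assume "e \<in> {e \<in> edges G. v \<in> e}"
      then have e: "e \<in> edges G" "v \<in> e" by auto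
      obtain a b where "e = {a, b}" using simple_edgeE[OF assms(1) e(1)] by metis
      then show "e \<in> (\<lambda>y. {v, y}) ` nbrs G v"
        using e by (auto simp: nbrs_def insert_commute)
    qed (auto simp: nbrs_def)
  qed
  then have "card (nbrs G v) = card {e \<in> edges G. v \<in> e}" by (rule bij_betw_same_card)
  moreover have "card (edges G) = card {e \<in> edges G. v \<notin> e} + card {e \<in> edges G. v \<in> e}"
    using finite_edges[OF assms(1)] by (subst card_Un_disjoint[symmetric]) (auto intro!: arg_cong[of _ _ card])
  ultimately show ?thesis by (simp add: delete_vertex_def)
qed

context odd_lollipop
begin

text \<open>One vertex less lowers the doubled benchmark by \<open>2 * (n - (n - s) div 3)\<close>.
  For the degree b of a low vertex and q = \<open>(n - s) div 3\<close>, the bounds 3 b \<le> 2 n +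
  1 and 3 q \<le> n - s \<le> n - 2 give b + q < n. So fewer edges are lost than the benchmark
  drops, and the surplus grows by at least one edge.\<close>

lemma low_degree_deletion:
  fixes G :: "'a graph"
  defines "s \<equiv> (k + l - 1) div 2"
  assumes sg: "simple_graph G" and n: "card (verts G) = Suc n" "s \<le> n"
    and E: "join_count s (Suc n) + 2 * j \<le> 2 * card (edges G)"
    and low: "\<not> (\<forall>v\<in>verts G. 2 * card (verts G) \<le> 3 * card (nbrs G v))"
  shows "\<exists>v. card (verts (delete_vertex G v)) = n \<and>
    join_count s n + 2 * (j + 1) \<le> 2 * card (edges (delete_vertex G v))"
proof -
  obtain v where v: "v \<in> verts G" "3 * card (nbrs G v) < 2 * Suc n" using low n(1) by auto
  have s2: "s \<ge> 2" using k3 l2 by (simp add: s_def)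
  define q where "q = (n - s) div 3"
  define b where "b = card (nbrs G v)"
  have "3 * q \<le> n - s" by (simp add: q_def)
  moreover have "n - s + 2 \<le> n" using n(2) s2 by linarith
  moreover have "3 * b < 2 * Suc n" using v(2) by (simp add: b_def)
  ultimately have "b + q < n" by presburger
  then have "join_count s n + 2 * (j + 1) \<le> 2 * card (edges (delete_vertex G v))"
    using join_count_Suc_n[OF n(2), folded q_def] E edges_delete_vertex[OF sg v(1), folded b_def] \<open>b + q < n\<close> by arith
  moreover have "card (verts (delete_vertex G v)) = n"
    using n(1) v(1) by (simp add: delete_vertex_def)
  ultimately show ?thesis by blast
qed

text \<open>Deleting vertices of low degree increases the surplus over \<^const>\<open>join_count\<close>. As the surplus
  is at most quadratic in the number of vertices left, only few vertices can be deleted.\<close>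
lemma surplus_bound:
  fixes G :: "'a graph"
  defines "s \<equiv> (k + l - 1) div 2"
  assumes N: "s \<le> N"
    and struct: "\<And>G :: 'a graph. simple_graph G \<Longrightarrow> graph_free F G \<Longrightarrow> card (verts G) \<ge> N \<Longrightarrow>
      \<forall>v\<in>verts G. 2 * card (verts G) \<le> 3 * card (nbrs G v) \<Longrightarrow>
      join_count s (card (verts G)) \<le> 2 * card (edges G) \<Longrightarrow> 2 * card (edges G) = join_count s (card (verts G))"
    and "simple_graph G" "graph_free F G" "card (verts G) = n" "N \<le> n"
    and "join_count s n + 2 * j \<le> 2 * card (edges G)" "1 \<le> j"
  shows "n + j \<le> N + N * N"
  using assms(4-)
proof (induction "n - N" arbitrary: n j G)
  case 0
  then have n: "n = N" by simp
  have fin: "finite (verts G)" using 0 by (simp add: simple_graph_def)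
  have "2 * card (edges G) \<le> n * n"
    using handshake[OF 0(2)] pairs_le[OF fin, of G "verts G"] 0 by simp
  from order_trans[OF add_leD2[OF 0(6)] this] have "2 * j \<le> N * N" by (simp add: n)
  then show ?case using n by simp
next
  case (Suc x)
  then obtain n' where n': "n = Suc n'" "N \<le> n'" "x = n' - N" by (cases n) auto
  show ?case
  proof (cases "\<forall>v\<in>verts G. 2 * card (verts G) \<le> 3 * card (nbrs G v)")
    \<comment> \<open>A graph satisfying the degree condition has no surplus, contrary to
      \<open>1 \<le> j\<close>.\<close>
    case True
    have "2 * card (edges G) = join_count s (card (verts G))"
      by (rule struct[OF Suc(3,4) _ True]) (use Suc in auto)
    then show ?thesis using Suc by simp
  next
    case False
    have "\<exists>v. card (verts (delete_vertex G v)) = n' \<and>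
      join_count s n' + 2 * (j + 1) \<le> 2 * card (edges (delete_vertex G v))"
      unfolding s_def
      by (rule low_degree_deletion[OF Suc(3) _ _ _ False]) (use Suc n' N in \<open>auto simp: s_def\<close>)
    then obtain v where v: "card (verts (delete_vertex G v)) = n'"
      "join_count s n' + 2 * (j + 1) \<le> 2 * card (edges (delete_vertex G v))" by blast
    have "n' + (j + 1) \<le> N + N * N"
      by (rule Suc(1)[OF n'(3) simple_delete_vertex[OF Suc(3)] free_delete_vertex[OF Suc(4)] v(1) n'(2) v(2)]) simp
    then show ?thesis using n' by simp
  qed
qed

text \<open>If some vertex had low degree, its deletion would leave a surplus of 1, and
  \<open>surplus_bound\<close> would limit the number of vertices. So a sufficiently large graph
  satisfies the degree condition itself, and \<open>extremal_structure\<close> applies to it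
  directly.\<close>

lemma large_structure:
  defines "s \<equiv> (k + l - 1) div 2"
  shows "\<exists>N. \<forall>G :: 'a graph. simple_graph G \<longrightarrow> graph_free F G \<longrightarrow> card (verts G) \<ge> N \<longrightarrow>
    join_count s (card (verts G)) \<le> 2 * card (edges G) \<longrightarrow>
    2 * card (edges G) = join_count s (card (verts G)) \<and>
    (\<exists>W U. apex_tripartite G W U \<and> card W = s \<and>
      (\<forall>i<3. card (U i) \<in> {(card (verts G) - s) div 3, (card (verts G) - s) div 3 + 1}))"
proof -
  obtain N0 where N0: "\<And>G :: 'a graph. simple_graph G \<Longrightarrow> graph_free F G \<Longrightarrow> card (verts G) \<ge> N0 \<Longrightarrow>
    \<forall>v\<in>verts G. 2 * card (verts G) \<le> 3 * card (nbrs G v) \<Longrightarrow>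
    join_count s (card (verts G)) \<le> 2 * card (edges G) \<Longrightarrow>
    2 * card (edges G) = join_count s (card (verts G)) \<and>
    (\<exists>W U. apex_tripartite G W U \<and> card W = s \<and>
      (\<forall>i<3. card (U i) \<in> {(card (verts G) - s) div 3, (card (verts G) - s) div 3 + 1}))"
    using extremal_structure[where 'a = 'a] unfolding s_def by blast
  define N where "N = max N0 s"
  show ?thesis
  proof (rule exI[of _ "N + N * N + 1"], intro allI impI)
    fix G :: "'a graph"
    assume sg: "simple_graph G" and free: "graph_free F G" and n: "N + N * N + 1 \<le> card (verts G)"
      and E: "join_count s (card (verts G)) \<le> 2 * card (edges G)"
    show "2 * card (edges G) = join_count s (card (verts G)) \<and>
      (\<exists>W U. apex_tripartite G W U \<and> card W = s \<and>
        (\<forall>i<3. card (U i) \<in> {(card (verts G) - s) div 3, (card (verts G) - s) div 3 + 1}))"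
    proof (cases "\<forall>v\<in>verts G. 2 * card (verts G) \<le> 3 * card (nbrs G v)")
      case True
      show ?thesis by (rule N0[OF sg free _ True E]) (use n in \<open>simp add: N_def\<close>)
    next
      case False
      obtain n' where n': "card (verts G) = Suc n'" using n by (cases "card (verts G)") auto
      have "N \<le> n'" using n n' by simp
      then have sn: "s \<le> n'" by (simp add: N_def)
      have "\<exists>v. card (verts (delete_vertex G v)) = n' \<and>
        join_count s n' + 2 * (0 + 1) \<le> 2 * card (edges (delete_vertex G v))"
        unfolding s_def
        by (rule low_degree_deletion[OF sg n' _ _ False]) (use E n' sn in \<open>simp_all add: s_def\<close>)
      then obtain v where v: "card (verts (delete_vertex G v)) = n'"
        "join_count s n' + 2 * 1 \<le> 2 * card (edges (delete_vertex G v))" by auto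
      have "n' + 1 \<le> N + N * N"
      proof (rule surplus_bound[folded s_def, OF _ _ simple_delete_vertex[OF sg] free_delete_vertex[OF free] v(1) \<open>N \<le> n'\<close> v(2)])
        show "2 * card (edges G) = join_count s (card (verts G))"
          if "simple_graph G" "graph_free F G" "N \<le> card (verts G)"
            "\<forall>v\<in>verts G. 2 * card (verts G) \<le> 3 * card (nbrs G v)"
            "join_count s (card (verts G)) \<le> 2 * card (edges G)" for G :: "'a graph"
          using N0[OF that(1,2) _ that(4,5)] that(3) by (simp add: N_def)
      qed (simp_all add: N_def)
      then show ?thesis using n n' by simp
    qed
  qed
qed

text \<open>A code lies in at most two of the k cliques around the cycle, so by oddness of k these
  need at least (k + 1) / 2 codes. Every second clique of the tail gives \<open>l div 2\<close>
  further cliques that are disjoint from each other and from those of the cycle; the first clique of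
  the tail is left out because it contains the vertex \<open>k - 1\<close> of the cycle.\<close>

lemma code_set_transversal:
  assumes fin: "finite A" and hit: "\<And>j. j < k + l \<Longrightarrow> A \<inter> clq k l j \<noteq> {}"
  shows "(k + l - 1) div 2 < card A"
proof -
  obtain x where x: "\<And>j. j < k + l \<Longrightarrow> x j \<in> A \<inter> clq k l j"
  proof -
    have "\<forall>j. \<exists>y. j < k + l \<longrightarrow> y \<in> A \<inter> clq k l j" using hit by blast
    then show ?thesis using that by metis
  qed
  define Cy where "Cy = insert (k + l - 1) {..<k - 1}"
  define Pa where "Pa = (\<lambda>i. k + 2 * i) ` {..<l div 2}"
  have Cy: "j < k + l" if "j \<in> Cy" for j using that k3 by (auto simp: Cy_def)
  have Pa: "Suc j < k + l" "k \<le> j" "even (j - k)" if "j \<in> Pa" for j using that by (auto simp: Pa_def)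
  have cCy: "card Cy = k" using k3 l2 by (simp add: Cy_def)
  have cPa: "card Pa = l div 2" unfolding Pa_def by (subst card_image) (auto simp: inj_on_def)
  have fibre: "card {j \<in> Cy. x j = y} \<le> 2" for y
  proof -
    obtain i b where y: "y = (i, b)" by fastforce
    have "{j \<in> Cy. x j = y} \<subseteq> {if i = k - 1 then k + l - 1 else i, if i = 0 then k + l - 1 else i - 1}"
    proof
      fix j assume "j \<in> {j \<in> Cy. x j = y}"
      then have j: "j \<in> Cy" "y \<in> clq k l j" using x[of j] Cy by auto
      then consider "j < k - 1" | "j = k + l - 1" by (auto simp: Cy_def)
      then show "j \<in> {if i = k - 1 then k + l - 1 else i, if i = 0 then k + l - 1 else i - 1}"
        using j(2) y k3 l2 by cases (auto simp: clq_def split: if_splits)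
    qed
    then have "card {j \<in> Cy. x j = y} \<le> card {if i = k - 1 then k + l - 1 else i, if i = 0 then k + l - 1 else i - 1}"
      by (intro card_mono) auto
    also have "\<dots> \<le> 2" by (simp add: card_insert_if)
    finally show ?thesis .
  qed
  have finCy: "finite Cy" by (simp add: Cy_def)
  have "card Cy = (\<Sum>y\<in>x ` Cy. card {j \<in> Cy. x j = y})"
    using sum.image_gen[OF finCy, of "\<lambda>_. 1::nat" x] by simp
  also have "\<dots> \<le> (\<Sum>y\<in>x ` Cy. 2)" using fibre by (intro sum_mono) auto
  finally have c1: "k \<le> 2 * card (x ` Cy)" using cCy by simp
  have inj: "inj_on x Pa"
  proof (rule inj_onI)
    fix i j assume ij: "i \<in> Pa" "j \<in> Pa" "x i = x j"
    have "x i \<in> clq k l i" "x i \<in> clq k l j" using x[of i] x[of j] ij Pa(1)[OF ij(1)] Pa(1)[OF ij(2)] by auto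
    then have "i = j \<or> i = Suc j \<or> j = Suc i"
      using Pa(1)[OF ij(1)] Pa(1)[OF ij(2)] by (auto simp: clq_def)
    then show "i = j" using Pa(2,3)[OF ij(1)] Pa(2,3)[OF ij(2)] by (auto simp: Suc_diff_le)
  qed
  have ndisj: "x j \<notin> x ` Cy" if j: "j \<in> Pa" for j
  proof
    assume "x j \<in> x ` Cy"
    then obtain i where i: "i \<in> Cy" "x j = x i" by blast
    have "x j \<in> clq k l j" "x j \<in> clq k l i" using x[of j] x[of i] i Pa(1)[OF j] Cy[OF i(1)] by auto
    moreover have "i < k - 1 \<or> i = k + l - 1" using i by (auto simp: Cy_def)
    ultimately show False using Pa(1,2)[OF j] k3 by (auto simp: clq_def split: if_splits)
  qed
  have disj: "x ` Cy \<inter> x ` Pa = {}"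
  proof (rule equals0I)
    fix y assume y: "y \<in> x ` Cy \<inter> x ` Pa"
    from IntD2[OF y] obtain j where j: "y = x j" "j \<in> Pa" by (rule imageE)
    show False using IntD1[OF y] ndisj[OF j(2)] unfolding j(1) by contradiction
  qed
  have "finite Pa" by (simp add: Pa_def)
  then have "card (x ` Cy \<union> x ` Pa) = card (x ` Cy) + card (x ` Pa)"
    by (intro card_Un_disjoint finite_imageI finCy disj)
  also have "card (x ` Pa) = l div 2" using inj cPa by (simp add: card_image)
  finally have "card (x ` Cy \<union> x ` Pa) = card (x ` Cy) + l div 2" .
  moreover have "card (x ` Cy \<union> x ` Pa) \<le> card A"
  proof (rule card_mono[OF fin], intro Un_least image_subsetI)
    show "x j \<in> A" if "j \<in> Cy" for j using x[OF Cy[OF that]] by (rule IntD1)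
    show "x j \<in> A" if "j \<in> Pa" for j using x[OF Suc_lessD[OF Pa(1)[OF that]]] by (rule IntD1)
  qed
  ultimately have "card (x ` Cy) + l div 2 \<le> card A" by simp
  moreover obtain h where h: "k = 2 * h + 1" using odd_k oddE by blast
  have "(k + l - 1) div 2 = h + l div 2" by (simp add: h)
  moreover have "h < card (x ` Cy)" using c1 h by simp
  ultimately show ?thesis by simp
qed

text \<open>A clique of the blow-up has four vertices, of which three independent classes take at
  most three, so one is mapped into \<open>W\<close>. The preimage of \<open>W\<close> thus meets
  all cliques and is larger than \<open>W\<close>, contrary to injectivity.\<close>

lemma apex_tripartite_free:
  assumes sg: "simple_graph G" and ap: "apex_tripartite G W U" and W: "card W \<le> (k + l - 1) div 2"
  shows "graph_free F G"
proof -
  have "\<not> embeds F G \<phi>" for \<phi>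
  proof
    assume emb: "embeds F G \<phi>"
    define A where "A = {x \<in> verts F. \<phi> x \<in> W}"
    have V: "verts G = W \<union> U 0 \<union> U 1 \<union> U 2" using ap by (simp add: apex_tripartite_def)
    have finV: "finite (verts G)" using sg by (simp add: simple_graph_def)
    have finF: "finite (verts F)" using simple_blow_up by (simp add: simple_graph_def)
    have "card A = card (\<phi> ` A)" using emb by (intro card_image[symmetric]) (auto simp: A_def embeds_def inj_on_def)
    also have "\<dots> \<le> card W" using V finV by (intro card_mono) (auto simp: A_def)
    finally have cA: "card A \<le> card W" .
    have "(k + l - 1) div 2 < card (code ` A)"
    proof (rule code_set_transversal)
      show "finite (code ` A)" using finF by (simp add: A_def)
      fix j assume j: "j < k + l"
      let ?K = "blow_up_clique 3 (ends k l j)"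
      have KF: "?K \<subseteq> verts F" using j by (auto simp: edge_blow_up_def edges_lollipop)
      have cK: "card ?K = 4"
      proof -
        have "inj_on code ?K" using code_inj KF inj_on_subset by blast
        then have "card ?K = card (clq k l j)" using code_clique[OF j] card_image by metis
        then show ?thesis using k3 by (simp add: clq_def card_insert_if)
      qed
      have "\<exists>x\<in>?K. \<phi> x \<in> W"
      proof (rule ccontr)
        assume no: "\<not> ?thesis"
        define part where "part x = (SOME i. i < 3 \<and> \<phi> x \<in> U i)" for x
        have part: "part x < 3 \<and> \<phi> x \<in> U (part x)" if "x \<in> ?K" for x
        proof -
          have "\<phi> x \<in> verts G" using emb KF that by (auto simp: embeds_def)
          then have "\<phi> x \<in> U 0 \<or> \<phi> x \<in> U 1 \<or> \<phi> x \<in> U 2" using no that V by blast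
          then have "\<exists>i. i < 3 \<and> \<phi> x \<in> U i"
            by (elim disjE) (rule exI[of _ 0], simp, rule exI[of _ 1], simp, rule exI[of _ 2], simp)
          then show ?thesis unfolding part_def by (rule someI_ex)
        qed
        have "card (part ` ?K) \<le> card {..<3::nat}" using part by (intro card_mono) auto
        then have "card (part ` ?K) < card ?K" using cK by simp
        then have "\<not> inj_on part ?K" by (rule pigeonhole)
        then obtain x y where xy: "x \<in> ?K" "y \<in> ?K" "x \<noteq> y" "part x = part y" by (auto simp: inj_on_def)
        have "{x, y} \<in> edges F" using xy j by (auto simp: edge_blow_up_def edges_lollipop)
        then have "\<phi> ` {x, y} \<in> edges G" using emb by (simp only: embeds_def)
        then have "\<phi> y \<in> nbrs G (\<phi> x)" by (simp add: nbrs_def)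
        moreover have "nbrs G (\<phi> x) = verts G - U (part x)" using ap part[OF xy(1)] unfolding apex_tripartite_def by blast
        ultimately show False using part[OF xy(2)] xy(4) by simp
      qed
      then obtain x where "x \<in> ?K" "x \<in> A" using KF by (auto simp: A_def)
      then show "code ` A \<inter> clq k l j \<noteq> {}" using code_clique[OF j] by blast
    qed
    moreover have "card (code ` A) \<le> card A" using finF by (intro card_image_le) (simp add: A_def)
    ultimately show False using cA W by linarith
  qed
  then show ?thesis using graph_free_iff[OF simple_blow_up] by blast
qed

end

lemma all_less_3: "(\<forall>i<3::nat. P i) \<longleftrightarrow> P 0 \<and> P 1 \<and> P 2"
proof
  assume "P 0 \<and> P 1 \<and> P 2"
  then show "\<forall>i<3. P i" by (metis One_nat_def less_2_cases less_Suc_eq numeral_2_eq_2 numeral_3_eq_3)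
qed auto

section \<open>The graph \<open>H(n, 3, q)\<close> and uniqueness\<close>

text \<open>Two balanced partitions have the same part sizes only up to order; sorting by size lets
  them be matched index by index.\<close>

lemma apex_tripartite_sorted:
  fixes U :: "nat \<Rightarrow> 'a set"
  assumes "apex_tripartite G W U"
  obtains U' where "apex_tripartite G W U'" "card (U' 0) \<le> card (U' 1)" "card (U' 1) \<le> card (U' 2)"
    "\<forall>i<3. U' i \<in> U ` {..<3}"
proof -
  have perm: thesis
    if "(a, b, c) \<in> {(0, 1, 2), (0, 2, 1), (1, 0, 2), (1, 2, 0), (2, 0, 1), (2, 1, 0 :: nat)}"
      "card (U a) \<le> card (U b)" "card (U b) \<le> card (U c)" for a b c :: nat
  proof (rule \<open>\<And>U'. \<lbrakk>apex_tripartite G W U'; card (U' 0) \<le> card (U' 1); card (U' 1) \<le> card (U' 2);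
      \<forall>i<3. U' i \<in> U ` {..<3}\<rbrakk> \<Longrightarrow> thesis\<close>)
    let ?U = "\<lambda>i :: nat. if i = 0 then U a else if i = 1 then U b else U c"
    show "apex_tripartite G W ?U"
      using assms that(1) unfolding apex_tripartite_def all_less_3 by (elim insertE) auto
    show "\<forall>i<3. ?U i \<in> U ` {..<3}" using that(1) by auto
  qed (use that in auto)
  consider "card (U 0) \<le> card (U 1)" "card (U 1) \<le> card (U 2)" | "card (U 0) \<le> card (U 2)" "card (U 2) \<le> card (U 1)"
    | "card (U 1) \<le> card (U 0)" "card (U 0) \<le> card (U 2)" | "card (U 1) \<le> card (U 2)" "card (U 2) \<le> card (U 0)"
    | "card (U 2) \<le> card (U 0)" "card (U 0) \<le> card (U 1)" | "card (U 2) \<le> card (U 1)" "card (U 1) \<le> card (U 0)"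
    by linarith
  then show thesis
  proof cases
    case 1 then show ?thesis by (rule perm[rotated]) simp
  next
    case 2 then show ?thesis by (rule perm[rotated]) simp
  next
    case 3 then show ?thesis by (rule perm[rotated]) simp
  next
    case 4 then show ?thesis by (rule perm[rotated]) simp
  next
    case 5 then show ?thesis by (rule perm[rotated]) simp
  next
    case 6 then show ?thesis by (rule perm[rotated]) simp
  qed
qed

lemma apex_tripartiteD:
  assumes "apex_tripartite G W U"
  shows "verts G = W \<union> U 0 \<union> U 1 \<union> U 2" and "i < 3 \<Longrightarrow> W \<inter> U i = {}"
    and "i < 3 \<Longrightarrow> j < 3 \<Longrightarrow> i \<noteq> j \<Longrightarrow> U i \<inter> U j = {}"
    and "x \<in> W \<Longrightarrow> nbrs G x = verts G - {x}" and "i < 3 \<Longrightarrow> x \<in> U i \<Longrightarrow> nbrs G x = verts G - U i"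
proof -
  note D = assms[unfolded apex_tripartite_def]
  show "verts G = W \<union> U 0 \<union> U 1 \<union> U 2" using D by (rule conjunct1)
  show "i < 3 \<Longrightarrow> W \<inter> U i = {}" by (rule D[THEN conjunct2, THEN conjunct1, rule_format])
  show "i < 3 \<Longrightarrow> j < 3 \<Longrightarrow> i \<noteq> j \<Longrightarrow> U i \<inter> U j = {}"
    by (rule D[THEN conjunct2, THEN conjunct2, THEN conjunct1, rule_format])
  show "x \<in> W \<Longrightarrow> nbrs G x = verts G - {x}"
    by (rule D[THEN conjunct2, THEN conjunct2, THEN conjunct2, THEN conjunct1, rule_format])
  show "i < 3 \<Longrightarrow> x \<in> U i \<Longrightarrow> nbrs G x = verts G - U i"
    by (rule D[THEN conjunct2, THEN conjunct2, THEN conjunct2, THEN conjunct2, rule_format])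
qed

text \<open>Adjacency in terms of the classes alone: two distinct vertices are adjacent unless they
  share a class. Hence every bijection that respects the classes is an isomorphism.\<close>

lemma apex_tripartite_nbrs:
  assumes "apex_tripartite G W U" "x \<in> verts G" "y \<in> verts G"
  shows "y \<in> nbrs G x \<longleftrightarrow> x \<noteq> y \<and> \<not> (\<exists>i<3. x \<in> U i \<and> y \<in> U i)"
proof (cases "x \<in> W")
  case True
  then have "nbrs G x = verts G - {x}" "\<forall>i<3. x \<notin> U i"
    using apex_tripartiteD(2,4)[OF assms(1)] by blast+
  then show ?thesis using assms(3) by auto
next
  case False
  then have "x \<in> U 0 \<or> x \<in> U 1 \<or> x \<in> U 2" using apex_tripartiteD(1)[OF assms(1)] assms(2) by blast
  then obtain i where i: "i < 3" "x \<in> U i" by (elim disjE) (auto intro: that[of 0] that[of 1] that[of 2])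
  have "nbrs G x = verts G - U i" by (rule apex_tripartiteD(5)[OF assms(1) i])
  moreover have "j = i" if "j < 3" "x \<in> U j" for j
    using apex_tripartiteD(3)[OF assms(1) i(1) that(1)] i(2) that(2) by blast
  ultimately have "y \<in> nbrs G x \<longleftrightarrow> y \<notin> U i" and uniq: "\<And>j. j < 3 \<Longrightarrow> x \<in> U j \<Longrightarrow> j = i"
    using assms(3) by simp_all
  moreover have "y \<notin> U i \<longleftrightarrow> x \<noteq> y \<and> \<not> (\<exists>j<3. x \<in> U j \<and> y \<in> U j)"
  proof
    assume "y \<notin> U i"
    then show "x \<noteq> y \<and> \<not> (\<exists>j<3. x \<in> U j \<and> y \<in> U j)" using uniq i(2) by metis
  next
    assume "x \<noteq> y \<and> \<not> (\<exists>j<3. x \<in> U j \<and> y \<in> U j)"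
    then show "y \<notin> U i" using i by metis
  qed
  ultimately show ?thesis by simp
qed

lemma bij_betw_glue:
  assumes "finite A" "finite A'" "card A = card A'" "bij_betw g S S'" "A \<inter> S = {}" "A' \<inter> S' = {}"
  obtains f where "bij_betw f (A \<union> S) (A' \<union> S')" "f ` A = A'" "\<And>x. x \<in> S \<Longrightarrow> f x = g x"
proof -
  obtain h where h: "bij_betw h A A'" using finite_same_card_bij[OF assms(1-3)] by blast
  define f where "f x = (if x \<in> A then h x else g x)" for x
  have 1: "bij_betw f A A'" using h by (rule bij_betw_cong[THEN iffD1, rotated]) (simp add: f_def)
  have 2: "bij_betw f S S'" using assms(4) by (rule bij_betw_cong[THEN iffD1, rotated]) (use assms(5) in \<open>auto simp: f_def\<close>)
  show thesis
  proof (rule that)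
    show "bij_betw f (A \<union> S) (A' \<union> S')" using bij_betw_combine[OF 1 2 assms(6)] .
    show "f ` A = A'" using 1 by (rule bij_betw_imp_surj_on)
    show "f x = g x" if "x \<in> S" for x using that assms(5) by (auto simp: f_def)
  qed
qed

lemma apex_tripartite_iso_aux:
  fixes G :: "'a graph" and H :: "'b graph"
  assumes sg: "simple_graph G" "simple_graph H" and G: "apex_tripartite G W U" and H: "apex_tripartite H W' U'"
    and cW: "card W = card W'" and cU: "\<forall>i<3. card (U i) = card (U' i)"
  shows "G \<simeq> H"
proof -
  have V: "verts G = W \<union> U 0 \<union> U 1 \<union> U 2" "verts H = W' \<union> U' 0 \<union> U' 1 \<union> U' 2"
    using G H by (simp_all add: apex_tripartite_def)
  have fin: "finite W" "finite (U 0)" "finite (U 1)" "finite (U 2)" "finite W'" "finite (U' 0)" "finite (U' 1)" "finite (U' 2)"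
    using sg V by (auto simp: simple_graph_def)
  have dG: "W \<inter> U 0 = {}" "W \<inter> U 1 = {}" "W \<inter> U 2 = {}" "U 0 \<inter> U 1 = {}" "U 0 \<inter> U 2 = {}" "U 1 \<inter> U 2 = {}"
    using G unfolding apex_tripartite_def all_less_3 by auto
  have dH: "W' \<inter> U' 0 = {}" "W' \<inter> U' 1 = {}" "W' \<inter> U' 2 = {}" "U' 0 \<inter> U' 1 = {}" "U' 0 \<inter> U' 2 = {}" "U' 1 \<inter> U' 2 = {}"
    using H unfolding apex_tripartite_def all_less_3 by auto
  obtain f0 where f0: "bij_betw f0 (U 0) (U' 0)"
    using finite_same_card_bij[OF fin(2,6)] cU by auto
  obtain f1 where f1: "bij_betw f1 (U 1 \<union> U 0) (U' 1 \<union> U' 0)" "f1 ` U 1 = U' 1" "\<And>x. x \<in> U 0 \<Longrightarrow> f1 x = f0 x"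
    using bij_betw_glue[OF fin(3,7) _ f0] cU dG dH by (auto simp: Int_commute)
  obtain f2 where f2: "bij_betw f2 (U 2 \<union> (U 1 \<union> U 0)) (U' 2 \<union> (U' 1 \<union> U' 0))" "f2 ` U 2 = U' 2"
      "\<And>x. x \<in> U 1 \<union> U 0 \<Longrightarrow> f2 x = f1 x"
    by (rule bij_betw_glue[OF fin(4,8) _ f1(1)]) (use cU dG dH in auto)
  obtain f where f: "bij_betw f (W \<union> (U 2 \<union> (U 1 \<union> U 0))) (W' \<union> (U' 2 \<union> (U' 1 \<union> U' 0)))" "f ` W = W'"
      "\<And>x. x \<in> U 2 \<union> (U 1 \<union> U 0) \<Longrightarrow> f x = f2 x"
    by (rule bij_betw_glue[OF fin(1,5) cW f2(1)]) (use dG dH in auto)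
  have bij: "bij_betw f (verts G) (verts H)" using f(1) unfolding V by (simp add: Un_ac)
  have im: "f ` U i = U' i" if "i < 3" for i
  proof -
    have "f ` U 2 = f2 ` U 2" "f ` U 1 = f1 ` U 1" "f ` U 0 = f0 ` U 0"
      using f(3) f2(3) f1(3) by (auto intro!: image_cong)
    then have "f ` U 2 = U' 2" "f ` U 1 = U' 1" "f ` U 0 = U' 0"
      using f2(2) f1(2) bij_betw_imp_surj_on[OF f0] by auto
    moreover have "i = 0 \<or> i = 1 \<or> i = 2" using that by auto
    ultimately show ?thesis by auto
  qed
  have inj: "inj_on f (verts G)" using bij by (rule bij_betw_imp_inj_on)
  have sub: "U i \<subseteq> verts G" if "i < 3" for i
  proof -
    have "i = 0 \<or> i = 1 \<or> i = 2" using that by auto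
    then show ?thesis using V by auto
  qed
  have mem: "f x \<in> U' i \<longleftrightarrow> x \<in> U i" if "i < 3" "x \<in> verts G" for i x
    using inj_on_image_mem_iff[OF inj that(2) sub[OF that(1)]] im[OF that(1)] by simp
  have adj: "f y \<in> nbrs H (f x) \<longleftrightarrow> y \<in> nbrs G x" if "x \<in> verts G" "y \<in> verts G" for x y
  proof -
    have "f x \<in> verts H" "f y \<in> verts H" using bij_betwE[OF bij] that by auto
    then show ?thesis
      using apex_tripartite_nbrs[OF G that] apex_tripartite_nbrs[OF H, of "f x" "f y"] mem that
        inj_on_eq_iff[OF inj that] by auto
  qed
  have "edges H = (`) f ` edges G"
  proof (intro equalityI subsetI)
    fix e assume e: "e \<in> edges H"
    obtain a b where ab: "e = {a, b}" "a \<in> verts H" "b \<in> verts H" using simple_edgeE[OF sg(2) e] by metis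
    then obtain x y where xy: "x \<in> verts G" "y \<in> verts G" "a = f x" "b = f y"
      using bij_betw_imp_surj_on[OF bij] by blast
    then have "y \<in> nbrs G x" using adj[OF xy(1,2)] e ab by (simp add: nbrs_def)
    then show "e \<in> (`) f ` edges G" using ab xy by (auto simp: nbrs_def intro!: image_eqI[of _ _ "{x, y}"])
  next
    fix e assume "e \<in> (`) f ` edges G"
    then obtain e' where e': "e' \<in> edges G" "e = f ` e'" by blast
    obtain x y where xy: "e' = {x, y}" "x \<in> verts G" "y \<in> verts G" using simple_edgeE[OF sg(1) e'(1)] by metis
    then have "f y \<in> nbrs H (f x)" using adj e'(1) by (simp add: nbrs_def)
    then show "e \<in> edges H" using e' xy by (simp add: nbrs_def)
  qed
  then show ?thesis using bij unfolding graph_iso_def by blast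
qed

lemma apex_tripartite_card:
  assumes "simple_graph G" "apex_tripartite G W U"
  shows "card (verts G) = card W + (card (U 0) + card (U 1) + card (U 2))"
  by (rule edge_balance(2)[OF assms(1)]) (use assms(2) in \<open>auto simp: apex_tripartite_def\<close>)

lemma sorted_near_equal:
  fixes q a b c a' b' c' :: nat
  assumes "a \<in> {q, q + 1}" "b \<in> {q, q + 1}" "c \<in> {q, q + 1}" "a' \<in> {q, q + 1}" "b' \<in> {q, q + 1}" "c' \<in> {q, q + 1}"
    and "a \<le> b" "b \<le> c" "a' \<le> b'" "b' \<le> c'" "a + b + c = a' + b' + c'"
  shows "a = a' \<and> b = b' \<and> c = c'"
  using assms by auto

lemma apex_tripartite_iso:
  fixes G :: "'a graph" and H :: "'b graph"
  assumes sg: "simple_graph G" "simple_graph H" and G: "apex_tripartite G W U" and H: "apex_tripartite H W' U'"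
    and cW: "card W = card W'" and cV: "card (verts G) = card (verts H)"
    and q: "\<forall>i<3. card (U i) \<in> {q, q + 1}" "\<forall>i<3. card (U' i) \<in> {q, q + 1}"
  shows "G \<simeq> H"
proof -
  obtain U1 where U1: "apex_tripartite G W U1" "card (U1 0) \<le> card (U1 1)" "card (U1 1) \<le> card (U1 2)" "\<forall>i<3. U1 i \<in> U ` {..<3}"
    using apex_tripartite_sorted[OF G] by blast
  obtain U2 where U2: "apex_tripartite H W' U2" "card (U2 0) \<le> card (U2 1)" "card (U2 1) \<le> card (U2 2)" "\<forall>i<3. U2 i \<in> U' ` {..<3}"
    using apex_tripartite_sorted[OF H] by blast
  have "card (U1 i) \<in> {q, q + 1}" "card (U2 i) \<in> {q, q + 1}" if "i < 3" for i
    using U1(4) U2(4) q that by fastforce+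
  then have "card (U1 0) = card (U2 0) \<and> card (U1 1) = card (U2 1) \<and> card (U1 2) = card (U2 2)"
    using apex_tripartite_card[OF sg(1) U1(1)] apex_tripartite_card[OF sg(2) U2(1)] cW cV
    by (intro sorted_near_equal[of _ q, OF _ _ _ _ _ _ U1(2,3) U2(2,3)]) auto
  then show ?thesis
    by (intro apex_tripartite_iso_aux[OF sg U1(1) U2(1) cW]) (simp add: all_less_3)
qed

section \<open>The classes and the edge number of H(n, 3, s + 1)\<close>

lemma card_residue_class: "card {j. j < N \<and> j mod 3 = i} = (N + 2 - i) div 3" if "i < 3" for i :: nat
proof (induction N)
  case 0
  have "i = 0 \<or> i = 1 \<or> i = 2" using that by auto
  then show ?case by auto
next
  case (Suc N)
  have i: "i = 0 \<or> i = 1 \<or> i = 2" using that by auto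
  have "{j. j < Suc N \<and> j mod 3 = i} = {j. j < N \<and> j mod 3 = i} \<union> (if N mod 3 = i then {N} else {})"
    by (auto simp: less_Suc_eq)
  then have "card {j. j < Suc N \<and> j mod 3 = i} = card {j. j < N \<and> j mod 3 = i} + (if N mod 3 = i then 1 else 0)"
    by simp
  also have "\<dots> = (Suc N + 2 - i) div 3"
    unfolding Suc using i by (elim disjE; simp; presburger)
  finally show ?case .
qed

definition H_class :: "nat \<Rightarrow> nat \<Rightarrow> (nat + nat) set" where
  "H_class N i = Inr ` {j. j < N \<and> j mod 3 = i}"

lemma verts_H: "verts (H_graph n 3 (s + 1)) = Inl ` {..<s} \<union> Inr ` {..<n - s}"
  by (simp add: H_graph_def graph_join_def complete_graph_def turan_graph_def)

lemma simple_H: "simple_graph (H_graph n 3 (s + 1))"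
  unfolding simple_graph_def
  by (auto simp: H_graph_def graph_join_def complete_graph_def turan_graph_def card_image card_2_iff)

lemma nbrs_H:
  "b \<in> nbrs (H_graph n 3 (s + 1)) a \<longleftrightarrow> (case (a, b) of
     (Inl i, Inl j) \<Rightarrow> i < s \<and> j < s \<and> i \<noteq> j
   | (Inl i, Inr j) \<Rightarrow> i < s \<and> j < n - s
   | (Inr i, Inl j) \<Rightarrow> i < n - s \<and> j < s
   | (Inr i, Inr j) \<Rightarrow> i < n - s \<and> j < n - s \<and> i mod 3 \<noteq> j mod 3)"
proof -
  have imL: "(Inl ` e :: (nat + nat) set) = {Inl i, Inl j} \<longleftrightarrow> e = {i, j}" for e i j
    using inj_image_eq_iff[of Inl e "{i, j}"] by simp
  have imR: "(Inr ` e :: (nat + nat) set) = {Inr i, Inr j} \<longleftrightarrow> e = {i, j}" for e i j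
    using inj_image_eq_iff[of Inr e "{i, j}"] by simp
  have n: "(Inl ` e :: (nat + nat) set) \<noteq> {x, Inr j}" "(Inl ` e :: (nat + nat) set) \<noteq> {Inr j, x}"
    "(Inr ` e :: (nat + nat) set) \<noteq> {x, Inl j}" "(Inr ` e :: (nat + nat) set) \<noteq> {Inl j, x}" for e x j
    by blast+
  show ?thesis
    unfolding nbrs_def H_graph_def graph_join_def complete_graph_def turan_graph_def
    by (cases a; cases b)
      (auto simp: image_iff imL imR n doubleton_eq_iff card_2_iff eq_commute[of "{_, _}" "_ ` _"])
qed

lemma H_apex_tripartite:
  "apex_tripartite (H_graph n 3 (s + 1)) (Inl ` {..<s}) (H_class (n - s))"
  unfolding apex_tripartite_def
proof (intro conjI allI impI ballI)
  show "verts (H_graph n 3 (s + 1)) = Inl ` {..<s} \<union> H_class (n - s) 0 \<union> H_class (n - s) 1 \<union> H_class (n - s) 2"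
  proof -
    have "j mod 3 = 0 \<or> j mod 3 = 1 \<or> j mod 3 = 2" for j :: nat by linarith
    then have "{..<n - s} = {j. j < n - s \<and> j mod 3 = 0} \<union> {j. j < n - s \<and> j mod 3 = 1} \<union> {j. j < n - s \<and> j mod 3 = 2}"
      by auto
    then show ?thesis unfolding verts_H H_class_def image_Un[symmetric] Un_assoc by metis
  qed
  show "nbrs (H_graph n 3 (s + 1)) x = verts (H_graph n 3 (s + 1)) - {x}" if "x \<in> Inl ` {..<s}" for x
  proof (rule set_eqI)
    fix y show "y \<in> nbrs (H_graph n 3 (s + 1)) x \<longleftrightarrow> y \<in> verts (H_graph n 3 (s + 1)) - {x}"
      unfolding nbrs_H verts_H using that by (cases y) auto
  qed
  show "nbrs (H_graph n 3 (s + 1)) x = verts (H_graph n 3 (s + 1)) - H_class (n - s) i"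
    if "i < 3" "x \<in> H_class (n - s) i" for i x
  proof (rule set_eqI)
    fix y show "y \<in> nbrs (H_graph n 3 (s + 1)) x \<longleftrightarrow> y \<in> verts (H_graph n 3 (s + 1)) - H_class (n - s) i"
      unfolding nbrs_H verts_H using that by (cases y) (auto simp: H_class_def)
  qed
qed (auto simp: H_class_def)

lemma card_H_class: "i < 3 \<Longrightarrow> card (H_class N i) = (N + 2 - i) div 3"
  by (simp add: H_class_def card_image card_residue_class)

lemma card_verts_H: "s \<le> n \<Longrightarrow> card (verts (H_graph n 3 (s + 1))) = n"
  unfolding verts_H by (subst card_Un_disjoint) (auto simp: card_image)

lemma card_edges_H:
  assumes "s \<le> n"
  shows "2 * card (edges (H_graph n 3 (s + 1))) = join_count s n"
proof -
  let ?H = "H_graph n 3 (s + 1)" and ?W = "Inl ` {..<s} :: (nat + nat) set" and ?U = "H_class (n - s)"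
  note ap = H_apex_tripartite[of n s]
  have W: "nbrs ?H x = verts ?H - {x}" if "x \<in> ?W" for x using ap that unfolding apex_tripartite_def by blast
  have U: "nbrs ?H x = verts ?H - ?U i" if "i < 3" "x \<in> ?U i" for i x using ap that unfolding apex_tripartite_def by blast
  have m: "(\<Sum>x\<in>?W. card (verts ?H - {x} - nbrs ?H x)) = 0" using W by simp
  have m': "(\<Sum>i<3. \<Sum>x\<in>?U i. card (verts ?H - ?U i - nbrs ?H x)) = 0" using U by simp
  have "pairs ?H (?U i) (?U i) = 0" if "i < 3" for i
  proof -
    have "nbrs ?H x \<inter> ?U i = {}" if "x \<in> ?U i" for x using U[OF \<open>i < 3\<close> that] by blast
    then show ?thesis by (simp add: pairs_def)
  qed
  then have p: "(\<Sum>i<3. pairs ?H (?U i) (?U i)) = 0" by simp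
  have sizes: "card (?U 0) = (n - s + 2) div 3" "card (?U 1) = (n - s + 1) div 3" "card (?U 2) = (n - s) div 3"
    by (simp_all add: card_H_class)
  have cW: "card ?W = s" by (simp add: card_image)
  have "2 * card (edges ?H) + ((\<Sum>x\<in>?W. card (verts ?H - {x} - nbrs ?H x)) + (\<Sum>i<3. \<Sum>x\<in>?U i. card (verts ?H - ?U i - nbrs ?H x)))
    = card ?W * (card ?W - 1) + 2 * card ?W * (card (verts ?H) - card ?W) +
      2 * (card (?U 0) * card (?U 1) + card (?U 1) * card (?U 2) + card (?U 2) * card (?U 0)) +
      (\<Sum>i<3. pairs ?H (?U i) (?U i))"
    by (rule edge_balance(1)[OF simple_H]) (use ap in \<open>auto simp: apex_tripartite_def\<close>)
  then show ?thesis
    unfolding m m' p cW sizes card_verts_H[OF assms]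
    by (simp add: join_count_def turan_number3_def Let_def algebra_simps)
qed

text \<open>\<^const>\<open>extremal_graph\<close> compares only with graphs on natural numbers, hence the copy of \<open>H(n, 3, q)\<close>.\<close>
lemma graph_map_copy:
  assumes sg: "simple_graph H" and inj: "inj g" and free: "graph_free F H" and F: "simple_graph F"
  shows "simple_graph (graph_map g H)" "card (verts (graph_map g H)) = card (verts H)"
    "card (edges (graph_map g H)) = card (edges H)" "graph_free F (graph_map g H)"
proof -
  show "simple_graph (graph_map g H)"
    using sg inj by (auto simp: simple_graph_def graph_map_def card_image inj_on_subset)
  show "card (verts (graph_map g H)) = card (verts H)"
    using inj by (simp add: graph_map_def card_image inj_on_subset)
  show "card (edges (graph_map g H)) = card (edges H)"
    unfolding graph_map_def using inj by (simp add: card_image inj_on_def inj_image_eq_iff)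
  have "\<not> embeds F (graph_map g H) \<phi>" for \<phi>
  proof
    assume emb: "embeds F (graph_map g H) \<phi>"
    have "embeds F H (inv g \<circ> \<phi>)"
      unfolding embeds_def
    proof (intro conjI ballI)
      have im: "\<phi> ` verts F \<subseteq> range g" using emb by (auto simp: embeds_def graph_map_def)
      show "inj_on (inv g \<circ> \<phi>) (verts F)"
        using emb im by (intro comp_inj_on inj_on_inv_into) (auto simp: embeds_def)
      show "(inv g \<circ> \<phi>) ` verts F \<subseteq> verts H"
        using emb inj by (fastforce simp: embeds_def graph_map_def)
      fix e assume "e \<in> edges F"
      then obtain e' where "e' \<in> edges H" "\<phi> ` e = g ` e'" using emb by (auto simp: embeds_def graph_map_def)
      moreover have "(inv g \<circ> \<phi>) ` e = inv g ` (\<phi> ` e)" by (rule image_comp[symmetric])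
      ultimately show "(inv g \<circ> \<phi>) ` e \<in> edges H" using inj by (simp only: image_inv_f_f)
    qed
    then show False using free graph_free_iff[OF F] by blast
  qed
  then show "graph_free F (graph_map g H)" using graph_free_iff[OF F] by blast
qed

text \<open>H(n, 3, s + 1) attains \<open>join_count s n\<close>, and by
  \<open>large_structure\<close> no graph without the blow-up exceeds this. An extremal graph on
  naturals has at least as many edges as a copy of H on naturals, so it attains the same value, and
  its classes have the same sizes as those of H up to order.\<close>

lemma (in odd_lollipop) unique_extremal:
  defines "s \<equiv> (k + l - 1) div 2"
  shows "\<exists>N. \<forall>n\<ge>N. unique_extremal_graph F n (H_graph n 3 (s + 1))"
proof -
  obtain N where N: "\<And>G :: nat graph. simple_graph G \<Longrightarrow> graph_free F G \<Longrightarrow> card (verts G) \<ge> N \<Longrightarrow>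
    join_count s (card (verts G)) \<le> 2 * card (edges G) \<Longrightarrow>
    2 * card (edges G) = join_count s (card (verts G)) \<and>
    (\<exists>W U. apex_tripartite G W U \<and> card W = s \<and>
      (\<forall>i<3. card (U i) \<in> {(card (verts G) - s) div 3, (card (verts G) - s) div 3 + 1}))"
    using large_structure[where 'a = nat] unfolding s_def by blast
  show ?thesis
  proof (rule exI[of _ "max N s"], intro allI impI)
    fix n assume n: "max N s \<le> n"
    then have sn: "s \<le> n" by simp
    let ?H = "H_graph n 3 (s + 1)"
    have cW: "card (Inl ` {..<s} :: (nat + nat) set) = s" by (simp add: card_image)
    have freeH: "graph_free F ?H"
      by (rule apex_tripartite_free[OF simple_H H_apex_tripartite]) (simp only: cW, simp only: s_def)
    have le: "card (edges G) \<le> card (edges ?H)" if "simple_graph G" "card (verts G) = n" "graph_free F G" for G :: "nat graph"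
      using N[OF that(1,3)] that(2) n card_edges_H[OF sn] by fastforce
    have "extremal_graph F n ?H"
      unfolding extremal_graph_def using simple_H card_verts_H[OF sn] freeH le by blast
    moreover have "G \<simeq> ?H" if G: "extremal_graph F n G" for G :: "nat graph"
    proof -
      define g :: "nat + nat \<Rightarrow> nat" where "g x = (case x of Inl i \<Rightarrow> 2 * i | Inr i \<Rightarrow> 2 * i + 1)" for x
      have "inj g"
      proof (rule injI)
        fix x y assume "g x = g y"
        then show "x = y" by (cases x; cases y) (simp_all add: g_def, presburger+)
      qed
      note copy = graph_map_copy[OF simple_H this freeH simple_blow_up]
      have Gs: "simple_graph G" "card (verts G) = n" "graph_free F G" using G by (auto simp: extremal_graph_def)
      have "card (edges (graph_map g ?H)) \<le> card (edges G)"
        using G copy card_verts_H[OF sn] unfolding extremal_graph_def by metis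
      then have "join_count s (card (verts G)) \<le> 2 * card (edges G)"
        using copy(3) card_edges_H[OF sn] Gs(2) by simp
      from N[OF Gs(1,3) _ this] n Gs(2) obtain W U where WU: "apex_tripartite G W U" "card W = s"
        "\<forall>i<3. card (U i) \<in> {(n - s) div 3, (n - s) div 3 + 1}" by auto
      have "\<forall>i<3. card (H_class (n - s) i) \<in> {(n - s) div 3, (n - s) div 3 + 1}"
        unfolding all_less_3 by (simp add: card_H_class) presburger
      then show ?thesis
        using apex_tripartite_iso[OF Gs(1) simple_H WU(1) H_apex_tripartite _ _ WU(3)] WU(2) cW Gs(2) card_verts_H[OF sn] by simp
    qed
    ultimately show "unique_extremal_graph F n ?H" unfolding unique_extremal_graph_def by blast
  qed
qed

theorem theorem3p1:
  fixes k l t :: nat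
  assumes "k \<ge> 3" and "odd k" and "l \<ge> 2"
    and "t = (k - 1) div 2 + (l - 1) div 2"
  shows "\<exists>N. \<forall>n\<ge>N.
    (odd l \<longrightarrow>
       unique_extremal_graph (edge_blow_up 3 (lollipop k l)) n (H_graph n 3 (t + 1))) \<and>
    (even l \<longrightarrow>
       unique_extremal_graph (edge_blow_up 3 (lollipop k l)) n (H_graph n 3 (t + 2)))"
proof -
  interpret odd_lollipop k l using assms by unfold_locales
  obtain h where h: "k = 2 * h + 1" using assms(2) oddE by blast
  \<comment> \<open>With k = 2 h + 1 the number of apices is h + \<open>l div 2\<close>, and
    \<open>l div 2\<close> exceeds \<open>(l - 1) div 2\<close> by one exactly when l is
    even.\<close>
  have "(k + l - 1) div 2 = t" if odd: "odd l"
  proof -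
    obtain r where "l = 2 * r + 1" using odd oddE by blast
    then show ?thesis using assms(4) h by simp
  qed
  moreover have "(k + l - 1) div 2 = t + 1" if even: "even l"
  proof -
    obtain r where "l = 2 * r" using even evenE by blast
    moreover from this obtain r' where "r = Suc r'" using assms(3) by (cases r) auto
    ultimately show ?thesis using assms(4) h by simp
  qed
  ultimately show ?thesis using unique_extremal by (cases "even l") auto
qed

end
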